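(* Let $f_i$ ($i=0,1$) be the $0$-harmonic function on the Sierpinski gasket $K$ taking value $1$ at the vertex $p_i$ and $0$ at the other two vertices of $V_0$. Then the smooth 1-form $f_0\,df_1$ is not locally exact; indeed, all the coefficients $k_\sigma$, $\sigma\in\Sigma$, in the Hodge decomposition $f_0\,df_1=dU_E+\sum_{\sigma}k_\sigma\,dz_\sigma$ are non-zero.
   Context: Sierpinski gasket: $p_0=(0,0)$, $p_1=(\frac12,\frac{\sqrt3}2)$, $p_2=(1,0)$, $V_0=\{p_0,p_1,p_2\}$, $w_i(x)=p_i+\frac12(x-p_i)$; $K\subset\mathbb R^2$ is the unique nonempty compact set with $K=\bigcup_iw_i(K)$. $\Sigma=\bigcup_m\{0,1,2\}^m$ is the set of finite words, $|\sigma|$ the length, $w_\sigma=w_{\sigma_1}\circ\dots\circ w_{\sigma_m}$, cell $C_\sigma=w_\sigma(K)$. $E_0$ is the set of sides of the triangle $p_0p_1p_2$, $E_m=\bigcup_{|\sigma|=m}w_\sigma(E_0)$, $E_*=\bigcup_mE_m$; an oriented edge has source $e_-$, target $e_+$. Lacunas: $\ell_\sigma=w_\sigma(\ell_\emptyset)$, $\ell_\emptyset$ the boundary of the triangle with vertices the midpoints of the sides of $p_0p_1p_2$, traversed clockwise. Energy: for real-valued $f\in C(K)$, $\mathcal E[f]=\lim_m(5/3)^m\sum_{e\in E_m}|f(e_+)-f(e_-)|^2$; $\mathcal F=\{f\in C(K):\mathcal E[f]<\infty\}$; $\mathcal E(\cdot,\cdot)$ the bilinear form; on a cell $C$, $\mathcal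 E_C[f]$ is the same limit with sum over edges in $C$. A $0$-harmonic function is the unique minimizer of $\mathcal E$ in $\mathcal F$ among functions with given values on $V_0$. The energy measure $\mu(f,g)$ is given by $\int_Kh\,d\mu(f,g)=\frac12(\mathcal E(f,gh)-\mathcal E(fg,h)+\mathcal E(hf,g))$. Forms: $\Omega^1(\mathcal F)\subset\mathcal F\otimes\mathcal F$ is the $\mathcal F$-bimodule generated by the elements $f\,dg$, $dg=g\otimes1-1\otimes g$; $Q(f\,dg,h\,dk)=\int_Kfh\,d\mu(g,k)$ extended bilinearly; $\mathcal H$ is the Hilbert space obtained from $(\Omega^1(\mathcal F),Q)$ by separation and completion, $\Omega^1(K)=\Omega^1(\mathcal F)/\{Q=0\}\subset\mathcal H$ (smooth 1-forms). For an elementary path $\gamma$ (finite concatenation of consecutive oriented edges in $E_*$) and $\omega=\sum_if_i\,dg_i$, $\int_\gamma\omega=\lim_n\sum_e\sum_if_i(e_+)(g_i(e_+)-g_i(e_-))$, sum over level-$n$ edges of $\gamma$ oriented as $\gamma$; it is well defined on $\Omega^1(K)$. $\omega\in\Omega^1(K)$ is $n$-exact if for each $|\sigma|=n$ there is a continuous $f_\sigma$ on $C_\sigma$ with $\mathcal E_{C_\sigma}[f_\sigma]<\infty$ and $\int_\gamma\omega=f_\sigma(\gamma(1))-f_\sigma(\gamma(0))$ for elementary $\gamma\subset C_\sigma$ (local potential); locally exact means $n$-exact for some $n$. The forms $dz_\sigma$: for $|\sigma|=n$, $dz_\sigma$ is the $(n+1)$-exact form minimizing $Q^{1/2}$ among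 the $(n+1)$-exact $\omega$ with $\int_{\ell_\sigma}\omega=1$. Explicitly, it vanishes on $C_\tau$ for $|\tau|=n,\tau\ne\sigma$, and on $C_{\sigma i}$ its local potential is the harmonic function (energy minimizer given its values at the three vertices of $C_{\sigma i}$) equal to $0$ at $w_\sigma(p_i)$ and $\pm\frac16$ at the other two vertices, with increment $+\frac13$ along the side of $\ell_\sigma$ in $C_{\sigma i}$ traversed clockwise. Hodge decomposition: every $\omega\in\mathcal H$ is uniquely an orthogonal sum $\omega=dU_E+\sum_\sigma k_\sigma dz_\sigma$ with $U_E\in\mathcal F$ (convergence in $\mathcal H$). *)

theory Defs
  imports "HOL-Analysis.Analysis"
begin

section \<open>The gasket\<close>

type_synonym pt = "real \<times> real"

definition p :: "nat \<Rightarrow> pt" where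
  "p i = (if i = 0 then (0, 0) else if i = 1 then (1/2, sqrt 3 / 2) else (1, 0))"

definition V0 :: "pt set" where
  "V0 = {p 0, p 1, p 2}"

definition w :: "nat \<Rightarrow> pt \<Rightarrow> pt" where
  "w i x = p i + (1/2) *\<^sub>R (x - p i)"

definition K :: "pt set" where
  "K = (THE X. compact X \<and> X \<noteq> {} \<and> X = (\<Union>i\<in>{0,1,2}. w i ` X))"

definition Words :: "nat list set" where
  "Words = {\<sigma>. set \<sigma> \<subseteq> {0,1,2}}"

fun wmap :: "nat list \<Rightarrow> pt \<Rightarrow> pt" where
  "wmap [] = id"
| "wmap (i # \<sigma>) = w i \<circ> wmap \<sigma>"

definition cell :: "nat list \<Rightarrow> pt set" where
  "cell \<sigma> = wmap \<sigma> ` K"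

section \<open>Edges and elementary paths\<close>

text \<open>An oriented edge is a pair (source, target). The set \<open>edges m\<close> contains every edge of level
  \<open>m\<close> exactly once, with the clockwise orientation of its cell; \<open>oedges m\<close> contains every edge of
  level \<open>m\<close> with both of its orientations.\<close>

definition edges :: "nat \<Rightarrow> (pt \<times> pt) set" where
  "edges m = (\<Union>\<sigma>\<in>{\<sigma>\<in>Words. length \<sigma> = m}.
     map_prod (wmap \<sigma>) (wmap \<sigma>) ` {(p 0, p 1), (p 1, p 2), (p 2, p 0)})"

definition oedges :: "nat \<Rightarrow> (pt \<times> pt) set" where
  "oedges m = edges m \<union> prod.swap ` edges m"

definition seg :: "pt \<times> pt \<Rightarrow> pt set" where
  "seg e = closed_segment (fst e) (snd e)"

definition elementary_path :: "(pt \<times> pt) list \<Rightarrow> bool" where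
  "elementary_path \<gamma> \<longleftrightarrow> \<gamma> \<noteq> [] \<and> set \<gamma> \<subseteq> (\<Union>m. oedges m) \<and>
     (\<forall>j. Suc j < length \<gamma> \<longrightarrow> snd (\<gamma> ! j) = fst (\<gamma> ! Suc j))"

definition epath_image :: "(pt \<times> pt) list \<Rightarrow> pt set" where
  "epath_image \<gamma> = (\<Union>e\<in>set \<gamma>. seg e)"

text \<open>The level-\<open>n\<close> edges lying on the edge \<open>e\<close>, oriented as \<open>e\<close>. For \<open>n\<close> at least the level of
  \<open>e\<close> these are the edges into which \<open>e\<close> is subdivided.\<close>

definition edges_along :: "nat \<Rightarrow> pt \<times> pt \<Rightarrow> (pt \<times> pt) set" where
  "edges_along n e = {e' \<in> oedges n. seg e' \<subseteq> seg e \<and>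
     0 < (snd e' - fst e') \<bullet> (snd e - fst e)}"

text \<open>The clockwise boundary of the central triangle of \<open>\<sigma>\<close>. Here \<open>w 0 (p 1)\<close>, \<open>w 1 (p 2)\<close> and
  \<open>w 2 (p 0)\<close> are the midpoints of the left, right and bottom side of the triangle; each edge is a
  side of one of the subcells \<open>1\<close>, \<open>2\<close>, \<open>0\<close>.\<close>

definition lacuna :: "nat list \<Rightarrow> (pt \<times> pt) list" where
  "lacuna \<sigma> = map (map_prod (wmap \<sigma>) (wmap \<sigma>))
     [(w 0 (p 1), w 1 (p 2)), (w 1 (p 2), w 2 (p 0)), (w 2 (p 0), w 0 (p 1))]"

section \<open>Energy\<close>

definition energy :: "(pt \<Rightarrow> real) \<Rightarrow> ereal" where
  "energy f = lim (\<lambda>m. ereal ((5/3)^m * (\<Sum>e\<in>edges m. \<bar>f (snd e) - f (fst e)\<bar>\<^sup>2)))"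

definition energy_on :: "pt set \<Rightarrow> (pt \<Rightarrow> real) \<Rightarrow> ereal" where
  "energy_on C f = lim (\<lambda>m. ereal ((5/3)^m *
     (\<Sum>e\<in>{e\<in>edges m. seg e \<subseteq> C}. \<bar>f (snd e) - f (fst e)\<bar>\<^sup>2)))"

text \<open>Elements of \<open>C(K)\<close> are represented by functions on the whole plane; only their values on
  \<open>K\<close> matter.\<close>

definition FF :: "(pt \<Rightarrow> real) set" where
  "FF = {f. continuous_on K f \<and> energy f < \<infinity>}"

definition energy_form :: "(pt \<Rightarrow> real) \<Rightarrow> (pt \<Rightarrow> real) \<Rightarrow> real" where
  "energy_form f g = lim (\<lambda>m. (5/3)^m *
     (\<Sum>e\<in>edges m. (f (snd e) - f (fst e)) * (g (snd e) - g (fst e))))"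

definition harmonic0 :: "(pt \<Rightarrow> real) \<Rightarrow> bool" where
  "harmonic0 u \<longleftrightarrow> u \<in> FF \<and> (\<forall>v\<in>FF. (\<forall>x\<in>V0. v x = u x) \<longrightarrow> energy u \<le> energy v)"

text \<open>The integral of \<open>h \<in> FF\<close> against the (signed) energy measure of \<open>f\<close> and \<open>g\<close>, by the formula
  that defines this measure. Since \<open>FF\<close> is an algebra, only integrands in \<open>FF\<close> occur below.\<close>

definition energy_measure_integral ::
    "(pt \<Rightarrow> real) \<Rightarrow> (pt \<Rightarrow> real) \<Rightarrow> (pt \<Rightarrow> real) \<Rightarrow> real" where
  "energy_measure_integral h f g =
     (energy_form f (\<lambda>x. g x * h x) - energy_form (\<lambda>x. f x * g x) h
        + energy_form (\<lambda>x. h x * f x) g) / 2"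

section \<open>1-forms\<close>

text \<open>The algebraic tensor product \<open>FF \<otimes> FF\<close> is identified with a space of functions on \<open>K \<times> K\<close>
  (extended by zero) via \<open>(a \<otimes> b)(x, y) = a(x) b(y)\<close>, which is injective. With
  \<open>dg = g \<otimes> 1 - 1 \<otimes> g\<close> the element \<open>f dg\<close> becomes \<open>f(x) (g(x) - g(y))\<close>. By the Leibniz rule
  \<open>(f dg) h = f d(gh) - fg dh\<close>, the bimodule generated by these elements consists of their
  finite sums.\<close>

type_synonym form = "pt \<Rightarrow> pt \<Rightarrow> real"

definition fdg :: "(pt \<Rightarrow> real) \<Rightarrow> (pt \<Rightarrow> real) \<Rightarrow> form" where
  "fdg f g = (\<lambda>x y. if x \<in> K \<and> y \<in> K then f x * (g x - g y) else 0)"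

definition form_of :: "((pt \<Rightarrow> real) \<times> (pt \<Rightarrow> real)) list \<Rightarrow> form" where
  "form_of ps = (\<lambda>x y. \<Sum>(f, g)\<leftarrow>ps. fdg f g x y)"

definition Omega1 :: "form set" where
  "Omega1 = {form_of ps | ps. set ps \<subseteq> FF \<times> FF}"

text \<open>The bilinear extension of \<open>Q(f dg, h dk) = \<integral> fh d\<mu>(g, k)\<close>.\<close>

definition Q :: "form \<Rightarrow> form \<Rightarrow> real" where
  "Q \<omega> \<eta> = (THE q. \<exists>ps qs. set ps \<subseteq> FF \<times> FF \<and> set qs \<subseteq> FF \<times> FF \<and>
     form_of ps = \<omega> \<and> form_of qs = \<eta> \<and>
     q = (\<Sum>(f, g)\<leftarrow>ps. \<Sum>(h, k)\<leftarrow>qs. energy_measure_integral (\<lambda>x. f x * h x) g k))"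

definition Qnorm :: "form \<Rightarrow> real" where
  "Qnorm \<omega> = sqrt (Q \<omega> \<omega>)"

text \<open>Elements of \<open>\<Omega>\<^sup>1(K)\<close> are represented by elements of \<open>Omega1\<close>; two of them represent the same
  smooth form iff their difference has \<open>Qnorm\<close> zero, and the norm of the Hilbert space completion,
  restricted to smooth forms, is \<open>Qnorm\<close>.\<close>

text \<open>For \<open>\<omega> = \<Sum> f\<^sub>i dg\<^sub>i\<close> and an edge \<open>e\<close> with source \<open>e\<^sub>-\<close> and target \<open>e\<^sub>+\<close>, the number
  \<open>\<Sum> f\<^sub>i(e\<^sub>+) (g\<^sub>i(e\<^sub>+) - g\<^sub>i(e\<^sub>-))\<close> is the value \<open>\<omega> e\<^sub>+ e\<^sub>-\<close>.\<close>

definition path_integral :: "(pt \<times> pt) list \<Rightarrow> form \<Rightarrow> real" where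
  "path_integral \<gamma> \<omega> = lim (\<lambda>n. \<Sum>e\<leftarrow>\<gamma>. \<Sum>e'\<in>edges_along n e. \<omega> (snd e') (fst e'))"

definition n_exact :: "nat \<Rightarrow> form \<Rightarrow> bool" where
  "n_exact n \<omega> \<longleftrightarrow> \<omega> \<in> Omega1 \<and>
     (\<forall>\<sigma>\<in>Words. length \<sigma> = n \<longrightarrow>
       (\<exists>f. continuous_on (cell \<sigma>) f \<and> energy_on (cell \<sigma>) f < \<infinity> \<and>
         (\<forall>\<gamma>. elementary_path \<gamma> \<and> epath_image \<gamma> \<subseteq> cell \<sigma> \<longrightarrow>
           path_integral \<gamma> \<omega> = f (snd (last \<gamma>)) - f (fst (hd \<gamma>)))))"

definition locally_exact :: "form \<Rightarrow> bool" where
  "locally_exact \<omega> \<longleftrightarrow> (\<exists>n. n_exact n \<omega>)"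

text \<open>The minimizer is unique up to forms of \<open>Qnorm\<close> zero; \<open>dz \<sigma>\<close> is a representative of it.\<close>

definition dz :: "nat list \<Rightarrow> form" where
  "dz \<sigma> = arg_min Qnorm (\<lambda>\<omega>. n_exact (Suc (length \<sigma>)) \<omega> \<and> path_integral (lacuna \<sigma>) \<omega> = 1)"

text \<open>\<open>\<omega> = dU + \<Sum>\<^sub>\<sigma> k\<^sub>\<sigma> dz\<^sub>\<sigma>\<close> for a smooth form \<open>\<omega>\<close>, with (unconditional) convergence in the Hilbert
  space: all partial sums and remainders are smooth forms, so their norms are given by \<open>Qnorm\<close>.\<close>

definition hodge_decomposition ::
    "form \<Rightarrow> (pt \<Rightarrow> real) \<Rightarrow> (nat list \<Rightarrow> real) \<Rightarrow> bool" where
  "hodge_decomposition \<omega> U k \<longleftrightarrow> U \<in> FF \<and>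
     ((\<lambda>A. Qnorm (\<lambda>x y. \<omega> x y - fdg (\<lambda>_. 1) U x y - (\<Sum>\<sigma>\<in>A. k \<sigma> * dz \<sigma> x y))) \<longlongrightarrow> 0)
       (finite_subsets_at_top Words)"

end

theory Submission imports Defs begin

text \<open>
  The pairing \<open>Q\<close> of smooth forms is a limit of sums over oriented edges,
  \<open>Q(\<omega>, \<eta>) = lim (5/3)^m \<Sum> (\<omega> y x * \<eta> y x + \<omega> x y * \<eta> x y) / 2\<close>, because
  \<open>(h x + h y) / 2 * \<Delta>f * \<Delta>g\<close> is the polarized expression in the definition of the energy measure.
  The form \<open>dz \<sigma>\<close> is given on the three children of the cell \<open>\<sigma>\<close> by harmonic potentials, so pairing it
  with a form that has local potentials on these children yields a multiple of the period around the
  lacuna. Hence the explicit form is the minimizer, these forms are orthogonal to each other and to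
  all \<open>dU\<close>, and \<open>k \<sigma>\<close> is a positive multiple of \<open>Q(f0 df1, dz \<sigma>)\<close>.
  On harmonic functions \<open>f\<close>, \<open>g\<close> the number \<open>Q(f dg, dz \<sigma>)\<close> is alternating, hence a multiple of the
  determinant of the increments of \<open>f\<close>, \<open>g\<close> on the cell; harmonic extension to a child multiplies
  this determinant by \<open>3/25\<close>, so it never vanishes. If \<open>f0 df1\<close> were \<open>n\<close>-exact, its pairing with
  \<open>dz \<sigma>\<close> for \<open>|\<sigma>| = n\<close> would be zero.
\<close>

section \<open>Geometry of the gasket\<close>

text \<open>An exact form is known only through its path integrals, whereas \<open>Q\<close> is a
  limit over the edge values \<open>\<omega> y x\<close>. A comparison of rates bridges the two.
  Summed over level \<open>m\<close>, \<open>\<omega>\<close> differs from its edge integrals, and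
  from an antisymmetric function, by O((3/5)^m); the factor (5/3)^m leaves this merely bounded. For
  fixed \<sigma>, however, \<open>dz_form \<sigma>\<close> is antisymmetric on fine edges and has
  size O((3/5)^m) on each of them, and this additional decay removes the error.

  Once edge integrals are increments of a potential, harmonicity of the potential of
  \<open>dz_form \<sigma>\<close> collapses each level sum to corner values of the three children,
  so the sequence is constant.

  The minimizer \<open>dz \<sigma>\<close> is a choice among forms at Q-distance zero from each
  other. Its values are therefore never computed, only its pairings, which agree with those of
  \<open>dz_form \<sigma>\<close>.

  The factor 3/25 is (3/5) * (1/5), the product of the two nontrivial eigenvalues of the map from
  the corner values of a cell to those of a child.\<close>

text \<open>Coordinates with respect to the basis \<open>p 1\<close>, \<open>p 2\<close> of the plane.\<close>

definition cA :: "pt \<Rightarrow> real" where "cA x = 2 / sqrt 3 * snd x"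
definition cB :: "pt \<Rightarrow> real" where "cB x = fst x - snd x / sqrt 3"

lemma coord_eqI: "cA x = cA y \<Longrightarrow> cB x = cB y \<Longrightarrow> x = y"
  by (auto simp: cA_def cB_def prod_eq_iff)

lemma coord_eq_iff: "x = y \<longleftrightarrow> cA x = cA y \<and> cB x = cB y"
  using coord_eqI by blast

lemma cA_simps [simp]: "cA (x + y) = cA x + cA y" "cA (x - y) = cA x - cA y"
    "cA (c *\<^sub>R x) = c * cA x" "cA (- x) = - cA x" "cA 0 = 0"
  by (auto simp: cA_def algebra_simps add_divide_distrib diff_divide_distrib)

lemma cB_simps [simp]: "cB (x + y) = cB x + cB y" "cB (x - y) = cB x - cB y"
    "cB (c *\<^sub>R x) = c * cB x" "cB (- x) = - cB x" "cB 0 = 0"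
  by (auto simp: cB_def algebra_simps add_divide_distrib diff_divide_distrib)

lemma cA_p: "cA (p i) = of_bool (i = 1)"
  by (auto simp: cA_def p_def)

lemma cB_p: "cB (p i) = of_bool (i \<noteq> 0 \<and> i \<noteq> 1)"
  by (auto simp: cB_def p_def)

lemma cA_w: "cA (w i x) = (cA (p i) + cA x) / 2"
  by (simp add: w_def field_simps)

lemma cB_w: "cB (w i x) = (cB (p i) + cB x) / 2"
  by (simp add: w_def field_simps)

definition Tri :: "pt set" where
  "Tri = {x. 0 \<le> cA x \<and> 0 \<le> cB x \<and> cA x + cB x \<le> 1}"

lemma closed_Tri: "closed Tri"
  unfolding Tri_def cA_def cB_def
  by (intro closed_Collect_conj closed_Collect_le continuous_intros) auto

lemma p_in_Tri: "p i \<in> Tri"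
  by (auto simp: Tri_def cA_p cB_p)

lemma w_Tri: "x \<in> Tri \<Longrightarrow> w i x \<in> Tri"
  by (auto simp: Tri_def cA_w cB_w cA_p cB_p field_simps)

lemma w_p_self [simp]: "w i (p i) = p i"
  by (simp add: w_def)

lemma w_p_swap: "w i (p j) = w j (p i)"
  by (rule coord_eqI) (simp_all add: cA_w cB_w)

lemma w_p_midpoint: "w i (p j) = midpoint (p i) (p j)"
  by (rule coord_eqI) (simp_all add: cA_w cB_w midpoint_def)

lemma p_eq_iff: "i < 3 \<Longrightarrow> j < 3 \<Longrightarrow> p i = p j \<longleftrightarrow> i = j"
  by (auto simp: coord_eq_iff cA_p cB_p)

lemma inj_w: "w i x = w i y \<Longrightarrow> x = y"
  by (simp add: w_def)

lemma continuous_w: "continuous_on A (w i)"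
  unfolding w_def by (intro continuous_intros)

text \<open>Two of the three half-size triangles touch only at the midpoint of a side. All
  statements about overlapping cells rest on this.\<close>

lemma w_inter:
  assumes "w i x = w j y" "x \<in> Tri" "y \<in> Tri" "i < 3" "j < 3" "i \<noteq> j"
  shows "x = p j" "y = p i"
proof -
  have a: "cA (p i) + cA x = cA (p j) + cA y" "cB (p i) + cB x = cB (p j) + cB y"
    using assms(1) by (auto simp: coord_eq_iff cA_w cB_w)
  have cases: "i = 0 \<or> i = 1 \<or> i = 2" "j = 0 \<or> j = 1 \<or> j = 2"
    using assms by linarith+
  show "x = p j" "y = p i"
    using cases a assms(2,3,6) by (auto simp: coord_eq_iff cA_p cB_p Tri_def)
qed

section \<open>Word maps and the cells of one level\<close>

lemma wmap_append: "wmap (\<sigma> @ \<tau>) x = wmap \<sigma> (wmap \<tau> x)"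
  by (induction \<sigma>) auto

lemma cA_wmap: "cA (wmap \<sigma> x) = cA (wmap \<sigma> 0) + cA x / 2 ^ length \<sigma>"
  by (induction \<sigma>) (auto simp: cA_w field_simps)

lemma cB_wmap: "cB (wmap \<sigma> x) = cB (wmap \<sigma> 0) + cB x / 2 ^ length \<sigma>"
  by (induction \<sigma>) (auto simp: cB_w field_simps)

lemma wmap_affine: "wmap \<sigma> x = wmap \<sigma> 0 + (1 / 2 ^ length \<sigma>) *\<^sub>R x"
  by (rule coord_eqI) (simp_all add: cA_wmap[of \<sigma> x] cB_wmap[of \<sigma> x])

lemma wmap_diff: "wmap \<sigma> y - wmap \<sigma> x = (1 / 2 ^ length \<sigma>) *\<^sub>R (y - x)"
  by (simp add: wmap_affine[of \<sigma> x] wmap_affine[of \<sigma> y] scaleR_diff_right)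

lemma dist_wmap: "dist (wmap \<sigma> x) (wmap \<sigma> y) = dist x y / 2 ^ length \<sigma>"
  by (simp add: dist_norm wmap_diff)

lemma wmap_eq_iff [simp]: "wmap \<sigma> x = wmap \<sigma> y \<longleftrightarrow> x = y"
  by (metis dist_wmap dist_eq_0_iff divide_eq_0_iff power_eq_0_iff zero_neq_numeral)

lemma wmap_midpoint: "wmap \<sigma> (midpoint x y) = midpoint (wmap \<sigma> x) (wmap \<sigma> y)"
proof (rule coord_eqI)
  show "cA (wmap \<sigma> (midpoint x y)) = cA (midpoint (wmap \<sigma> x) (wmap \<sigma> y))"
    unfolding cA_wmap[of \<sigma> "midpoint x y"]
    by (simp add: midpoint_def cA_wmap[of \<sigma> x] cA_wmap[of \<sigma> y] field_simps)
  show "cB (wmap \<sigma> (midpoint x y)) = cB (midpoint (wmap \<sigma> x) (wmap \<sigma> y))"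
    unfolding cB_wmap[of \<sigma> "midpoint x y"]
    by (simp add: midpoint_def cB_wmap[of \<sigma> x] cB_wmap[of \<sigma> y] field_simps)
qed

lemma continuous_wmap: "continuous_on A (wmap \<sigma>)"
proof -
  have "continuous_on A (\<lambda>x. wmap \<sigma> 0 + (1 / 2 ^ length \<sigma>) *\<^sub>R x)"
    by (intro continuous_intros)
  then show ?thesis
    using wmap_affine by (metis (no_types, lifting) continuous_on_cong)
qed

definition level_words :: "nat \<Rightarrow> nat list set" where
  "level_words n = {\<sigma> \<in> Words. length \<sigma> = n}"

lemma Words_Cons [simp]: "i # \<sigma> \<in> Words \<longleftrightarrow> i < 3 \<and> \<sigma> \<in> Words"
  by (auto simp: Words_def)

lemma Words_Nil [simp]: "[] \<in> Words"
  by (auto simp: Words_def)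

lemma Words_append [simp]: "\<sigma> @ \<tau> \<in> Words \<longleftrightarrow> \<sigma> \<in> Words \<and> \<tau> \<in> Words"
  by (auto simp: Words_def)

lemma level_words_Nil [simp]: "level_words 0 = {[]}"
  by (auto simp: level_words_def)

lemma level_wordsI: "\<sigma> \<in> Words \<Longrightarrow> length \<sigma> = n \<Longrightarrow> \<sigma> \<in> level_words n"
  by (simp add: level_words_def)

lemma level_wordsD: "\<sigma> \<in> level_words n \<Longrightarrow> \<sigma> \<in> Words" "\<sigma> \<in> level_words n \<Longrightarrow> length \<sigma> = n"
  by (simp_all add: level_words_def)

lemma finite_level_words [simp]: "finite (level_words n)"
proof -
  have "level_words n \<subseteq> {xs. set xs \<subseteq> {0,1,2} \<and> length xs = n}"
    by (auto simp: level_words_def Words_def)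
  then show ?thesis
    by (rule finite_subset) (rule finite_lists_length_eq, simp)
qed

lemma sum_level_words_add:
  "(\<Sum>\<sigma>\<in>level_words (m + k). F \<sigma>) = (\<Sum>\<sigma>\<in>level_words m. \<Sum>\<rho>\<in>level_words k. F (\<sigma> @ \<rho>))"
proof -
  have "(\<Sum>\<sigma>\<in>level_words m. \<Sum>\<rho>\<in>level_words k. F (\<sigma> @ \<rho>))
      = (\<Sum>(\<sigma>, \<rho>)\<in>level_words m \<times> level_words k. F (\<sigma> @ \<rho>))"
    by (simp add: sum.cartesian_product)
  also have "\<dots> = (\<Sum>\<sigma>\<in>level_words (m + k). F \<sigma>)"
    by (rule sum.reindex_bij_witness[where i = "\<lambda>\<sigma>. (take m \<sigma>, drop m \<sigma>)" and j = "\<lambda>(\<sigma>, \<rho>). \<sigma> @ \<rho>"])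
      (auto simp: level_words_def Words_def dest: in_set_takeD in_set_dropD)
  finally show ?thesis by simp
qed

lemma level_words_1: "level_words (Suc 0) = {[0], [1], [2]}"
  by (auto simp: level_words_def Words_def length_Suc_conv)

lemma sum_level_words_Suc:
  "(\<Sum>\<sigma>\<in>level_words (Suc m). F \<sigma>) = (\<Sum>\<sigma>\<in>level_words m. F (\<sigma> @ [0]) + F (\<sigma> @ [1]) + F (\<sigma> @ [2]))"
  for F :: "nat list \<Rightarrow> real"
  using sum_level_words_add[of F m "Suc 0"] by (simp add: level_words_1 add.assoc)

lemma wmap_Tri: "x \<in> Tri \<Longrightarrow> wmap \<sigma> x \<in> Tri"
  by (induction \<sigma>) (auto intro: w_Tri)

text \<open>At the first letter where the words differ, \<open>w_inter\<close> prescribes the common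
  point, so different cells of one level cannot share two points. This is how a cell is recovered
  from any of its edges.\<close>

lemma wmap_inter:
  assumes "\<sigma> \<in> level_words n" "\<tau> \<in> level_words n" "x \<in> Tri" "y \<in> Tri" "x' \<in> Tri" "y' \<in> Tri"
    and "wmap \<sigma> x = wmap \<tau> y" "wmap \<sigma> x' = wmap \<tau> y'" "x \<noteq> x'"
  shows "\<sigma> = \<tau>"
  using assms
proof (induction n arbitrary: \<sigma> \<tau>)
  case 0
  then show ?case by simp
next
  case (Suc n)
  obtain i \<sigma>' j \<tau>' where e: "\<sigma> = i # \<sigma>'" "\<tau> = j # \<tau>'"
    using Suc.prems(1,2) by (auto simp: level_words_def length_Suc_conv)
  have l: "i < 3" "j < 3" "\<sigma>' \<in> level_words n" "\<tau>' \<in> level_words n"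
    using Suc.prems(1,2) e by (auto simp: level_words_def)
  have "i = j"
  proof (rule ccontr)
    assume "i \<noteq> j"
    then have "wmap \<sigma>' x = p j" "wmap \<sigma>' x' = p j"
      using w_inter(1)[of i "wmap \<sigma>' x" j "wmap \<tau>' y"] w_inter(1)[of i "wmap \<sigma>' x'" j "wmap \<tau>' y'"]
        Suc.prems e l wmap_Tri by auto
    then show False
      using Suc.prems(9) by (metis wmap_eq_iff)
  qed
  moreover have "\<sigma>' = \<tau>'"
    using Suc.IH[OF l(3,4) Suc.prems(3-6)] Suc.prems(7-9) e \<open>i = j\<close> inj_w by auto
  ultimately show ?case using e by simp
qed

text \<open>A point of \<open>S\<close> is \<open>wmap \<sigma> z\<close> with \<open>z\<close> in
  \<open>S\<close> for words of every length \<open>n\<close>, and \<open>wmap \<sigma> y0\<close>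
  is a point of \<open>Y\<close> at distance O(2^-n) from it. Used in both directions this gives
  uniqueness of the attractor; used for a segment it puts the sides of the triangle into
  \<open>K\<close>.\<close>

lemma selfsimilar_subset:
  assumes S: "S \<subseteq> (\<Union>i\<in>{0,1,2}. w i ` S)" "bounded S"
    and Y: "closed Y" "Y \<noteq> {}" "\<And>i. i < 3 \<Longrightarrow> w i ` Y \<subseteq> Y"
  shows "S \<subseteq> Y"
proof
  fix x assume x: "x \<in> S"
  obtain y0 where y0: "y0 \<in> Y" using Y by auto
  obtain D where D: "\<And>z. z \<in> S \<Longrightarrow> dist z y0 \<le> D"
    using S(2) bounded_any_center[of S y0] by (auto simp: dist_commute)
  have ex: "\<exists>\<sigma>\<in>level_words n. \<exists>z\<in>S. x = wmap \<sigma> z" for n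
  proof (induction n)
    case 0
    then show ?case using x by auto
  next
    case (Suc n)
    then obtain \<sigma> z where s: "\<sigma> \<in> level_words n" "z \<in> S" "x = wmap \<sigma> z" by auto
    obtain i z' where i: "i \<in> {0,1,2}" "z' \<in> S" "z = w i z'" using S(1) s(2) by blast
    have "\<sigma> @ [i] \<in> level_words (Suc n)" "x = wmap (\<sigma> @ [i]) z'"
      using s i by (auto simp: level_words_def wmap_append)
    then show ?case using i(2) by blast
  qed
  have inY: "wmap \<sigma> y0 \<in> Y" if "\<sigma> \<in> Words" for \<sigma>
    using that Y(3) by (induction \<sigma>) (auto simp: y0 image_subset_iff)
  have "x \<in> closure Y"
    unfolding closure_approachable
  proof (intro allI impI)
    fix e :: real assume "e > 0"
    obtain n where n: "(D + 1) * (1/2)^n < e"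
    proof -
      have "(\<lambda>n. (D + 1) * (1/2)^n) \<longlonglongrightarrow> (D + 1) * 0"
        by (intro tendsto_intros) auto
      then have "eventually (\<lambda>n. (D + 1) * (1/2)^n < e) sequentially"
        using \<open>e > 0\<close> by (intro order_tendstoD) auto
      then show ?thesis using that eventually_sequentially by auto
    qed
    obtain \<sigma> z where s: "\<sigma> \<in> level_words n" "z \<in> S" "x = wmap \<sigma> z" using ex by blast
    have "dist (wmap \<sigma> y0) x = dist z y0 / 2^n"
      using s by (simp add: dist_wmap level_words_def dist_commute)
    also have "\<dots> \<le> (D + 1) * (1/2)^n"
      using D[OF s(2)] by (simp add: field_simps)
    finally show "\<exists>y\<in>Y. dist y x < e"
      using n inY s(1) by (auto simp: level_words_def intro!: bexI[of _ "wmap \<sigma> y0"])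
  qed
  then show "x \<in> Y" using Y(1) by simp
qed

section \<open>The attractor as the closure of the vertices\<close>

definition vertices :: "pt set" where
  "vertices = (\<Union>\<sigma>\<in>Words. wmap \<sigma> ` V0)"

lemma V0_eq: "V0 = p ` {..<3}"
  by (auto simp: V0_def image_iff eval_nat_numeral lessThan_Suc)

lemma vertices_selfsimilar: "vertices = (\<Union>i\<in>{0,1,2}. w i ` vertices)"
proof
  show "vertices \<subseteq> (\<Union>i\<in>{0,1,2}. w i ` vertices)"
  proof
    fix x assume "x \<in> vertices"
    then obtain \<sigma> j where s: "\<sigma> \<in> Words" "j < 3" "x = wmap \<sigma> (p j)"
      by (auto simp: vertices_def V0_eq)
    have pv: "wmap \<tau> (p j) \<in> vertices" if "\<tau> \<in> Words" for \<tau>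
      using that s(2) by (auto simp: vertices_def V0_eq)
    have "\<exists>i y. i < 3 \<and> y \<in> vertices \<and> x = w i y"
    proof (cases \<sigma>)
      case Nil
      then have "x = w j (p j)" "p j \<in> vertices" using s pv[of "[]"] by auto
      then show ?thesis using s(2) by blast
    next
      case (Cons i \<tau>)
      then have "x = w i (wmap \<tau> (p j))" "i < 3" "wmap \<tau> (p j) \<in> vertices"
        using s pv[of \<tau>] by auto
      then show ?thesis by blast
    qed
    then obtain i y where i: "i < 3" "y \<in> vertices" "x = w i y" by blast
    then have "i \<in> {0,1,2}" by auto
    then show "x \<in> (\<Union>i\<in>{0,1,2}. w i ` vertices)" using i by blast
  qed
  show "(\<Union>i\<in>{0,1,2}. w i ` vertices) \<subseteq> vertices"
  proof (intro UN_least image_subsetI)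
    fix i :: nat and x assume i: "i \<in> {0,1,2}" and "x \<in> vertices"
    then obtain \<sigma> v where "\<sigma> \<in> Words" "v \<in> V0" "x = wmap \<sigma> v" by (auto simp: vertices_def)
    then show "w i x \<in> vertices"
      using i by (auto simp: vertices_def intro!: bexI[of _ "i # \<sigma>"])
  qed
qed

lemma vertices_subset_Tri: "vertices \<subseteq> Tri"
  unfolding vertices_def V0_eq using wmap_Tri[OF p_in_Tri] by blast

lemma bounded_Tri: "bounded Tri"
proof -
  have "norm x \<le> 2 + 2" if "x \<in> Tri" for x
  proof -
    have eq: "x = cA x *\<^sub>R p 1 + cB x *\<^sub>R p 2"
      by (rule coord_eqI) (simp_all add: cA_p cB_p)
    have "norm (p 1) = 1" "norm (p 2) = 1"
      by (simp_all add: p_def norm_Pair power_divide)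
    then have "norm x \<le> \<bar>cA x\<bar> + \<bar>cB x\<bar>"
      using norm_triangle_ineq[of "cA x *\<^sub>R p 1" "cB x *\<^sub>R p 2"] eq by simp
    then show ?thesis using that by (auto simp: Tri_def)
  qed
  then show ?thesis unfolding bounded_iff by blast
qed

lemma attractor_closure_vertices:
  "compact (closure vertices)" "closure vertices \<noteq> {}"
  "closure vertices = (\<Union>i\<in>{0,1,2}. w i ` closure vertices)"
proof -
  show c: "compact (closure vertices)"
    using bounded_subset[OF bounded_Tri vertices_subset_Tri] by (simp add: compact_closure)
  have "p 0 \<in> vertices"
    by (auto simp: vertices_def V0_def intro!: bexI[of _ "[]"])
  then show "closure vertices \<noteq> {}" by auto
  have wc: "w i ` closure vertices \<subseteq> closure (w i ` vertices)" for i
    by (intro image_closure_subset continuous_w closed_closure closure_subset)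
  show "closure vertices = (\<Union>i\<in>{0,1,2}. w i ` closure vertices)"
  proof
    have "closed (\<Union>i\<in>{0,1,2}. w i ` closure vertices)"
      by (intro closed_UN finite.intros ballI compact_imp_closed compact_continuous_image continuous_w c)
    moreover have "vertices \<subseteq> (\<Union>i\<in>{0,1,2}. w i ` closure vertices)"
      by (subst vertices_selfsimilar) (intro UN_mono image_mono closure_subset order_refl)
    ultimately show "closure vertices \<subseteq> (\<Union>i\<in>{0,1,2}. w i ` closure vertices)"
      by (rule closure_minimal[rotated])
    have "closure (w i ` vertices) \<subseteq> closure vertices" if "i \<in> {0,1,2}" for i
      using that vertices_selfsimilar by (intro closure_mono) blast
    then show "(\<Union>i\<in>{0,1,2}. w i ` closure vertices) \<subseteq> closure vertices"
      using wc by blast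
  qed
qed

text \<open>The explicit description supplies existence of the attractor without a fixed point
  argument on the space of compact sets, and it makes all vertices points of
  \<open>K\<close>.\<close>

lemma K_eq_closure: "K = closure vertices"
  unfolding K_def
proof (rule the_equality)
  show "compact (closure vertices) \<and> closure vertices \<noteq> {} \<and>
      closure vertices = (\<Union>i\<in>{0,1,2}. w i ` closure vertices)"
    using attractor_closure_vertices by blast
  have sub: "X \<subseteq> Y"
    if "compact X" "X = (\<Union>i\<in>{0,1,2}. w i ` X)" "compact Y" "Y \<noteq> {}" "Y = (\<Union>i\<in>{0,1,2}. w i ` Y)" for X Y
  proof (rule selfsimilar_subset)
    show "X \<subseteq> (\<Union>i\<in>{0,1,2}. w i ` X)" using that(2) by blast
    show "w i ` Y \<subseteq> Y" if "i < 3" for i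
    proof -
      have "i \<in> {0,1,2}" using that by auto
      then show ?thesis using \<open>Y = (\<Union>i\<in>{0,1,2}. w i ` Y)\<close> by blast
    qed
  qed (use that in \<open>auto simp: compact_imp_bounded compact_imp_closed\<close>)
  fix X assume "compact X \<and> X \<noteq> {} \<and> X = (\<Union>i\<in>{0,1,2}. w i ` X)"
  then show "X = closure vertices"
    using sub[of X "closure vertices"] sub[of "closure vertices" X] attractor_closure_vertices by blast
qed

lemma compact_K: "compact K" and K_ne: "K \<noteq> {}" and K_selfsimilar: "K = (\<Union>i\<in>{0,1,2}. w i ` K)"
  using attractor_closure_vertices unfolding K_eq_closure by blast+

lemma K_subset_Tri: "K \<subseteq> Tri"
  unfolding K_eq_closure by (intro closure_minimal vertices_subset_Tri closed_Tri)

lemma w_K: "i < 3 \<Longrightarrow> x \<in> K \<Longrightarrow> w i x \<in> K"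
  using K_selfsimilar by (auto simp: less_Suc_eq eval_nat_numeral)

lemma wmap_K: "\<sigma> \<in> Words \<Longrightarrow> x \<in> K \<Longrightarrow> wmap \<sigma> x \<in> K"
  by (induction \<sigma>) (auto intro: w_K)

lemma p_in_K: "i < 3 \<Longrightarrow> p i \<in> K"
  unfolding K_eq_closure
  by (rule subsetD[OF closure_subset]) (auto simp: vertices_def V0_eq intro!: bexI[of _ "[]"])

lemma wmap_p_in_K: "\<sigma> \<in> Words \<Longrightarrow> i < 3 \<Longrightarrow> wmap \<sigma> (p i) \<in> K"
  by (intro wmap_K p_in_K)

lemma K_cases:
  assumes "x \<in> K"
  obtains i y where "i < 3" "y \<in> K" "x = w i y"
proof -
  obtain i y where "i \<in> {0,1,2}" "y \<in> K" "x = w i y"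
    using assms K_selfsimilar by blast
  then show ?thesis using that[of i y] by auto
qed

lemma side_subset_K: "i < 3 \<Longrightarrow> j < 3 \<Longrightarrow> closed_segment (p i) (p j) \<subseteq> K"
proof (rule selfsimilar_subset)
  assume ij: "i < 3" "j < 3"
  show "closed_segment (p i) (p j) \<subseteq> (\<Union>k\<in>{0,1,2}. w k ` closed_segment (p i) (p j))"
  proof
    fix x assume "x \<in> closed_segment (p i) (p j)"
    then obtain u where u: "0 \<le> u" "u \<le> 1" "x = (1 - u) *\<^sub>R p i + u *\<^sub>R p j"
      by (auto simp: in_segment)
    have iw: "w k z \<in> (\<Union>k\<in>{0,1,2}. w k ` closed_segment (p i) (p j))"
      if "k < 3" "z \<in> closed_segment (p i) (p j)" for k z
    proof -
      have "k \<in> {0,1,2}" using that(1) by auto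
      then show ?thesis using that(2) by blast
    qed
    \<comment> \<open>The two halves of the segment are its images under \<open>w i\<close> and
      \<open>w j\<close>; doubling the parameter modulo 1 gives the preimage.\<close>
    show "x \<in> (\<Union>k\<in>{0,1,2}. w k ` closed_segment (p i) (p j))"
    proof (cases "u \<le> 1/2")
      case True
      have "x = w i ((1 - 2*u) *\<^sub>R p i + (2*u) *\<^sub>R p j)"
        by (rule coord_eqI) (simp_all add: u cA_w cB_w field_simps)
      moreover have "(1 - 2*u) *\<^sub>R p i + (2*u) *\<^sub>R p j \<in> closed_segment (p i) (p j)"
        using u True by (auto simp: in_segment intro!: exI[of _ "2*u"])
      ultimately show ?thesis using iw[of i] ij by simp
    next
      case False
      have "x = w j ((1 - (2*u - 1)) *\<^sub>R p i + (2*u - 1) *\<^sub>R p j)"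
        by (rule coord_eqI) (simp_all add: u cA_w cB_w field_simps)
      moreover have "(1 - (2*u - 1)) *\<^sub>R p i + (2*u - 1) *\<^sub>R p j \<in> closed_segment (p i) (p j)"
        using u False unfolding in_segment by (intro exI[of _ "2*u-1"]) auto
      ultimately show ?thesis using iw[of j] ij by simp
    qed
  qed
qed (auto simp: compact_imp_closed compact_K K_ne compact_imp_bounded intro: w_K)

lemma wmap_closed_segment: "wmap \<sigma> ` closed_segment x y = closed_segment (wmap \<sigma> x) (wmap \<sigma> y)"
proof -
  have "wmap \<sigma> = (\<lambda>z. wmap \<sigma> 0 + (1 / 2 ^ length \<sigma>) *\<^sub>R z)"
    using wmap_affine by blast
  then have "wmap \<sigma> ` closed_segment x y
      = (+) (wmap \<sigma> 0) ` (\<lambda>z. (1 / 2 ^ length \<sigma>) *\<^sub>R z) ` closed_segment x y"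
    by (metis (no_types, lifting) image_cong image_image)
  also have "\<dots> = closed_segment (wmap \<sigma> x) (wmap \<sigma> y)"
    using wmap_affine[of \<sigma> x] wmap_affine[of \<sigma> y]
    by (simp add: closed_segment_translation closed_segment_linear_image[symmetric] linear_iff scaleR_add_right)
  finally show ?thesis .
qed

lemma side_subset_cell:
  assumes "\<rho> \<in> Words" "i < 3" "j < 3"
  shows "closed_segment (wmap (\<sigma> @ \<rho>) (p i)) (wmap (\<sigma> @ \<rho>) (p j)) \<subseteq> cell \<sigma>"
proof -
  have "closed_segment (wmap (\<sigma> @ \<rho>) (p i)) (wmap (\<sigma> @ \<rho>) (p j))
      = wmap (\<sigma> @ \<rho>) ` closed_segment (p i) (p j)"
    by (simp add: wmap_closed_segment)
  also have "\<dots> \<subseteq> wmap (\<sigma> @ \<rho>) ` K"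
    using side_subset_K[OF assms(2,3)] by blast
  also have "\<dots> \<subseteq> wmap \<sigma> ` K"
    using wmap_K[OF assms(1)] by (auto simp: wmap_append)
  finally show ?thesis by (simp add: cell_def)
qed

section \<open>Energy and discrete harmonic functions\<close>

text \<open>Each midpoint has two names; the one with the smaller outer index is made canonical.
  \<open>Suc 0\<close> appears because the simplifier rewrites \<open>1\<close> to it.\<close>

lemma w_p_normalize [simp]:
  "w (Suc 0) (p 0) = w 0 (p (Suc 0))" "w 2 (p 0) = w 0 (p 2)" "w 2 (p (Suc 0)) = w (Suc 0) (p 2)"
  by (rule w_p_swap)+

section \<open>Sums over the edges of one level\<close>

definition cell_edges :: "nat list \<Rightarrow> (pt \<times> pt) set" where
  "cell_edges \<sigma> = map_prod (wmap \<sigma>) (wmap \<sigma>) ` {(p 0, p 1), (p 1, p 2), (p 2, p 0)}"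

text \<open>\<open>F\<close> receives source and target as an ordered pair, so that the same sums
  serve for squared increments of functions and for forms, whose values on an edge are in general
  not antisymmetric.\<close>

definition cell_sum :: "(pt \<Rightarrow> pt \<Rightarrow> real) \<Rightarrow> nat list \<Rightarrow> real" where
  "cell_sum F \<sigma> = F (wmap \<sigma> (p 0)) (wmap \<sigma> (p 1)) + F (wmap \<sigma> (p 1)) (wmap \<sigma> (p 2))
     + F (wmap \<sigma> (p 2)) (wmap \<sigma> (p 0))"

definition level_sum :: "(pt \<Rightarrow> pt \<Rightarrow> real) \<Rightarrow> nat \<Rightarrow> real" where
  "level_sum F m = (\<Sum>\<sigma>\<in>level_words m. cell_sum F \<sigma>)"

lemma edges_eq: "edges m = (\<Union>\<sigma>\<in>level_words m. cell_edges \<sigma>)"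
  by (simp add: edges_def cell_edges_def level_words_def)

lemma finite_cell_edges [simp]: "finite (cell_edges \<sigma>)"
  by (simp add: cell_edges_def)

lemma finite_edges [simp]: "finite (edges m)"
  by (simp add: edges_eq)

lemma sum_cell_edges: "(\<Sum>e\<in>cell_edges \<sigma>. F (fst e) (snd e)) = cell_sum F \<sigma>"
  by (simp add: cell_edges_def cell_sum_def p_eq_iff)

lemma cell_edgesE:
  assumes "e \<in> cell_edges \<sigma>"
  obtains i j where "i < 3" "j < 3" "i \<noteq> j" "e = (wmap \<sigma> (p i), wmap \<sigma> (p j))"
proof -
  have "e = (wmap \<sigma> (p 0), wmap \<sigma> (p 1)) \<or> e = (wmap \<sigma> (p 1), wmap \<sigma> (p 2))
      \<or> e = (wmap \<sigma> (p 2), wmap \<sigma> (p 0))"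
    using assms by (auto simp: cell_edges_def)
  then show ?thesis
    using that[of 0 1] that[of 1 2] that[of 2 0] by auto
qed

lemma sum_cell_edges_family:
  assumes "A \<subseteq> level_words m"
  shows "(\<Sum>e\<in>(\<Union>\<sigma>\<in>A. cell_edges \<sigma>). F (fst e) (snd e)) = (\<Sum>\<sigma>\<in>A. cell_sum F \<sigma>)"
proof -
  have "cell_edges \<sigma> \<inter> cell_edges \<tau> = {}" if "\<sigma> \<in> A" "\<tau> \<in> A" "\<sigma> \<noteq> \<tau>" for \<sigma> \<tau>
  proof (rule ccontr)
    assume "cell_edges \<sigma> \<inter> cell_edges \<tau> \<noteq> {}"
    then obtain e where e: "e \<in> cell_edges \<sigma>" "e \<in> cell_edges \<tau>" by blast
    obtain i j where i: "i < 3" "j < 3" "i \<noteq> j" "e = (wmap \<sigma> (p i), wmap \<sigma> (p j))"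
      using cell_edgesE[OF e(1)] by metis
    obtain k l where k: "k < 3" "l < 3" "k \<noteq> l" "e = (wmap \<tau> (p k), wmap \<tau> (p l))"
      using cell_edgesE[OF e(2)] by metis
    have "\<sigma> = \<tau>"
      using that(1,2) assms i k p_eq_iff
      by (intro wmap_inter[of \<sigma> m \<tau> "p i" "p k" "p j" "p l"] p_in_Tri) auto
    then show False using that by simp
  qed
  moreover have "finite A"
    using assms finite_subset finite_level_words by blast
  ultimately show ?thesis
    by (subst sum.UNION_disjoint) (auto simp: sum_cell_edges)
qed

lemma sum_edges: "(\<Sum>e\<in>edges m. F (fst e) (snd e)) = level_sum F m"
  unfolding edges_eq level_sum_def by (rule sum_cell_edges_family[OF order_refl])

lemma level_sum_add:
  "level_sum F (m + k) = (\<Sum>\<sigma>\<in>level_words m. \<Sum>\<rho>\<in>level_words k. cell_sum F (\<sigma> @ \<rho>))"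
  by (simp add: level_sum_def sum_level_words_add)

lemma cell_Tri: "cell \<sigma> \<subseteq> wmap \<sigma> ` Tri"
  using K_subset_Tri by (auto simp: cell_def)

text \<open>An edge inside a cell has two distinct endpoints there, and by \<open>wmap_inter\<close>
  these determine the prefix of its word. An edge of a neighbouring cell meets the cell in at most
  one vertex.\<close>

lemma edges_in_cell:
  assumes "\<sigma> \<in> level_words n"
  shows "{e \<in> edges (n + k). seg e \<subseteq> cell \<sigma>} = (\<Union>\<tau>\<in>(@) \<sigma> ` level_words k. cell_edges \<tau>)"
proof (intro equalityI subsetI)
  fix e assume "e \<in> {e \<in> edges (n + k). seg e \<subseteq> cell \<sigma>}"
  then obtain \<tau> where t: "\<tau> \<in> level_words (n + k)" "e \<in> cell_edges \<tau>" and s: "seg e \<subseteq> cell \<sigma>"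
    by (auto simp: edges_eq)
  define \<alpha> \<rho> where "\<alpha> = take n \<tau>" and "\<rho> = drop n \<tau>"
  have ar: "\<tau> = \<alpha> @ \<rho>" "\<alpha> \<in> level_words n" "\<rho> \<in> level_words k"
    using t(1) by (auto simp: \<alpha>_def \<rho>_def level_words_def Words_def dest: in_set_takeD in_set_dropD)
  obtain i j where i: "i < 3" "j < 3" "i \<noteq> j" "e = (wmap \<tau> (p i), wmap \<tau> (p j))"
    using cell_edgesE[OF t(2)] by metis
  have "wmap \<tau> (p i) \<in> cell \<sigma>" "wmap \<tau> (p j) \<in> cell \<sigma>"
    using s i by (auto simp: seg_def)
  then obtain x y where xy: "x \<in> Tri" "y \<in> Tri" "wmap \<tau> (p i) = wmap \<sigma> x" "wmap \<tau> (p j) = wmap \<sigma> y"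
    using cell_Tri by blast
  have "\<alpha> = \<sigma>"
    using ar xy i p_eq_iff[of i j]
    by (intro wmap_inter[OF ar(2) assms, of "wmap \<rho> (p i)" x "wmap \<rho> (p j)" y] wmap_Tri p_in_Tri)
      (auto simp: wmap_append)
  then show "e \<in> (\<Union>\<tau>\<in>(@) \<sigma> ` level_words k. cell_edges \<tau>)"
    using ar t by blast
next
  fix e assume "e \<in> (\<Union>\<tau>\<in>(@) \<sigma> ` level_words k. cell_edges \<tau>)"
  then obtain \<rho> where r: "\<rho> \<in> level_words k" "e \<in> cell_edges (\<sigma> @ \<rho>)" by blast
  have "\<sigma> @ \<rho> \<in> level_words (n + k)" using r(1) assms by (auto simp: level_words_def)
  then have "e \<in> edges (n + k)" using r(2) by (auto simp: edges_eq)
  moreover have "seg e \<subseteq> cell \<sigma>"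
  proof -
    obtain i j where "i < 3" "j < 3" "e = (wmap (\<sigma> @ \<rho>) (p i), wmap (\<sigma> @ \<rho>) (p j))"
      using cell_edgesE[OF r(2)] by metis
    then show ?thesis
      using side_subset_cell[of \<rho> i j \<sigma>] level_wordsD[OF r(1)] by (simp add: seg_def)
  qed
  ultimately show "e \<in> {e \<in> edges (n + k). seg e \<subseteq> cell \<sigma>}" by simp
qed

lemma sum_edges_in_cell:
  assumes "\<sigma> \<in> level_words n"
  shows "(\<Sum>e\<in>{e \<in> edges (n + k). seg e \<subseteq> cell \<sigma>}. F (fst e) (snd e))
    = (\<Sum>\<rho>\<in>level_words k. cell_sum F (\<sigma> @ \<rho>))"
proof -
  have "(@) \<sigma> ` level_words k \<subseteq> level_words (n + k)"
    using assms by (auto simp: level_words_def)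
  then show ?thesis
    unfolding edges_in_cell[OF assms] sum_cell_edges_family[OF \<open>(@) \<sigma> ` level_words k \<subseteq> level_words (n + k)\<close>]
    by (simp add: sum.reindex inj_on_def)
qed

lemma cell_sum_add: "cell_sum (\<lambda>x y. F x y + G x y) \<sigma> = cell_sum F \<sigma> + cell_sum G \<sigma>"
  by (simp add: cell_sum_def)

lemma cell_sum_scale: "cell_sum (\<lambda>x y. c * F x y) \<sigma> = c * cell_sum F \<sigma>"
  by (simp add: cell_sum_def algebra_simps)

lemma cell_sum_mono:
  assumes "\<And>i j. i < 3 \<Longrightarrow> j < 3 \<Longrightarrow> F (wmap \<sigma> (p i)) (wmap \<sigma> (p j)) \<le> G (wmap \<sigma> (p i)) (wmap \<sigma> (p j))"
  shows "cell_sum F \<sigma> \<le> cell_sum G \<sigma>"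
  unfolding cell_sum_def by (intro add_mono assms) auto

lemma cell_sum_cong:
  assumes "\<And>i j. i < 3 \<Longrightarrow> j < 3 \<Longrightarrow> F (wmap \<sigma> (p i)) (wmap \<sigma> (p j)) = G (wmap \<sigma> (p i)) (wmap \<sigma> (p j))"
  shows "cell_sum F \<sigma> = cell_sum G \<sigma>"
  unfolding cell_sum_def by (simp add: assms)

lemma level_sum_mono:
  assumes "\<And>x y. x \<in> K \<Longrightarrow> y \<in> K \<Longrightarrow> F x y \<le> G x y"
  shows "level_sum F m \<le> level_sum G m"
  unfolding level_sum_def
  by (intro sum_mono cell_sum_mono assms wmap_p_in_K) (auto simp: level_words_def)

lemma level_sum_cong:
  assumes "\<And>x y. x \<in> K \<Longrightarrow> y \<in> K \<Longrightarrow> F x y = G x y"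
  shows "level_sum F m = level_sum G m"
  by (intro antisym level_sum_mono) (simp_all add: assms)

lemma level_sum_add_fun: "level_sum (\<lambda>x y. F x y + G x y) m = level_sum F m + level_sum G m"
  by (simp add: level_sum_def cell_sum_add sum.distrib)

lemma level_sum_scale: "level_sum (\<lambda>x y. c * F x y) m = c * level_sum F m"
  by (simp add: level_sum_def cell_sum_scale sum_distrib_left)

lemma level_sum_diff_fun: "level_sum (\<lambda>x y. F x y - G x y) m = level_sum F m - level_sum G m"
  using level_sum_add_fun[of F "\<lambda>x y. - 1 * G x y" m] level_sum_scale[of "-1" G m] by simp

lemma level_sum_nonneg: "(\<And>x y. 0 \<le> F x y) \<Longrightarrow> 0 \<le> level_sum F m"
  by (simp add: level_sum_def cell_sum_def sum_nonneg)

lemma level_sum_abs: "\<bar>level_sum F m\<bar> \<le> level_sum (\<lambda>x y. \<bar>F x y\<bar>) m"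
  unfolding level_sum_def by (rule order_trans[OF sum_abs]) (auto simp: cell_sum_def intro!: sum_mono)

lemma cell_sum_children:
  "cell_sum F (\<sigma> @ [0]) + cell_sum F (\<sigma> @ [1]) + cell_sum F (\<sigma> @ [2]) =
    (let a = wmap \<sigma> (p 0); b = wmap \<sigma> (p 1); c = wmap \<sigma> (p 2);
         x = wmap \<sigma> (w 0 (p 1)); y = wmap \<sigma> (w 1 (p 2)); z = wmap \<sigma> (w 0 (p 2))
     in F a x + F x z + F z a + (F x b + F b y + F y x) + (F z y + F y c + F c z))"
  by (simp add: cell_sum_def wmap_append Let_def)

section \<open>Energy along the levels and its equality case\<close>

definition energy_at :: "nat \<Rightarrow> (pt \<Rightarrow> real) \<Rightarrow> real" where
  "energy_at m f = (5/3)^m * level_sum (\<lambda>x y. (f y - f x)\<^sup>2) m"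

definition harmonic_at :: "(pt \<Rightarrow> real) \<Rightarrow> nat list \<Rightarrow> bool" where
  "harmonic_at f \<sigma> \<longleftrightarrow>
     f (wmap \<sigma> (w 0 (p 1))) = (2 * f (wmap \<sigma> (p 0)) + 2 * f (wmap \<sigma> (p 1)) + f (wmap \<sigma> (p 2))) / 5 \<and>
     f (wmap \<sigma> (w 1 (p 2))) = (f (wmap \<sigma> (p 0)) + 2 * f (wmap \<sigma> (p 1)) + 2 * f (wmap \<sigma> (p 2))) / 5 \<and>
     f (wmap \<sigma> (w 0 (p 2))) = (2 * f (wmap \<sigma> (p 0)) + f (wmap \<sigma> (p 1)) + 2 * f (wmap \<sigma> (p 2))) / 5"

definition harmonic_in :: "(pt \<Rightarrow> real) \<Rightarrow> nat list \<Rightarrow> bool" where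
  "harmonic_in f \<sigma> \<longleftrightarrow> (\<forall>\<rho>\<in>Words. harmonic_at f (\<sigma> @ \<rho>))"

text \<open>The deviations of the midpoint values from the harmonic ones contribute a positive definite
  quadratic form, without cross terms.\<close>

lemma energy_defect:
  fixes a b c x y z :: real
  defines "X \<equiv> x - (2*a + 2*b + c)/5" and "Y \<equiv> y - (a + 2*b + 2*c)/5" and "Z \<equiv> z - (2*a + b + 2*c)/5"
  shows "(x - a)\<^sup>2 + (z - x)\<^sup>2 + (a - z)\<^sup>2 + ((b - x)\<^sup>2 + (y - b)\<^sup>2 + (x - y)\<^sup>2) + ((y - z)\<^sup>2 + (c - y)\<^sup>2 + (z - c)\<^sup>2)
    - 3/5 * ((b - a)\<^sup>2 + (c - b)\<^sup>2 + (a - c)\<^sup>2) = (X - Y)\<^sup>2 + (Y - Z)\<^sup>2 + (Z - X)\<^sup>2 + 2 * (X\<^sup>2 + Y\<^sup>2 + Z\<^sup>2)"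
  unfolding X_def Y_def Z_def
  by (simp add: power2_eq_square algebra_simps add_divide_distrib diff_divide_distrib)

lemma cell_energy_children:
  fixes f :: "pt \<Rightarrow> real"
  defines "F \<equiv> \<lambda>x y. (f y - f x)\<^sup>2"
  shows "3/5 * cell_sum F \<sigma> \<le> cell_sum F (\<sigma> @ [0]) + cell_sum F (\<sigma> @ [1]) + cell_sum F (\<sigma> @ [2])" (is ?le)
    and "cell_sum F (\<sigma> @ [0]) + cell_sum F (\<sigma> @ [1]) + cell_sum F (\<sigma> @ [2]) = 3/5 * cell_sum F \<sigma>
      \<longleftrightarrow> harmonic_at f \<sigma>" (is ?eq)
proof -
  define a b c x y z where "a = f (wmap \<sigma> (p 0))" "b = f (wmap \<sigma> (p 1))" "c = f (wmap \<sigma> (p 2))"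
      "x = f (wmap \<sigma> (w 0 (p 1)))" "y = f (wmap \<sigma> (w 1 (p 2)))" "z = f (wmap \<sigma> (w 0 (p 2)))"
  define X Y Z where "X = x - (2*a + 2*b + c)/5" "Y = y - (a + 2*b + 2*c)/5" "Z = z - (2*a + b + 2*c)/5"
  have d: "cell_sum F (\<sigma> @ [0]) + cell_sum F (\<sigma> @ [1]) + cell_sum F (\<sigma> @ [2]) - 3/5 * cell_sum F \<sigma>
      = (X - Y)\<^sup>2 + (Y - Z)\<^sup>2 + (Z - X)\<^sup>2 + 2 * (X\<^sup>2 + Y\<^sup>2 + Z\<^sup>2)"
    unfolding cell_sum_children X_Y_Z_def energy_defect[symmetric]
    by (simp add: F_def Let_def cell_sum_def a_b_c_x_y_z_def)
  have n: "(X - Y)\<^sup>2 + (Y - Z)\<^sup>2 + (Z - X)\<^sup>2 + 2 * (X\<^sup>2 + Y\<^sup>2 + Z\<^sup>2) \<ge> 0" by simp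
  then show ?le using d by linarith
  have "harmonic_at f \<sigma> \<longleftrightarrow> X = 0 \<and> Y = 0 \<and> Z = 0"
    by (auto simp: harmonic_at_def X_Y_Z_def a_b_c_x_y_z_def)
  also have "\<dots> \<longleftrightarrow> (X - Y)\<^sup>2 + (Y - Z)\<^sup>2 + (Z - X)\<^sup>2 + 2 * (X\<^sup>2 + Y\<^sup>2 + Z\<^sup>2) = 0"
    by (auto simp: add_nonneg_eq_0_iff)
  finally show ?eq using d by linarith
qed

lemma energy_at_Suc: "energy_at m f \<le> energy_at (Suc m) f"
proof -
  have "3/5 * level_sum (\<lambda>x y. (f y - f x)\<^sup>2) m \<le> level_sum (\<lambda>x y. (f y - f x)\<^sup>2) (Suc m)"
    unfolding level_sum_def sum_level_words_Suc sum_distrib_left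
    by (intro sum_mono cell_energy_children)
  then show ?thesis by (simp add: energy_at_def field_simps)
qed

text \<open>The gain of energy from one level to the next is a sum of nonnegative cell defects, so
  it vanishes only if each of them does. Through this equivalence minimality of the energy turns
  into the midpoint rule.\<close>

lemma energy_at_Suc_eq_iff:
  "energy_at (Suc m) f = energy_at m f \<longleftrightarrow> (\<forall>\<sigma>\<in>level_words m. harmonic_at f \<sigma>)"
proof -
  let ?F = "\<lambda>x y. (f y - f x)\<^sup>2"
  have "energy_at (Suc m) f = energy_at m f \<longleftrightarrow> level_sum ?F (Suc m) - 3/5 * level_sum ?F m = 0"
    by (simp add: energy_at_def field_simps)
  also have "level_sum ?F (Suc m) - 3/5 * level_sum ?F m = (\<Sum>\<sigma>\<in>level_words m.
      cell_sum ?F (\<sigma> @ [0]) + cell_sum ?F (\<sigma> @ [1]) + cell_sum ?F (\<sigma> @ [2]) - 3/5 * cell_sum ?F \<sigma>)"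
    unfolding level_sum_def sum_level_words_Suc by (simp add: sum_subtractf sum_distrib_left)
  also have "\<dots> = 0 \<longleftrightarrow> (\<forall>\<sigma>\<in>level_words m.
      cell_sum ?F (\<sigma> @ [0]) + cell_sum ?F (\<sigma> @ [1]) + cell_sum ?F (\<sigma> @ [2]) - 3/5 * cell_sum ?F \<sigma> = 0)"
    using cell_energy_children(1)[of f] by (intro sum_nonneg_eq_0_iff) auto
  also have "\<dots> \<longleftrightarrow> (\<forall>\<sigma>\<in>level_words m. harmonic_at f \<sigma>)"
    using cell_energy_children(2)[of f] by auto
  finally show ?thesis .
qed

lemma energy_at_mono: "m \<le> n \<Longrightarrow> energy_at m f \<le> energy_at n f"
  by (rule lift_Suc_mono_le[of "\<lambda>m. energy_at m f"]) (rule energy_at_Suc)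

lemma energy_at_nonneg: "0 \<le> energy_at m f"
  by (simp add: energy_at_def level_sum_nonneg)

text \<open>Monotonicity in the level makes the limit a supremum; finite energy then just means
  bounded level energies.\<close>

lemma energy_eq_SUP: "energy f = (SUP m. ereal (energy_at m f))"
proof -
  have "energy f = lim (\<lambda>m. ereal (energy_at m f))"
    by (simp add: energy_def energy_at_def sum_edges[of "\<lambda>x y. (f y - f x)\<^sup>2"])
  moreover have "(\<lambda>m. ereal (energy_at m f)) \<longlonglongrightarrow> (SUP m. ereal (energy_at m f))"
    by (rule LIMSEQ_SUP) (auto simp: incseq_def intro: energy_at_mono)
  ultimately show ?thesis by (simp add: limI)
qed

lemma FF_iff: "f \<in> FF \<longleftrightarrow> continuous_on K f \<and> (\<exists>C. \<forall>m. energy_at m f \<le> C)"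
proof -
  have "energy f < \<infinity> \<longleftrightarrow> (\<exists>C. \<forall>m. energy_at m f \<le> C)"
  proof
    assume a: "energy f < \<infinity>"
    have le: "ereal (energy_at m f) \<le> energy f" for m
      unfolding energy_eq_SUP by (rule SUP_upper) simp
    have "energy f \<noteq> -\<infinity>" using le[of 0] by auto
    then obtain r where "energy f = ereal r" using a by (cases "energy f") auto
    then show "\<exists>C. \<forall>m. energy_at m f \<le> C" using le by auto
  next
    assume "\<exists>C. \<forall>m. energy_at m f \<le> C"
    then obtain C where "\<And>m. energy_at m f \<le> C" by auto
    then have "energy f \<le> ereal C" unfolding energy_eq_SUP by (intro SUP_least) auto
    then show "energy f < \<infinity>" by auto
  qed
  then show ?thesis by (simp add: FF_def)
qed

lemma FF_D:
  assumes "f \<in> FF"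
  obtains C where "C \<ge> 0" "\<And>m. energy_at m f \<le> C"
  using assms energy_at_nonneg unfolding FF_iff by (meson order_trans)

lemma FF_level_bound:
  assumes "f \<in> FF"
  obtains C where "C \<ge> 0" "\<And>m. level_sum (\<lambda>x y. (f y - f x)\<^sup>2) m \<le> C * (3/5)^m"
proof -
  obtain C where C: "C \<ge> 0" "\<And>m. energy_at m f \<le> C" using FF_D[OF assms] by blast
  have "level_sum (\<lambda>x y. (f y - f x)\<^sup>2) m \<le> C * (3/5)^m" for m
    using C(2)[of m] by (simp add: energy_at_def field_simps power_divide)
  then show ?thesis using C that by blast
qed

section \<open>The algebra of functions of finite energy\<close>

lemma FF_continuous: "f \<in> FF \<Longrightarrow> continuous_on K f"
  by (simp add: FF_iff)

lemma FF_bounded: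
  assumes "f \<in> FF"
  obtains B where "B \<ge> 0" "\<And>x. x \<in> K \<Longrightarrow> \<bar>f x\<bar> \<le> B"
proof -
  have "bounded (f ` K)"
    using assms compact_K by (intro compact_imp_bounded compact_continuous_image FF_continuous)
  then obtain B where B: "\<And>x. x \<in> K \<Longrightarrow> \<bar>f x\<bar> \<le> B" by (auto simp: bounded_iff)
  have "\<bar>f x\<bar> \<le> max B 0" if "x \<in> K" for x using B[OF that] by linarith
  then show ?thesis using that[of "max B 0"] by simp
qed

text \<open>Domination of squared increments passes to every level sum at once. Closure of
  \<open>FF\<close> under sums, multiples and products reduces to a pointwise inequality of this
  kind.\<close>

lemma FF_I:
  assumes "continuous_on K h" "f \<in> FF" "g \<in> FF"
    and "\<And>x y. x \<in> K \<Longrightarrow> y \<in> K \<Longrightarrow> (h y - h x)\<^sup>2 \<le> A * (f y - f x)\<^sup>2 + B * (g y - g x)\<^sup>2" "A \<ge> 0" "B \<ge> 0"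
  shows "h \<in> FF"
proof -
  obtain C where C: "\<And>m. energy_at m f \<le> C" using FF_D[OF assms(2)] by metis
  obtain D where D: "\<And>m. energy_at m g \<le> D" using FF_D[OF assms(3)] by metis
  have "energy_at m h \<le> A * C + B * D" for m
  proof -
    have "level_sum (\<lambda>x y. (h y - h x)\<^sup>2) m \<le> level_sum (\<lambda>x y. A * (f y - f x)\<^sup>2 + B * (g y - g x)\<^sup>2) m"
      by (rule level_sum_mono) (rule assms(4))
    then have "energy_at m h \<le> (5/3)^m * level_sum (\<lambda>x y. A * (f y - f x)\<^sup>2 + B * (g y - g x)\<^sup>2) m"
      unfolding energy_at_def by (intro mult_left_mono) auto
    also have "\<dots> = A * energy_at m f + B * energy_at m g"
      by (simp add: level_sum_add_fun level_sum_scale energy_at_def algebra_simps)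
    also have "\<dots> \<le> A * C + B * D"
      by (intro add_mono mult_left_mono C D assms)
    finally show ?thesis .
  qed
  then show ?thesis unfolding FF_iff using assms(1) by blast
qed

lemma FF_const [simp]: "(\<lambda>_. c) \<in> FF"
proof -
  have "energy_at m (\<lambda>_. c) = 0" for m
    by (simp add: energy_at_def level_sum_def cell_sum_def)
  then show ?thesis by (auto simp: FF_iff)
qed

lemma square_sum_le: "(a + b)\<^sup>2 \<le> 2 * a\<^sup>2 + 2 * b\<^sup>2" for a b :: real
  using zero_le_power2[of "a - b"] by (simp add: power2_eq_square algebra_simps)

lemma FF_add:
  assumes "f \<in> FF" "g \<in> FF"
  shows "(\<lambda>x. f x + g x) \<in> FF"
proof (rule FF_I[of _ f g 2 2])
  fix x y
  show "(f y + g y - (f x + g x))\<^sup>2 \<le> 2 * (f y - f x)\<^sup>2 + 2 * (g y - g x)\<^sup>2"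
    using square_sum_le[of "f y - f x" "g y - g x"] by (simp add: algebra_simps)
qed (simp_all add: continuous_on_add FF_continuous assms)

lemma FF_scale:
  assumes "f \<in> FF"
  shows "(\<lambda>x. c * f x) \<in> FF"
proof (rule FF_I[of _ f f "c\<^sup>2" 0])
  fix x y
  show "(c * f y - c * f x)\<^sup>2 \<le> c\<^sup>2 * (f y - f x)\<^sup>2 + 0 * (f y - f x)\<^sup>2"
    by (simp add: power_mult_distrib[symmetric] right_diff_distrib)
qed (simp_all add: continuous_on_mult_left FF_continuous assms)

lemma FF_mult:
  assumes "f \<in> FF" "g \<in> FF"
  shows "(\<lambda>x. f x * g x) \<in> FF"
proof -
  obtain B where B: "\<And>x. x \<in> K \<Longrightarrow> \<bar>f x\<bar> \<le> B" using FF_bounded[OF assms(1)] by metis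
  obtain D where D: "\<And>x. x \<in> K \<Longrightarrow> \<bar>g x\<bar> \<le> D" using FF_bounded[OF assms(2)] by metis
  show ?thesis
  proof (rule FF_I[of _ f g "2 * D\<^sup>2" "2 * B\<^sup>2"])
    fix x y assume xy: "x \<in> K" "y \<in> K"
    have "(f y * g y - f x * g x)\<^sup>2 = (g x * (f y - f x) + f y * (g y - g x))\<^sup>2"
      by (simp add: algebra_simps)
    also have "\<dots> \<le> 2 * ((g x)\<^sup>2 * (f y - f x)\<^sup>2) + 2 * ((f y)\<^sup>2 * (g y - g x)\<^sup>2)"
      unfolding power_mult_distrib[symmetric] by (rule square_sum_le)
    also have "(g x)\<^sup>2 * (f y - f x)\<^sup>2 \<le> D\<^sup>2 * (f y - f x)\<^sup>2"
      using D[OF xy(1)] by (intro mult_right_mono) (auto intro: power2_le_iff_abs_le[THEN iffD2])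
    also have "(f y)\<^sup>2 * (g y - g x)\<^sup>2 \<le> B\<^sup>2 * (g y - g x)\<^sup>2"
      using B[OF xy(2)] by (intro mult_right_mono) (auto intro: power2_le_iff_abs_le[THEN iffD2])
    finally show "(f y * g y - f x * g x)\<^sup>2 \<le> 2 * D\<^sup>2 * (f y - f x)\<^sup>2 + 2 * B\<^sup>2 * (g y - g x)\<^sup>2"
      by (simp add: mult.assoc)
  qed (simp_all add: continuous_on_mult FF_continuous assms)
qed

lemma energy_at_tendsto:
  assumes "f \<in> FF"
  shows "convergent (\<lambda>m. energy_at m f)"
proof -
  obtain C where C: "\<And>m. energy_at m f \<le> C" using FF_D[OF assms] by metis
  have "Bseq (\<lambda>m. energy_at m f)"
    using C energy_at_nonneg by (intro BseqI'[of _ C]) auto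
  then show ?thesis
    by (rule Bseq_monoseq_convergent) (auto simp: monoseq_def intro: energy_at_mono)
qed

text \<open>The mixed sums need not be monotone in the level, but by polarization they are a quarter
  of the difference of two bounded monotone sequences.\<close>

lemma energy_form_tendsto:
  assumes "f \<in> FF" "g \<in> FF"
  shows "(\<lambda>m. (5/3)^m * level_sum (\<lambda>x y. (f y - f x) * (g y - g x)) m) \<longlonglongrightarrow> energy_form f g"
proof -
  have "(\<lambda>x. f x + (-1) * g x) \<in> FF" using assms by (intro FF_add FF_scale)
  then have "convergent (\<lambda>m. energy_at m (\<lambda>x. f x + g x) - energy_at m (\<lambda>x. f x + (-1) * g x))"
    using assms by (intro convergent_diff energy_at_tendsto) (simp_all only: FF_add)
  then have "convergent (\<lambda>m. (energy_at m (\<lambda>x. f x + g x) - energy_at m (\<lambda>x. f x + (-1) * g x)) / 4)"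
    unfolding convergent_def using tendsto_divide[OF _ tendsto_const, of _ _ sequentially "4 :: real"] by auto
  also have "(\<lambda>m. (energy_at m (\<lambda>x. f x + g x) - energy_at m (\<lambda>x. f x + (-1) * g x)) / 4)
    = (\<lambda>m. (5/3)^m * level_sum (\<lambda>x y. (f y - f x) * (g y - g x)) m)"
  proof
    fix m
    have "(energy_at m (\<lambda>x. f x + g x) - energy_at m (\<lambda>x. f x + (-1) * g x)) / 4
      = (5/3)^m * level_sum (\<lambda>x y. (1/4) * ((f y + g y - (f x + g x))\<^sup>2 - (f y + (-1) * g y - (f x + (-1) * g x))\<^sup>2)) m"
      unfolding energy_at_def level_sum_scale level_sum_diff_fun by (simp only: right_diff_distrib) simp
    also have "(\<lambda>x y. (1/4) * ((f y + g y - (f x + g x))\<^sup>2 - (f y + (-1) * g y - (f x + (-1) * g x))\<^sup>2))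
        = (\<lambda>x y. (f y - f x) * (g y - g x))"
      by (intro ext) (simp add: power2_eq_square field_simps)
    finally show "(energy_at m (\<lambda>x. f x + g x) - energy_at m (\<lambda>x. f x + (-1) * g x)) / 4
      = (5/3)^m * level_sum (\<lambda>x y. (f y - f x) * (g y - g x)) m" .
  qed
  finally show ?thesis
    by (simp add: energy_form_def sum_edges[of "\<lambda>x y. (f y - f x) * (g y - g x)"] convergent_LIMSEQ_iff)
qed

section \<open>Discrete harmonic functions: pairings, oscillation and minimality\<close>

lemma harmonic_in_append: "harmonic_in h \<sigma> \<Longrightarrow> \<rho> \<in> Words \<Longrightarrow> harmonic_in h (\<sigma> @ \<rho>)"
  by (auto simp: harmonic_in_def)

lemma harmonic_in_at: "harmonic_in h \<sigma> \<Longrightarrow> harmonic_at h \<sigma>"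
  unfolding harmonic_in_def by (metis Words_Nil append_Nil2)

text \<open>Only the primed function obeys the midpoint rule; \<open>x\<close>, \<open>y\<close>,
  \<open>z\<close> are arbitrary. At each midpoint the primed function is the average of its four
  neighbours, so the midpoint values of the other function have coefficient zero and only corner
  values survive.\<close>

lemma harmonic_pairing_identity:
  fixes a b c a' b' c' x y z :: real
  assumes "x' = (2*a' + 2*b' + c')/5" "y' = (a' + 2*b' + 2*c')/5" "z' = (2*a' + b' + 2*c')/5"
  shows "(x-a)*(x'-a') + (z-x)*(z'-x') + (a-z)*(a'-z')
    + ((b-x)*(b'-x') + (y-b)*(y'-b') + (x-y)*(x'-y'))
    + ((y-z)*(y'-z') + (c-y)*(c'-y') + (z-c)*(z'-c'))
    = 3/5 * ((b-a)*(b'-a') + (c-b)*(c'-b') + (a-c)*(a'-c'))"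
  unfolding assms by (simp add: algebra_simps add_divide_distrib diff_divide_distrib)

lemma harmonic_pairing_children:
  fixes F h :: "pt \<Rightarrow> real"
  assumes "harmonic_at h \<sigma>"
  defines "G \<equiv> \<lambda>x y. (F y - F x) * (h y - h x)"
  shows "cell_sum G (\<sigma> @ [0]) + cell_sum G (\<sigma> @ [1]) + cell_sum G (\<sigma> @ [2]) = 3/5 * cell_sum G \<sigma>"
  unfolding cell_sum_children unfolding Let_def G_def cell_sum_def
  by (rule harmonic_pairing_identity) (use assms(1) in \<open>simp_all only: harmonic_at_def\<close>)

lemma cell_sum_descendants:
  assumes "\<sigma> \<in> Words" "\<And>\<rho>. \<rho> \<in> Words \<Longrightarrow>
    cell_sum G (\<sigma> @ \<rho> @ [0]) + cell_sum G (\<sigma> @ \<rho> @ [1]) + cell_sum G (\<sigma> @ \<rho> @ [2]) = c * cell_sum G (\<sigma> @ \<rho>)"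
  shows "(\<Sum>\<rho>\<in>level_words k. cell_sum G (\<sigma> @ \<rho>)) = c ^ k * cell_sum G \<sigma>"
proof (induction k)
  case (Suc k)
  have "(\<Sum>\<rho>\<in>level_words (Suc k). cell_sum G (\<sigma> @ \<rho>)) = (\<Sum>\<rho>\<in>level_words k. c * cell_sum G (\<sigma> @ \<rho>))"
    unfolding sum_level_words_Suc using assms(2) level_wordsD(1) by (intro sum.cong) auto
  then show ?case by (simp add: sum_distrib_left[symmetric] Suc.IH)
qed simp

lemma harmonic_pairing:
  fixes F h :: "pt \<Rightarrow> real"
  assumes "harmonic_in h \<sigma>" "\<sigma> \<in> Words"
  shows "(\<Sum>\<rho>\<in>level_words k. cell_sum (\<lambda>x y. (F y - F x) * (h y - h x)) (\<sigma> @ \<rho>))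
    = (3/5) ^ k * cell_sum (\<lambda>x y. (F y - F x) * (h y - h x)) \<sigma>"
proof (rule cell_sum_descendants[OF assms(2)])
  fix \<rho> assume "\<rho> \<in> Words"
  then have "harmonic_at h (\<sigma> @ \<rho>)" using assms by (simp add: harmonic_in_def)
  from harmonic_pairing_children[OF this, of F] show
    "cell_sum (\<lambda>x y. (F y - F x) * (h y - h x)) (\<sigma> @ \<rho> @ [0]) + cell_sum (\<lambda>x y. (F y - F x) * (h y - h x)) (\<sigma> @ \<rho> @ [1])
      + cell_sum (\<lambda>x y. (F y - F x) * (h y - h x)) (\<sigma> @ \<rho> @ [2])
      = 3/5 * cell_sum (\<lambda>x y. (F y - F x) * (h y - h x)) (\<sigma> @ \<rho>)" by simp
qed

text \<open>The averaged product is half of \<Delta>g \<Delta>(hf) - \<Delta>(gh) \<Delta>f +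
  \<Delta>(fg) \<Delta>h, and each of these products pairs one of the three harmonic functions with
  an arbitrary function. The factor 3/5 is thus that of
  \<open>harmonic_pairing_identity\<close>.\<close>

lemma harmonic_triple_identity:
  fixes a b c a' b' c' a'' b'' c'' :: real
  assumes "x = (2*a + 2*b + c)/5" "y = (a + 2*b + 2*c)/5" "z = (2*a + b + 2*c)/5"
    "x' = (2*a' + 2*b' + c')/5" "y' = (a' + 2*b' + 2*c')/5" "z' = (2*a' + b' + 2*c')/5"
    "x'' = (2*a'' + 2*b'' + c'')/5" "y'' = (a'' + 2*b'' + 2*c'')/5" "z'' = (2*a'' + b'' + 2*c'')/5"
  shows "(a+x)/2*(x'-a')*(x''-a'') + (x+z)/2*(z'-x')*(z''-x'') + (z+a)/2*(a'-z')*(a''-z'')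
    + ((x+b)/2*(b'-x')*(b''-x'') + (b+y)/2*(y'-b')*(y''-b'') + (y+x)/2*(x'-y')*(x''-y''))
    + ((z+y)/2*(y'-z')*(y''-z'') + (y+c)/2*(c'-y')*(c''-y'') + (c+z)/2*(z'-c')*(z''-c''))
    = 3/5 * ((a+b)/2*(b'-a')*(b''-a'') + (b+c)/2*(c'-b')*(c''-b'') + (c+a)/2*(a'-c')*(a''-c''))"
  unfolding assms by (simp add: algebra_simps add_divide_distrib diff_divide_distrib)

lemma harmonic_triple_children:
  fixes f g h :: "pt \<Rightarrow> real"
  assumes "harmonic_at f \<sigma>" "harmonic_at g \<sigma>" "harmonic_at h \<sigma>"
  defines "G \<equiv> \<lambda>x y. (f x + f y) / 2 * (g y - g x) * (h y - h x)"
  shows "cell_sum G (\<sigma> @ [0]) + cell_sum G (\<sigma> @ [1]) + cell_sum G (\<sigma> @ [2]) = 3/5 * cell_sum G \<sigma>"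
  unfolding cell_sum_children unfolding Let_def G_def cell_sum_def
  by (rule harmonic_triple_identity) (use assms(1-3) in \<open>simp_all only: harmonic_at_def\<close>)

lemma harmonic_triple:
  fixes f g h :: "pt \<Rightarrow> real"
  assumes "harmonic_in f \<sigma>" "harmonic_in g \<sigma>" "harmonic_in h \<sigma>" "\<sigma> \<in> Words"
  defines "G \<equiv> \<lambda>x y. (f x + f y) / 2 * (g y - g x) * (h y - h x)"
  shows "(\<Sum>\<rho>\<in>level_words k. cell_sum G (\<sigma> @ \<rho>)) = (3/5) ^ k * cell_sum G \<sigma>"
proof (rule cell_sum_descendants[OF assms(4)])
  fix \<rho> assume "\<rho> \<in> Words"
  then have "harmonic_at f (\<sigma> @ \<rho>)" "harmonic_at g (\<sigma> @ \<rho>)" "harmonic_at h (\<sigma> @ \<rho>)"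
    using assms by (simp_all add: harmonic_in_def)
  from harmonic_triple_children[OF this] show
    "cell_sum G (\<sigma> @ \<rho> @ [0]) + cell_sum G (\<sigma> @ \<rho> @ [1]) + cell_sum G (\<sigma> @ \<rho> @ [2]) = 3/5 * cell_sum G (\<sigma> @ \<rho>)"
    by (simp add: G_def)
qed

text \<open>The sum of the absolute increments around a triangle is twice the range of the three
  values, and the midpoint rule leaves a child with at most 3/5 of that range.\<close>

lemma harmonic_osc_bound:
  fixes a b c :: real
  shows "\<bar>(2*a+2*b+c)/5 - a\<bar> + \<bar>(2*a+b+2*c)/5 - (2*a+2*b+c)/5\<bar> + \<bar>a - (2*a+b+2*c)/5\<bar>
    \<le> 3/5 * (\<bar>b-a\<bar>+\<bar>c-b\<bar>+\<bar>a-c\<bar>)"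
  by (simp add: abs_if field_simps)

lemma harmonic_osc_child:
  fixes h :: "pt \<Rightarrow> real"
  assumes "harmonic_at h \<sigma>" "i < 3"
  shows "cell_sum (\<lambda>x y. \<bar>h y - h x\<bar>) (\<sigma> @ [i]) \<le> 3/5 * cell_sum (\<lambda>x y. \<bar>h y - h x\<bar>) \<sigma>"
proof -
  define a b c x y z where "a = h (wmap \<sigma> (p 0))" "b = h (wmap \<sigma> (p 1))" "c = h (wmap \<sigma> (p 2))"
    "x = h (wmap \<sigma> (w 0 (p 1)))" "y = h (wmap \<sigma> (w 1 (p 2)))" "z = h (wmap \<sigma> (w 0 (p 2)))"
  note defs = this
  \<comment> \<open>The summands are ordered cyclically, so that the children 1 and 2 become
    instances of the bound for child 0.\<close>
  have X: "x = (2*a+2*b+c)/5" and Y: "y = (2*b+2*c+a)/5" and Z: "z = (2*c+2*a+b)/5"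
    using assms(1) unfolding harmonic_at_def defs by (simp_all add: algebra_simps)
  have S: "cell_sum (\<lambda>x y. \<bar>h y - h x\<bar>) \<sigma> = \<bar>b-a\<bar>+\<bar>c-b\<bar>+\<bar>a-c\<bar>"
    by (simp add: cell_sum_def defs)
  consider "i = 0" | "i = 1" | "i = 2" using assms(2) by linarith
  then show ?thesis
  proof cases
    case 1
    then have "cell_sum (\<lambda>x y. \<bar>h y - h x\<bar>) (\<sigma> @ [i]) = \<bar>x-a\<bar>+\<bar>z-x\<bar>+\<bar>a-z\<bar>"
      by (simp add: cell_sum_def wmap_append defs)
    then show ?thesis unfolding S X Z using harmonic_osc_bound[of a b c] by (simp add: ac_simps)
  next
    case 2
    then have "cell_sum (\<lambda>x y. \<bar>h y - h x\<bar>) (\<sigma> @ [i]) = \<bar>y-b\<bar>+\<bar>x-y\<bar>+\<bar>b-x\<bar>"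
      by (simp add: cell_sum_def wmap_append defs)
    then show ?thesis unfolding S X Y using harmonic_osc_bound[of b c a] by (simp add: ac_simps)
  next
    case 3
    then have "cell_sum (\<lambda>x y. \<bar>h y - h x\<bar>) (\<sigma> @ [i]) = \<bar>z-c\<bar>+\<bar>y-z\<bar>+\<bar>c-y\<bar>"
      by (simp add: cell_sum_def wmap_append defs)
    then show ?thesis unfolding S Y Z using harmonic_osc_bound[of c a b] by (simp add: ac_simps)
  qed
qed

lemma harmonic_osc:
  fixes h :: "pt \<Rightarrow> real"
  assumes "harmonic_in h \<sigma>" "\<rho> \<in> Words"
  shows "cell_sum (\<lambda>x y. \<bar>h y - h x\<bar>) (\<sigma> @ \<rho>) \<le> (3/5) ^ length \<rho> * cell_sum (\<lambda>x y. \<bar>h y - h x\<bar>) \<sigma>"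
  using assms(2)
proof (induction \<rho> rule: rev_induct)
  case (snoc i \<rho>)
  have "cell_sum (\<lambda>x y. \<bar>h y - h x\<bar>) (\<sigma> @ \<rho> @ [i]) \<le> 3/5 * cell_sum (\<lambda>x y. \<bar>h y - h x\<bar>) (\<sigma> @ \<rho>)"
    using harmonic_osc_child[of h "\<sigma> @ \<rho>" i] assms(1) snoc.prems by (auto simp: harmonic_in_def)
  then show ?case using snoc by simp
qed simp

lemma energy_at_harmonic:
  assumes "harmonic_in v []"
  shows "energy_at m v = energy_at 0 v"
proof (induction m)
  case (Suc m)
  have "\<forall>\<sigma>\<in>level_words m. harmonic_at v \<sigma>"
    using assms by (auto simp: harmonic_in_def dest: level_wordsD)
  then have "energy_at (Suc m) v = energy_at m v" unfolding energy_at_Suc_eq_iff .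
  then show ?case using Suc.IH by simp
qed simp

text \<open>The competitor \<open>v\<close> has its level-0 energy on all levels, hence the energy
  of \<open>u\<close> is at most \<open>energy_at 0 u\<close>. By monotonicity all level energies of
  \<open>u\<close> coincide, and the equality case applies at each level. Below, \<open>hext\<close>
  provides such a competitor.\<close>

lemma harmonic0_imp_harmonic_in:
  assumes "harmonic0 u" "v \<in> FF" "harmonic_in v []" "\<And>i. i < 3 \<Longrightarrow> v (p i) = u (p i)"
  shows "harmonic_in u []"
proof -
  have "energy u \<le> energy v"
    using assms(1,2,4) unfolding harmonic0_def V0_eq by auto
  also have "\<dots> = ereal (energy_at 0 v)"
  proof -
    have "energy v = (SUP m::nat. ereal (energy_at 0 v))"
      unfolding energy_eq_SUP by (rule SUP_cong[OF refl]) (metis energy_at_harmonic assms(3))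
    then show ?thesis by simp
  qed
  also have "energy_at 0 v = energy_at 0 u"
    using assms(4) by (simp add: energy_at_def level_sum_def cell_sum_def)
  finally have le: "energy u \<le> ereal (energy_at 0 u)" .
  have "energy_at m u = energy_at 0 u" for m
  proof -
    have "ereal (energy_at m u) \<le> energy u"
      unfolding energy_eq_SUP by (rule SUP_upper) simp
    then have "energy_at m u \<le> energy_at 0 u" using le order_trans by fastforce
    then show ?thesis using energy_at_mono[of 0 m u] by simp
  qed
  then have "\<forall>\<sigma>\<in>level_words m. harmonic_at u \<sigma>" for m
    using energy_at_Suc_eq_iff by metis
  then show ?thesis unfolding harmonic_in_def using level_wordsI by auto
qed

section \<open>Harmonic extension and forms supported on a cell\<close>

definition winv :: "nat \<Rightarrow> pt \<Rightarrow> pt" where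
  "winv i x = 2 *\<^sub>R x - p i"

lemma winv_w [simp]: "winv i (w i x) = x"
  by (rule coord_eqI) (simp_all add: winv_def cA_w cB_w field_simps)

text \<open>On \<open>K\<close> the order of the branches is immaterial for compatible families. Off
  \<open>K\<close> the last branch is a default value that makes the function total.\<close>

definition glue :: "(nat \<Rightarrow> pt \<Rightarrow> real) \<Rightarrow> pt \<Rightarrow> real" where
  "glue u x = (if x \<in> w 0 ` K then u 0 (winv 0 x) else if x \<in> w 1 ` K then u 1 (winv 1 x) else u 2 (winv 2 x))"

definition compatible :: "(nat \<Rightarrow> pt \<Rightarrow> real) \<Rightarrow> bool" where
  "compatible u \<longleftrightarrow> (\<forall>i<3. \<forall>j<3. u i (p j) = u j (p i))"

lemma glue_w:
  assumes "compatible u" "i < 3" "x \<in> K"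
  shows "glue u (w i x) = u i x"
proof -
  \<comment> \<open>A point lying in two subcells is their common corner, where compatibility makes
    the branches agree.\<close>
  have other: "u j (winv j (w i x)) = u i x" if j: "w i x \<in> w j ` K" "j < 3" for j
  proof (cases "i = j")
    case False
    obtain y where y: "y \<in> K" "w i x = w j y" using j by blast
    have "x = p j" "y = p i"
      using w_inter[of i x j y] y assms False j K_subset_Tri by blast+
    then show ?thesis using assms(1,2) j(2) y(2) by (auto simp: compatible_def)
  qed simp
  have "w i x \<in> w i ` K" using assms(3) by blast
  moreover have "i = 0 \<or> i = 1 \<or> i = 2" using assms(2) by linarith
  ultimately show ?thesis
    using other[of 0] other[of 1] unfolding glue_def by (cases "i = 2") (simp_all split: if_splits, blast?)
qed

lemma K_Un: "K = w 0 ` K \<union> (w 1 ` K \<union> w 2 ` K)"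
  using K_selfsimilar by auto

lemma continuous_glue:
  assumes "compatible u" "\<And>i. i < 3 \<Longrightarrow> continuous_on K (u i)"
  shows "continuous_on K (glue u)"
proof -
  have closed: "closed (w i ` K)" for i
    by (intro compact_imp_closed compact_continuous_image continuous_w compact_K)
  have cont: "continuous_on (w i ` K) (glue u)" if i: "i < 3" for i
  proof -
    have "continuous_on (w i ` K) (\<lambda>x. u i (winv i x))"
    proof (rule continuous_on_compose2[of K "u i"])
      show "continuous_on (w i ` K) (winv i)"
        unfolding winv_def by (intro continuous_intros)
    qed (use assms(2) i in auto)
    then show ?thesis
      by (rule continuous_on_eq) (use glue_w[OF assms(1) i] in auto)
  qed
  show ?thesis
    by (subst K_Un) (intro continuous_on_closed_Un closed_Un closed cont; simp)
qed

text \<open>The value at \<open>w i (p j)\<close> of the harmonic function with corner values \<open>v\<close>; for \<open>i \<noteq> j\<close> this is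
  the rule with weights 2/5, 2/5, 1/5.\<close>

definition hchild :: "(nat \<Rightarrow> real) \<Rightarrow> nat \<Rightarrow> nat \<Rightarrow> real" where
  "hchild v i j = (if i = j then v i else (v 0 + v 1 + v 2 + v i + v j) / 5)"

section \<open>The harmonic extension of three corner values\<close>

lemma hchild_commute: "hchild v i j = hchild v j i"
  by (simp add: hchild_def add_ac)

definition osc :: "(nat \<Rightarrow> real) \<Rightarrow> real" where
  "osc v = \<bar>v 1 - v 0\<bar> + \<bar>v 2 - v 1\<bar> + \<bar>v 0 - v 2\<bar>"

lemma osc_nonneg: "0 \<le> osc v"
  by (simp add: osc_def)

lemma osc_hchild: "i < 3 \<Longrightarrow> osc (hchild v i) \<le> 3/5 * osc v"
proof -
  assume "i < 3"
  then consider "i = 0" | "i = 1" | "i = 2" by linarith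
  then show ?thesis
    by cases (simp_all add: osc_def hchild_def abs_if field_simps)
qed

text \<open>\<open>n\<close> steps of the harmonic rule followed by affine interpolation in each
  cell of level \<open>n\<close>. These approximants are continuous on \<open>K\<close>, so their
  uniform limit is defined and continuous on all of \<open>K\<close>, not only at vertices.\<close>

fun hiter :: "nat \<Rightarrow> (nat \<Rightarrow> real) \<Rightarrow> pt \<Rightarrow> real" where
  "hiter 0 v = (\<lambda>x. v 0 + cA x * (v 1 - v 0) + cB x * (v 2 - v 0))"
| "hiter (Suc n) v = glue (\<lambda>i. hiter n (hchild v i))"

text \<open>Compatibility needs the corner values of the current approximant, and the corner values
  of the next one need compatibility. The conditional form allows both to be obtained in one
  induction.\<close>

lemma compatible_hiter_aux:
  assumes "\<And>v j. j < 3 \<Longrightarrow> hiter n v (p j) = v j"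
  shows "compatible (\<lambda>i. hiter n (hchild v i))"
  using assms by (simp add: compatible_def hchild_commute)

lemma hiter_p: "j < 3 \<Longrightarrow> hiter n v (p j) = v j"
proof (induction n arbitrary: v j)
  case 0
  then consider "j = 0" | "j = 1" | "j = 2" by linarith
  then show ?case by cases (simp_all add: cA_p cB_p)
next
  case (Suc n)
  then show ?case
    using glue_w[OF compatible_hiter_aux[of n v], of j "p j"] p_in_K by (simp add: hchild_def)
qed

lemma compatible_hiter: "compatible (\<lambda>i. hiter n (hchild v i))"
  using compatible_hiter_aux hiter_p by blast

lemma hiter_w: "i < 3 \<Longrightarrow> x \<in> K \<Longrightarrow> hiter (Suc n) v (w i x) = hiter n (hchild v i) x"
  by (simp add: glue_w[OF compatible_hiter])

lemma continuous_hiter: "continuous_on K (hiter n v)"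
proof (induction n arbitrary: v)
  case 0
  show ?case by (simp add: cA_def cB_def) (intro continuous_intros; simp)
next
  case (Suc n)
  then show ?case by (simp add: continuous_glue compatible_hiter)
qed

lemma hiter_0_near:
  assumes "x \<in> Tri" "j < 3"
  shows "\<bar>hiter 0 v x - v j\<bar> \<le> osc v"
proof -
  define s t where "s = cA x" and "t = cB x"
  have st: "0 \<le> s" "0 \<le> t" "s + t \<le> 1" using assms(1) by (auto simp: Tri_def s_def t_def)
  have *: "\<bar>a * r + b * q\<bar> \<le> \<bar>a\<bar> + \<bar>b\<bar>" if "0 \<le> r" "r \<le> 1" "0 \<le> q" "q \<le> 1" for a b r q :: real
    using mult_left_le[of r "\<bar>a\<bar>"] mult_left_le[of q "\<bar>b\<bar>"] that abs_triangle_ineq[of "a*r" "b*q"]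
    by (simp add: abs_mult)
  consider "j = 0" | "j = 1" | "j = 2" using assms(2) by linarith
  then show ?thesis
  proof cases
    case 1
    have "hiter 0 v x - v j = (v 1 - v 0) * s + (v 2 - v 0) * t"
      by (simp add: 1 s_def t_def algebra_simps)
    then show ?thesis using *[of s t "v 1 - v 0" "v 2 - v 0"] st by (simp add: osc_def)
  next
    case 2
    have "hiter 0 v x - v j = (v 0 - v 1) * (1 - s - t) + (v 2 - v 1) * t"
      by (simp add: 2 s_def t_def algebra_simps)
    then show ?thesis using *[of "1-s-t" t "v 0 - v 1" "v 2 - v 1"] st by (simp add: osc_def)
  next
    case 3
    have "hiter 0 v x - v j = (v 0 - v 2) * (1 - s - t) + (v 1 - v 2) * s"
      by (simp add: 3 s_def t_def algebra_simps)
    then show ?thesis using *[of "1-s-t" s "v 0 - v 2" "v 1 - v 2"] st by (simp add: osc_def)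
  qed
qed

lemma hiter_step: "x \<in> K \<Longrightarrow> \<bar>hiter (Suc n) v x - hiter n v x\<bar> \<le> 2 * osc v * (3/5)^n"
proof (induction n arbitrary: v x)
  case 0
  obtain i y where i: "i < 3" "y \<in> K" "x = w i y" using K_cases[OF 0] by blast
  have T: "x \<in> Tri" "y \<in> Tri" using 0 i K_subset_Tri by auto
  have "hiter (Suc 0) v x = hiter 0 (hchild v i) y" using hiter_w i by blast
  \<comment> \<open>Since \<open>w i\<close> fixes \<open>p i\<close>, the number \<open>v i\<close>
    is a corner value of the cell and also of its child; both approximants are compared with
    it.\<close>
  moreover have "\<bar>hiter 0 (hchild v i) y - v i\<bar> \<le> osc (hchild v i)"
    using hiter_0_near[OF T(2) i(1), of "hchild v i"] by (simp add: hchild_def)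
  moreover have "\<bar>hiter 0 v x - v i\<bar> \<le> osc v" by (rule hiter_0_near[OF T(1) i(1)])
  ultimately show ?case using osc_hchild[OF i(1), of v] osc_nonneg[of v] by simp
next
  case (Suc n)
  obtain i y where i: "i < 3" "y \<in> K" "x = w i y" using K_cases[OF Suc.prems] by blast
  have "\<bar>hiter (Suc (Suc n)) v x - hiter (Suc n) v x\<bar> = \<bar>hiter (Suc n) (hchild v i) y - hiter n (hchild v i) y\<bar>"
    using hiter_w[OF i(1,2)] i(3) by metis
  also have "\<dots> \<le> 2 * osc (hchild v i) * (3/5)^n" by (rule Suc.IH[OF i(2)])
  also have "\<dots> \<le> 2 * (3/5 * osc v) * (3/5)^n"
    using osc_hchild[OF i(1), of v] by (intro mult_right_mono mult_left_mono) auto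
  finally show ?case by simp
qed

definition hext :: "(nat \<Rightarrow> real) \<Rightarrow> pt \<Rightarrow> real" where
  "hext v x = lim (\<lambda>n. hiter n v x)"

lemma uniform_limit_hext: "uniform_limit K (\<lambda>n. hiter n v) (hext v) sequentially"
proof -
  let ?f = "\<lambda>n x. hiter (Suc n) v x - hiter n v x"
  have "uniform_limit K (\<lambda>n x. \<Sum>i<n. ?f i x) (\<lambda>x. \<Sum>i. ?f i x) sequentially"
  proof (rule Weierstrass_m_test)
    show "norm (?f n x) \<le> 2 * osc v * (3/5)^n" if "x \<in> K" for n x
      using hiter_step[OF that] by simp
    show "summable (\<lambda>n. 2 * osc v * (3/5)^n)"
      by (intro summable_mult summable_geometric) simp
  qed
  then have "uniform_limit K (\<lambda>n x. hiter 0 v x + (\<Sum>i<n. ?f i x)) (\<lambda>x. hiter 0 v x + (\<Sum>i. ?f i x)) sequentially"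
    by (intro uniform_limit_intros)
  then have u: "uniform_limit K (\<lambda>n x. hiter n v x) (\<lambda>x. hiter 0 v x + (\<Sum>i. ?f i x)) sequentially"
    using sum_lessThan_telescope[of "\<lambda>n. hiter n v _"] by simp
  have "hext v x = hiter 0 v x + (\<Sum>i. ?f i x)" if "x \<in> K" for x
    unfolding hext_def by (rule limI) (rule tendsto_uniform_limitI[OF u that])
  then show ?thesis using u by (subst uniform_limit_cong'[where g = "\<lambda>n. hiter n v" and i = "\<lambda>x. hiter 0 v x + (\<Sum>i. ?f i x)"]) auto
qed

lemma hext_tendsto: "x \<in> K \<Longrightarrow> (\<lambda>n. hiter n v x) \<longlonglongrightarrow> hext v x"
  by (rule tendsto_uniform_limitI[OF uniform_limit_hext])

lemma continuous_hext: "continuous_on K (hext v)"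
  by (rule uniform_limit_theorem[OF _ uniform_limit_hext]) (simp_all add: continuous_hiter)

lemma hext_w:
  assumes "i < 3" "x \<in> K"
  shows "hext v (w i x) = hext (hchild v i) x"
proof -
  have "(\<lambda>n. hiter (Suc n) v (w i x)) \<longlonglongrightarrow> hext v (w i x)"
    using hext_tendsto[OF w_K[OF assms]] by (rule LIMSEQ_Suc)
  then have "(\<lambda>n. hiter n (hchild v i) x) \<longlonglongrightarrow> hext v (w i x)"
    by (simp only: hiter_w[OF assms])
  then show ?thesis using hext_tendsto[OF assms(2)] LIMSEQ_unique by blast
qed

lemma hext_p: "j < 3 \<Longrightarrow> hext v (p j) = v j"
  using LIMSEQ_unique[OF hext_tendsto[OF p_in_K], of j v "v j"] by (simp add: hiter_p)

lemma hiter_cong: "(\<And>j. j < 3 \<Longrightarrow> u j = v j) \<Longrightarrow> hiter n u = hiter n v"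
proof (induction n arbitrary: u v)
  case 0
  then show ?case by simp
next
  case (Suc n)
  have "hiter n (hchild u i) = hiter n (hchild v i)" if "i < 3" for i
    by (rule Suc.IH) (simp add: hchild_def Suc.prems that)
  then have "glue (\<lambda>i. hiter n (hchild u i)) x = glue (\<lambda>i. hiter n (hchild v i)) x" for x
    by (simp add: glue_def)
  then show ?case by auto
qed

lemma hext_cong: "(\<And>j. j < 3 \<Longrightarrow> u j = v j) \<Longrightarrow> hext u = hext v"
  unfolding hext_def using hiter_cong[of u v] by simp

lemma hiter_add: "hiter n (\<lambda>j. u j + v j) x = hiter n u x + hiter n v x"
proof (induction n arbitrary: u v x)
  case (Suc n)
  have "hchild (\<lambda>j. u j + v j) i = (\<lambda>j. hchild u i j + hchild v i j)" for i
    by (rule ext) (simp add: hchild_def field_simps)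
  then show ?case by (simp add: glue_def Suc.IH)
qed (simp add: algebra_simps)

lemma hiter_const: "hiter n (\<lambda>j. c) x = c"
proof (induction n arbitrary: x)
  case (Suc n)
  have "hchild (\<lambda>j. c) i = (\<lambda>j. c)" for i by (rule ext) (simp add: hchild_def)
  then show ?case by (simp add: glue_def Suc.IH)
qed simp

lemma hext_add: "x \<in> K \<Longrightarrow> hext (\<lambda>j. u j + v j) x = hext u x + hext v x"
  using tendsto_add[OF hext_tendsto hext_tendsto, of x x u v] hext_tendsto[of x "\<lambda>j. u j + v j"] LIMSEQ_unique
  by (simp add: hiter_add)

lemma hext_const [simp]: "hext (\<lambda>j. c) x = c"
  unfolding hext_def hiter_const by (rule limI) simp

lemma hext_zero: "(\<And>j. j < 3 \<Longrightarrow> v j = 0) \<Longrightarrow> hext v x = 0"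
  using hext_cong[of v "\<lambda>_. 0"] by simp

text \<open>Restricted to a cell, an extension is again the extension of some corner values, so the
  midpoint rule has to be verified for the empty word only.\<close>

lemma hext_wmap:
  assumes "\<sigma> \<in> Words"
  shows "\<exists>u. \<forall>x\<in>K. hext v (wmap \<sigma> x) = hext u x"
  using assms
proof (induction \<sigma> arbitrary: v)
  case (Cons i \<sigma>)
  then obtain u where "\<forall>x\<in>K. hext (hchild v i) (wmap \<sigma> x) = hext u x" by auto
  then show ?case
    using Cons.prems hext_w[of i _ v] wmap_K[of \<sigma>] by (intro exI[of _ u]) auto
qed auto

lemma harmonic_at_hext_Nil: "harmonic_at (hext u) []"
  unfolding harmonic_at_def by (simp add: hext_w p_in_K hext_p hchild_def)

lemma harmonic_at_transfer:
  assumes "\<And>x. x \<in> K \<Longrightarrow> f (wmap \<tau> x) = h (wmap \<sigma> x)"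
  shows "harmonic_at f \<tau> \<longleftrightarrow> harmonic_at h \<sigma>"
  unfolding harmonic_at_def by (simp add: assms p_in_K w_K)

lemma harmonic_in_hext: "harmonic_in (hext v) []"
  unfolding harmonic_in_def
proof
  fix \<rho> assume "\<rho> \<in> Words"
  then obtain u where "\<forall>x\<in>K. hext v (wmap \<rho> x) = hext u x" using hext_wmap by blast
  then show "harmonic_at (hext v) ([] @ \<rho>)"
    using harmonic_at_transfer[of "hext v" \<rho> "hext u" "[]"] harmonic_at_hext_Nil by simp
qed

lemma harmonic_in_transfer:
  assumes "\<And>x. x \<in> K \<Longrightarrow> f (wmap \<tau> x) = h x" "harmonic_in h []"
  shows "harmonic_in f \<tau>"
  unfolding harmonic_in_def
proof
  fix \<rho> assume r: "\<rho> \<in> Words"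
  have "harmonic_at f (\<tau> @ \<rho>) \<longleftrightarrow> harmonic_at h \<rho>"
    by (rule harmonic_at_transfer) (simp add: wmap_append assms(1) wmap_K[OF r])
  then show "harmonic_at f (\<tau> @ \<rho>)" using assms(2) r by (simp add: harmonic_in_def)
qed

text \<open>From level \<open>n\<close> on no cell has a defect, so the level energies are constant
  there, and the earlier ones are not larger.\<close>

lemma harmonic_levels_imp_FF:
  assumes "continuous_on K f" "\<And>\<sigma>. \<sigma> \<in> level_words n \<Longrightarrow> harmonic_in f \<sigma>"
  shows "f \<in> FF"
proof -
  have "energy_at (n + k) f = energy_at n f" for k
  proof (induction k)
    case (Suc k)
    have "\<forall>\<sigma>\<in>level_words (n + k). harmonic_at f \<sigma>"
    proof
      fix \<sigma> assume s: "\<sigma> \<in> level_words (n + k)"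
      then have "take n \<sigma> \<in> level_words n" "drop n \<sigma> \<in> Words"
        by (auto simp: level_words_def Words_def dest: in_set_takeD in_set_dropD)
      then have "harmonic_at f (take n \<sigma> @ drop n \<sigma>)"
        using assms(2) unfolding harmonic_in_def by blast
      then show "harmonic_at f \<sigma>" by simp
    qed
    then have "energy_at (Suc (n + k)) f = energy_at (n + k) f" unfolding energy_at_Suc_eq_iff .
    then show ?case using Suc by simp
  qed simp
  then have "energy_at m f \<le> energy_at n f" for m
    using energy_at_mono[of m "n + m" f] by simp
  then show ?thesis unfolding FF_iff using assms(1) by blast
qed

lemma hext_in_FF: "hext v \<in> FF"
  by (rule harmonic_levels_imp_FF[of _ 0]) (simp_all add: continuous_hext harmonic_in_hext)

section \<open>Harmonic splines of level \<open>n\<close> with vertex values taken from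
  \<open>g\<close>\<close>

fun pharm :: "nat \<Rightarrow> (pt \<Rightarrow> real) \<Rightarrow> pt \<Rightarrow> real" where
  "pharm 0 g = hext (\<lambda>j. g (p j))"
| "pharm (Suc n) g = glue (\<lambda>i. pharm n (g \<circ> w i))"

lemma compatible_pharm_aux:
  assumes "\<And>g j. j < 3 \<Longrightarrow> pharm n g (p j) = g (p j)"
  shows "compatible (\<lambda>i. pharm n (g \<circ> w i))"
  using assms by (simp add: compatible_def w_p_swap)

lemma pharm_p: "j < 3 \<Longrightarrow> pharm n g (p j) = g (p j)"
proof (induction n arbitrary: g j)
  case (Suc n)
  then show ?case
    using glue_w[OF compatible_pharm_aux[of n g], of j "p j"] p_in_K by simp
qed (simp add: hext_p)

lemma compatible_pharm: "compatible (\<lambda>i. pharm n (g \<circ> w i))"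
  using compatible_pharm_aux pharm_p by blast

lemma continuous_pharm: "continuous_on K (pharm n g)"
  by (induction n arbitrary: g) (simp_all add: continuous_hext continuous_glue compatible_pharm)

lemma pharm_wmap: "\<sigma> \<in> level_words n \<Longrightarrow> x \<in> K \<Longrightarrow> pharm n g (wmap \<sigma> x) = hext (\<lambda>j. g (wmap \<sigma> (p j))) x"
proof (induction n arbitrary: g \<sigma>)
  case (Suc n)
  then obtain i \<tau> where s: "\<sigma> = i # \<tau>" "i < 3" "\<tau> \<in> level_words n"
    by (auto simp: level_words_def length_Suc_conv)
  then show ?case
    using Suc.IH[OF s(3) Suc.prems(2), where g = "g \<circ> w i"] wmap_K[OF level_wordsD(1)[OF s(3)] Suc.prems(2)]
    using glue_w[OF compatible_pharm[of n g] s(2), of "wmap \<tau> x"] by (simp add: comp_def)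
qed simp

lemma pharm_in_FF: "pharm n g \<in> FF"
proof (rule harmonic_levels_imp_FF)
  show "harmonic_in (pharm n g) \<sigma>" if "\<sigma> \<in> level_words n" for \<sigma>
    using harmonic_in_transfer[OF pharm_wmap[OF that] harmonic_in_hext] .
qed (rule continuous_pharm)

section \<open>Potentials and forms on a single cell\<close>

definition cell_harmonic :: "nat list \<Rightarrow> (nat \<Rightarrow> real) \<Rightarrow> pt \<Rightarrow> real" where
  "cell_harmonic \<tau> v x = hext v (inv (wmap \<tau>) x)"

lemma inv_wmap [simp]: "inv (wmap \<tau>) (wmap \<tau> x) = x"
  by (simp add: inv_f_f inj_def)

lemma cell_harmonic_wmap [simp]: "cell_harmonic \<tau> v (wmap \<tau> x) = hext v x"
  by (simp add: cell_harmonic_def)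

lemma harmonic_in_cell_harmonic: "harmonic_in (cell_harmonic \<tau> v) \<tau>"
  by (rule harmonic_in_transfer[OF _ harmonic_in_hext]) simp

lemma continuous_cell_harmonic: "continuous_on (cell \<tau>) (cell_harmonic \<tau> v)"
proof -
  have "continuous_on (wmap \<tau> ` K) (inv (wmap \<tau>))"
    by (rule continuous_on_inv[OF continuous_wmap compact_K]) simp
  then have "continuous_on (wmap \<tau> ` K) (\<lambda>x. hext v (inv (wmap \<tau>) x))"
    by (rule continuous_on_compose2[OF continuous_hext]) auto
  then show ?thesis unfolding cell_def cell_harmonic_def .
qed

text \<open>The indicator of a cell is not continuous; instead, each corner of the cell gets a tent function,
  and the potential is shifted so as to vanish at that corner.\<close>

definition cell_form_terms :: "nat list \<Rightarrow> (nat \<Rightarrow> real) \<Rightarrow> ((pt \<Rightarrow> real) \<times> (pt \<Rightarrow> real)) list" where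
  "cell_form_terms \<tau> v = map (\<lambda>j. (pharm (length \<tau>) (\<lambda>u. of_bool (u = wmap \<tau> (p j))),
     pharm (length \<tau>) (\<lambda>u. \<Sum>i<3. of_bool (u = wmap \<tau> (p i)) * (v i - v j)))) [0, 1, 2]"

definition cell_form :: "nat list \<Rightarrow> (nat \<Rightarrow> real) \<Rightarrow> form" where
  "cell_form \<tau> v = form_of (cell_form_terms \<tau> v)"

lemma cell_form_in_Omega1: "cell_form \<tau> v \<in> Omega1"
proof -
  have "set (cell_form_terms \<tau> v) \<subseteq> FF \<times> FF"
    using pharm_in_FF by (auto simp: cell_form_terms_def)
  then show ?thesis unfolding Omega1_def cell_form_def by blast
qed

lemma cell_form_eq:
  assumes "x \<in> K" "y \<in> K"
  shows "cell_form \<tau> v x y = (\<Sum>j<3. pharm (length \<tau>) (\<lambda>u. of_bool (u = wmap \<tau> (p j))) x *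
    (pharm (length \<tau>) (\<lambda>u. \<Sum>i<3. of_bool (u = wmap \<tau> (p i)) * (v i - v j)) x
      - pharm (length \<tau>) (\<lambda>u. \<Sum>i<3. of_bool (u = wmap \<tau> (p i)) * (v i - v j)) y))"
  using assms
  by (simp add: cell_form_def cell_form_terms_def form_of_def fdg_def eval_nat_numeral)

text \<open>On the cell each shifted potential differs from \<open>hext v\<close> by a constant, so
  all three have the same increments, and the three tent functions add up to 1.\<close>

lemma cell_form_on_cell:
  assumes t: "\<tau> \<in> Words" and xy: "x \<in> K" "y \<in> K"
  shows "cell_form \<tau> v (wmap \<tau> x) (wmap \<tau> y) = hext v x - hext v y"
proof -
  have tl: "\<tau> \<in> level_words (length \<tau>)" using t by (simp add: level_words_def)
  have tent: "pharm (length \<tau>) (\<lambda>u. of_bool (u = wmap \<tau> (p j))) (wmap \<tau> x) = hext (\<lambda>i. of_bool (i = j)) x"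
    if "j < 3" for j
    unfolding pharm_wmap[OF tl xy(1)] using that p_eq_iff[of _ j] by (intro fun_cong[OF hext_cong]) simp
  have pot: "pharm (length \<tau>) (\<lambda>u. \<Sum>i<3. of_bool (u = wmap \<tau> (p i)) * (v i - v j)) (wmap \<tau> z) = hext v z - v j"
    if "j < 3" "z \<in> K" for j z
  proof -
    have "(\<Sum>i<3. of_bool (p k = p i) * (v i - v j)) = v k + (- v j)" if "k < 3" for k
    proof -
      have "(\<Sum>i<3. of_bool (p k = p i) * (v i - v j)) = (\<Sum>i<3. of_bool (k = i) * (v i - v j))"
        using that p_eq_iff[of k] by (intro sum.cong) auto
      also have "\<dots> = (\<Sum>i<3. if k = i then v i - v j else 0)" by (intro sum.cong) auto
      finally show ?thesis using that by simp
    qed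
    then have "pharm (length \<tau>) (\<lambda>u. \<Sum>i<3. of_bool (u = wmap \<tau> (p i)) * (v i - v j)) (wmap \<tau> z)
        = hext (\<lambda>k. v k + (- v j)) z"
      unfolding pharm_wmap[OF tl that(2)] by (intro fun_cong[OF hext_cong]) simp
    then show ?thesis using hext_add[OF that(2), of v "\<lambda>_. - v j"] by simp
  qed
  have "cell_form \<tau> v (wmap \<tau> x) (wmap \<tau> y) = (\<Sum>j<3. hext (\<lambda>i. of_bool (i = j)) x * (hext v x - hext v y))"
    unfolding cell_form_eq[OF wmap_K[OF t xy(1)] wmap_K[OF t xy(2)]]
    by (intro sum.cong refl) (simp only: lessThan_iff tent pot xy, simp)
  also have "\<dots> = (\<Sum>j<3. hext (\<lambda>i. of_bool (i = j)) x) * (hext v x - hext v y)"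
    by (simp add: sum_distrib_right)
  also have "(\<Sum>j<3. hext (\<lambda>i. of_bool (i = j)) x) = hext (\<lambda>i. of_bool (i = 0) + of_bool (i = 1) + of_bool (i = 2)) x"
    by (simp add: hext_add[OF xy(1)] eval_nat_numeral)
  also have "hext (\<lambda>i. of_bool (i = 0) + of_bool (i = 1) + of_bool (i = 2)) = hext (\<lambda>_. 1)"
    by (rule hext_cong) (auto simp: less_Suc_eq eval_nat_numeral)
  finally show ?thesis by simp
qed

text \<open>Another cell of the same level shares at most one corner with \<tau>. The tents of the
  remaining corners vanish on it, and the potential that accompanies the tent of the shared corner
  was shifted to vanish exactly there.\<close>

lemma cell_form_off_cell:
  assumes "\<tau> \<in> Words" "\<tau>' \<in> level_words (length \<tau>)" "\<tau>' \<noteq> \<tau>" "x \<in> K" "y \<in> K"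
  shows "cell_form \<tau> v (wmap \<tau>' x) (wmap \<tau>' y) = 0"
proof -
  let ?n = "length \<tau>"
  have tl: "\<tau> \<in> level_words ?n" using assms(1) by (simp add: level_words_def)
  have K': "wmap \<tau>' x \<in> K" "wmap \<tau>' y \<in> K"
    using assms wmap_K level_wordsD(1) by blast+
  have "pharm ?n (\<lambda>u. of_bool (u = wmap \<tau> (p j))) (wmap \<tau>' x) *
    (pharm ?n (\<lambda>u. \<Sum>i<3. of_bool (u = wmap \<tau> (p i)) * (v i - v j)) (wmap \<tau>' x)
      - pharm ?n (\<lambda>u. \<Sum>i<3. of_bool (u = wmap \<tau> (p i)) * (v i - v j)) (wmap \<tau>' y)) = 0"
    if j: "j < 3" for j
  proof (cases "\<exists>i<3. wmap \<tau>' (p i) = wmap \<tau> (p j)")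
    case False
    then have "pharm ?n (\<lambda>u. of_bool (u = wmap \<tau> (p j))) (wmap \<tau>' x) = 0"
      unfolding pharm_wmap[OF assms(2,4)] by (intro hext_zero) auto
    then show ?thesis by simp
  next
    case True
    then obtain i where i: "i < 3" "wmap \<tau>' (p i) = wmap \<tau> (p j)" by blast
    have eq: "k = i \<and> l = j" if "k < 3" "l < 3" "wmap \<tau>' (p k) = wmap \<tau> (p l)" for k l
    proof -
      have "p i = p k"
        using wmap_inter[OF assms(2) tl p_in_Tri p_in_Tri p_in_Tri p_in_Tri i(2) that(3)] assms(3) by blast
      then have "k = i" using p_eq_iff i(1) that(1) by metis
      then show ?thesis using that i(2) j p_eq_iff by auto
    qed
    have "pharm ?n (\<lambda>u. \<Sum>i<3. of_bool (u = wmap \<tau> (p i)) * (v i - v j)) (wmap \<tau>' z) = 0" if "z \<in> K" for z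
      unfolding pharm_wmap[OF assms(2) that] using eq by (intro hext_zero sum.neutral) force
    then show ?thesis using assms(4,5) by simp
  qed
  then show ?thesis unfolding cell_form_eq[OF K'] by (intro sum.neutral) auto
qed

section \<open>The pairing of smooth forms\<close>

lemma energy_measure_integral_tendsto:
  assumes "h \<in> FF" "f \<in> FF" "g \<in> FF"
  shows "(\<lambda>m. (5/3)^m * level_sum (\<lambda>x y. (h x + h y) / 2 * (f y - f x) * (g y - g x)) m)
    \<longlonglongrightarrow> energy_measure_integral h f g"
proof -
  let ?E = "\<lambda>f g m. (5/3)^m * level_sum (\<lambda>x y. (f y - f x) * (g y - g x)) m"
  have "(\<lambda>m. (?E f (\<lambda>x. g x * h x) m - ?E (\<lambda>x. f x * g x) h m + ?E (\<lambda>x. h x * f x) g m) / 2)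
      \<longlonglongrightarrow> energy_measure_integral h f g"
    unfolding energy_measure_integral_def
    by (intro tendsto_intros energy_form_tendsto FF_mult assms) simp
  also have "(\<lambda>m. (?E f (\<lambda>x. g x * h x) m - ?E (\<lambda>x. f x * g x) h m + ?E (\<lambda>x. h x * f x) g m) / 2)
      = (\<lambda>m. (5/3)^m * level_sum (\<lambda>x y. (h x + h y) / 2 * (f y - f x) * (g y - g x)) m)"
  proof
    fix m
    have half: "(c * X - c * Y + c * Z) / 2 = c * (1/2 * ((X - Y) + Z))" for c X Y Z :: real
      by (simp add: field_simps)
    have "(h x + h y) / 2 * (f y - f x) * (g y - g x) = 1/2 * (((f y - f x) * (g y * h y - g x * h x)
        - (f y * g y - f x * g x) * (h y - h x)) + (h y * f y - h x * f x) * (g y - g x))" for x y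
      by (simp add: field_simps)
    then show "(?E f (\<lambda>x. g x * h x) m - ?E (\<lambda>x. f x * g x) h m + ?E (\<lambda>x. h x * f x) g m) / 2
        = (5/3)^m * level_sum (\<lambda>x y. (h x + h y) / 2 * (f y - f x) * (g y - g x)) m"
      by (simp only: level_sum_scale level_sum_add_fun level_sum_diff_fun) (rule half)
  qed
  finally show ?thesis .
qed

section \<open>Approximation of the pairing on one level\<close>

definition Q_at :: "nat \<Rightarrow> form \<Rightarrow> form \<Rightarrow> real" where
  "Q_at m \<omega> \<eta> = (5/3)^m * level_sum (\<lambda>x y. 1/2 * (\<omega> y x * \<eta> y x + \<omega> x y * \<eta> x y)) m"

lemma Q_at_add_left: "Q_at m (\<lambda>x y. \<omega> x y + \<omega>' x y) \<eta> = Q_at m \<omega> \<eta> + Q_at m \<omega>' \<eta>"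
proof -
  have "level_sum (\<lambda>x y. 1/2 * ((\<omega> y x + \<omega>' y x) * \<eta> y x + (\<omega> x y + \<omega>' x y) * \<eta> x y)) m
    = level_sum (\<lambda>x y. 1/2 * (\<omega> y x * \<eta> y x + \<omega> x y * \<eta> x y) + 1/2 * (\<omega>' y x * \<eta> y x + \<omega>' x y * \<eta> x y)) m"
    by (rule level_sum_cong) (simp add: algebra_simps)
  then show ?thesis by (simp only: Q_at_def level_sum_add_fun distrib_left)
qed

lemma Q_at_scale_left: "Q_at m (\<lambda>x y. c * \<omega> x y) \<eta> = c * Q_at m \<omega> \<eta>"
proof -
  have "level_sum (\<lambda>x y. 1/2 * (c * \<omega> y x * \<eta> y x + c * \<omega> x y * \<eta> x y)) m
    = level_sum (\<lambda>x y. c * (1/2 * (\<omega> y x * \<eta> y x + \<omega> x y * \<eta> x y))) m"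
    by (rule level_sum_cong) (simp add: algebra_simps)
  then show ?thesis by (simp only: Q_at_def level_sum_scale mult.left_commute)
qed

lemma Q_at_commute: "Q_at m \<omega> \<eta> = Q_at m \<eta> \<omega>"
  by (simp add: Q_at_def mult.commute)

lemma Q_at_add_right: "Q_at m \<eta> (\<lambda>x y. \<omega> x y + \<omega>' x y) = Q_at m \<eta> \<omega> + Q_at m \<eta> \<omega>'"
  using Q_at_add_left Q_at_commute by metis

lemma Q_at_zero: "Q_at m (\<lambda>x y. 0) \<eta> = 0" "Q_at m \<eta> (\<lambda>x y. 0) = 0"
  by (simp_all add: Q_at_def level_sum_def cell_sum_def)

lemma Q_at_nonneg: "0 \<le> Q_at m \<omega> \<omega>"
  by (simp add: Q_at_def level_sum_nonneg)

lemma form_of_Nil: "form_of [] = (\<lambda>x y. 0)"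
  by (simp add: form_of_def)

lemma form_of_Cons: "form_of ((f, g) # ps) = (\<lambda>x y. fdg f g x y + form_of ps x y)"
  by (simp add: form_of_def)

lemma form_of_append: "form_of (ps @ qs) = (\<lambda>x y. form_of ps x y + form_of qs x y)"
  by (simp add: form_of_def)

text \<open>A form evaluates its coefficient at one endpoint only. Averaging over both orientations
  yields the mean of the two endpoint values of \<open>f * h\<close>, so \<open>Q_at\<close> is
  exactly the approximant of the energy measure, with no error term.\<close>

lemma Q_at_fdg_tendsto:
  assumes "f \<in> FF" "g \<in> FF" "h \<in> FF" "k \<in> FF"
  shows "(\<lambda>m. Q_at m (fdg f g) (fdg h k)) \<longlonglongrightarrow> energy_measure_integral (\<lambda>x. f x * h x) g k"
proof -
  have "level_sum (\<lambda>x y. 1/2 * (fdg f g y x * fdg h k y x + fdg f g x y * fdg h k x y)) m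
      = level_sum (\<lambda>x y. (f x * h x + f y * h y) / 2 * (g y - g x) * (k y - k x)) m" for m
    by (rule level_sum_cong) (simp add: fdg_def field_simps)
  then have "Q_at m (fdg f g) (fdg h k)
      = (5/3)^m * level_sum (\<lambda>x y. (f x * h x + f y * h y) / 2 * (g y - g x) * (k y - k x)) m" for m
    by (simp only: Q_at_def)
  then show ?thesis
    using energy_measure_integral_tendsto[OF FF_mult[OF assms(1,3)] assms(2,4)] by simp
qed

lemma Q_at_form_of_tendsto:
  assumes "set ps \<subseteq> FF \<times> FF" "set qs \<subseteq> FF \<times> FF"
  shows "(\<lambda>m. Q_at m (form_of ps) (form_of qs)) \<longlonglongrightarrow>
    (\<Sum>(f, g)\<leftarrow>ps. \<Sum>(h, k)\<leftarrow>qs. energy_measure_integral (\<lambda>x. f x * h x) g k)"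
  using assms(1)
proof (induction ps)
  case Nil
  then show ?case by (simp add: form_of_Nil Q_at_zero)
next
  case (Cons a ps)
  obtain f g where a: "a = (f, g)" "f \<in> FF" "g \<in> FF" using Cons.prems by (cases a) auto
  have "(\<lambda>m. Q_at m (fdg f g) (form_of qs)) \<longlonglongrightarrow>
    (\<Sum>(h, k)\<leftarrow>qs. energy_measure_integral (\<lambda>x. f x * h x) g k)"
    using assms(2)
  proof (induction qs)
    case Nil
    then show ?case by (simp add: form_of_Nil Q_at_zero)
  next
    case (Cons b qs)
    obtain h k where b: "b = (h, k)" "h \<in> FF" "k \<in> FF" using Cons.prems by (cases b) auto
    show ?case
      using Cons.IH Cons.prems Q_at_fdg_tendsto[OF a(2,3) b(2,3)]
      by (auto simp: b(1) form_of_Cons Q_at_add_right intro: tendsto_add)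
  qed
  then show ?case
    using Cons.IH Cons.prems by (auto simp: a(1) form_of_Cons Q_at_add_left intro: tendsto_add)
qed

text \<open>\<open>Q_at\<close> depends on the two forms as functions and not on their
  representations. Uniqueness of its limit is therefore what makes the bilinear extension of
  \<open>Q\<close> well defined.\<close>

lemma Q_tendsto:
  assumes "\<omega> \<in> Omega1" "\<eta> \<in> Omega1"
  shows "(\<lambda>m. Q_at m \<omega> \<eta>) \<longlonglongrightarrow> Q \<omega> \<eta>"
proof -
  obtain ps qs where ps: "set ps \<subseteq> FF \<times> FF" "form_of ps = \<omega>" and qs: "set qs \<subseteq> FF \<times> FF" "form_of qs = \<eta>"
    using assms unfolding Omega1_def by blast
  let ?q = "\<Sum>(f, g)\<leftarrow>ps. \<Sum>(h, k)\<leftarrow>qs. energy_measure_integral (\<lambda>x. f x * h x) g k"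
  have lim: "(\<lambda>m. Q_at m \<omega> \<eta>) \<longlonglongrightarrow> ?q" using Q_at_form_of_tendsto[OF ps(1) qs(1)] ps(2) qs(2) by simp
  have "Q \<omega> \<eta> = ?q"
    unfolding Q_def
  proof (rule the_equality)
    show "\<exists>ps qs. set ps \<subseteq> FF \<times> FF \<and> set qs \<subseteq> FF \<times> FF \<and> form_of ps = \<omega> \<and> form_of qs = \<eta> \<and>
      ?q = (\<Sum>(f, g)\<leftarrow>ps. \<Sum>(h, k)\<leftarrow>qs. energy_measure_integral (\<lambda>x. f x * h x) g k)"
      using ps qs by blast
    fix q
    assume "\<exists>ps qs. set ps \<subseteq> FF \<times> FF \<and> set qs \<subseteq> FF \<times> FF \<and> form_of ps = \<omega> \<and> form_of qs = \<eta> \<and>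
      q = (\<Sum>(f, g)\<leftarrow>ps. \<Sum>(h, k)\<leftarrow>qs. energy_measure_integral (\<lambda>x. f x * h x) g k)"
    then have "(\<lambda>m. Q_at m \<omega> \<eta>) \<longlonglongrightarrow> q" using Q_at_form_of_tendsto by blast
    then show "q = ?q" using lim LIMSEQ_unique by blast
  qed
  then show ?thesis using lim by simp
qed

section \<open>The vector space of smooth forms and its semidefinite form \<open>Q\<close>\<close>

lemma Omega1_add: "\<omega> \<in> Omega1 \<Longrightarrow> \<eta> \<in> Omega1 \<Longrightarrow> (\<lambda>x y. \<omega> x y + \<eta> x y) \<in> Omega1"
proof -
  assume "\<omega> \<in> Omega1" "\<eta> \<in> Omega1"
  then obtain ps qs where "set ps \<subseteq> FF \<times> FF" "form_of ps = \<omega>" "set qs \<subseteq> FF \<times> FF" "form_of qs = \<eta>"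
    unfolding Omega1_def by blast
  then have "set (ps @ qs) \<subseteq> FF \<times> FF" "form_of (ps @ qs) = (\<lambda>x y. \<omega> x y + \<eta> x y)"
    by (auto simp: form_of_append)
  then show ?thesis unfolding Omega1_def by (metis (mono_tags, lifting) mem_Collect_eq)
qed

lemma fdg_in_Omega1: "f \<in> FF \<Longrightarrow> g \<in> FF \<Longrightarrow> fdg f g \<in> Omega1"
  unfolding Omega1_def by (intro CollectI exI[of _ "[(f, g)]"]) (auto simp: form_of_def)

lemma zero_in_Omega1: "(\<lambda>x y. 0) \<in> Omega1"
  unfolding Omega1_def by (intro CollectI exI[of _ "[]"]) (simp add: form_of_Nil)

lemma Omega1_scale:
  assumes "\<omega> \<in> Omega1"
  shows "(\<lambda>x y. c * \<omega> x y) \<in> Omega1"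
proof -
  obtain ps where "set ps \<subseteq> FF \<times> FF" "form_of ps = \<omega>"
    using assms unfolding Omega1_def by blast
  then show ?thesis
  proof (induction ps arbitrary: \<omega>)
    case Nil
    then show ?case using zero_in_Omega1 by (auto simp: form_of_Nil)
  next
    case (Cons a ps)
    obtain f g where a: "a = (f, g)" "f \<in> FF" "g \<in> FF" using Cons.prems by (cases a) auto
    have "(\<lambda>x y. c * form_of ps x y) \<in> Omega1" using Cons by auto
    then have "(\<lambda>x y. fdg (\<lambda>x. c * f x) g x y + c * form_of ps x y) \<in> Omega1"
      using a by (intro Omega1_add fdg_in_Omega1 FF_scale)
    moreover have "(\<lambda>x y. fdg (\<lambda>x. c * f x) g x y + c * form_of ps x y) = (\<lambda>x y. c * \<omega> x y)"
      using Cons.prems(2)[symmetric] by (auto simp: a(1) form_of_Cons fdg_def algebra_simps fun_eq_iff)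
    ultimately show ?case by simp
  qed
qed

lemma Omega1_diff: "\<omega> \<in> Omega1 \<Longrightarrow> \<eta> \<in> Omega1 \<Longrightarrow> (\<lambda>x y. \<omega> x y - \<eta> x y) \<in> Omega1"
  using Omega1_add[OF _ Omega1_scale[of \<eta> "-1"], of \<omega>] by simp

lemma Omega1_sum: "finite A \<Longrightarrow> (\<And>i. i \<in> A \<Longrightarrow> \<omega> i \<in> Omega1) \<Longrightarrow> (\<lambda>x y. \<Sum>i\<in>A. \<omega> i x y) \<in> Omega1"
  by (induction rule: finite_induct) (simp_all add: zero_in_Omega1 Omega1_add)

lemma Q_commute: "\<omega> \<in> Omega1 \<Longrightarrow> \<eta> \<in> Omega1 \<Longrightarrow> Q \<omega> \<eta> = Q \<eta> \<omega>"
  using Q_tendsto[of \<omega> \<eta>] Q_tendsto[of \<eta> \<omega>] LIMSEQ_unique by (simp add: Q_at_commute)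

lemma Q_add_left:
  "\<omega> \<in> Omega1 \<Longrightarrow> \<omega>' \<in> Omega1 \<Longrightarrow> \<eta> \<in> Omega1 \<Longrightarrow> Q (\<lambda>x y. \<omega> x y + \<omega>' x y) \<eta> = Q \<omega> \<eta> + Q \<omega>' \<eta>"
  using Q_tendsto[OF Omega1_add[of \<omega> \<omega>'], of \<eta>] tendsto_add[OF Q_tendsto[of \<omega> \<eta>] Q_tendsto[of \<omega>' \<eta>]]
    LIMSEQ_unique by (simp add: Q_at_add_left)

lemma Q_scale_left: "\<omega> \<in> Omega1 \<Longrightarrow> \<eta> \<in> Omega1 \<Longrightarrow> Q (\<lambda>x y. c * \<omega> x y) \<eta> = c * Q \<omega> \<eta>"
  using Q_tendsto[OF Omega1_scale[of \<omega> c], of \<eta>] tendsto_mult_left[OF Q_tendsto[of \<omega> \<eta>], of c]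
    LIMSEQ_unique by (simp add: Q_at_scale_left)

lemma Q_diff_left:
  "\<omega> \<in> Omega1 \<Longrightarrow> \<omega>' \<in> Omega1 \<Longrightarrow> \<eta> \<in> Omega1 \<Longrightarrow> Q (\<lambda>x y. \<omega> x y - \<omega>' x y) \<eta> = Q \<omega> \<eta> - Q \<omega>' \<eta>"
  using Q_add_left[OF _ Omega1_scale[of \<omega>' "-1"], of \<omega> \<eta>] Q_scale_left[of \<omega>' \<eta> "-1"] by simp

lemma Q_sum_left:
  assumes "finite A" "\<And>i. i \<in> A \<Longrightarrow> \<omega> i \<in> Omega1" "\<eta> \<in> Omega1"
  shows "Q (\<lambda>x y. \<Sum>i\<in>A. c i * \<omega> i x y) \<eta> = (\<Sum>i\<in>A. c i * Q (\<omega> i) \<eta>)"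
  using assms(1,2)
proof (induction rule: finite_induct)
  case empty
  have "(\<lambda>m. 0) \<longlonglongrightarrow> Q (\<lambda>x y. 0) \<eta>"
    using Q_tendsto[OF zero_in_Omega1 assms(3)] by (simp add: Q_at_zero)
  then show ?case by (simp add: LIMSEQ_const_iff)
next
  case (insert i A)
  then have "(\<lambda>x y. \<Sum>i\<in>A. c i * \<omega> i x y) \<in> Omega1" by (intro Omega1_sum Omega1_scale) auto
  then show ?case
    using insert assms(3) by (simp add: Q_add_left Omega1_scale Q_scale_left)
qed

lemma Q_nonneg: "\<omega> \<in> Omega1 \<Longrightarrow> 0 \<le> Q \<omega> \<omega>"
  using Q_tendsto[of \<omega> \<omega>] LIMSEQ_le_const Q_at_nonneg by blast

lemma Qnorm_power2: "\<omega> \<in> Omega1 \<Longrightarrow> (Qnorm \<omega>)\<^sup>2 = Q \<omega> \<omega>"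
  by (simp add: Qnorm_def Q_nonneg)

lemma Q_diff_self:
  assumes "\<omega> \<in> Omega1" "\<eta> \<in> Omega1"
  shows "Q (\<lambda>x y. \<omega> x y - \<eta> x y) (\<lambda>x y. \<omega> x y - \<eta> x y) = Q \<omega> \<omega> - 2 * Q \<omega> \<eta> + Q \<eta> \<eta>"
proof -
  have d: "(\<lambda>x y. \<omega> x y - \<eta> x y) \<in> Omega1" using assms by (rule Omega1_diff)
  have "Q (\<lambda>x y. \<omega> x y - \<eta> x y) (\<lambda>x y. \<omega> x y - \<eta> x y)
      = Q \<omega> (\<lambda>x y. \<omega> x y - \<eta> x y) - Q \<eta> (\<lambda>x y. \<omega> x y - \<eta> x y)"
    by (rule Q_diff_left[OF assms d])
  also have "Q \<omega> (\<lambda>x y. \<omega> x y - \<eta> x y) = Q \<omega> \<omega> - Q \<eta> \<omega>"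
    using Q_commute[OF assms(1) d] Q_diff_left[OF assms assms(1)] by simp
  also have "Q \<eta> (\<lambda>x y. \<omega> x y - \<eta> x y) = Q \<omega> \<eta> - Q \<eta> \<eta>"
    using Q_commute[OF assms(2) d] Q_diff_left[OF assms assms(2)] by simp
  finally show ?thesis using Q_commute[OF assms] by simp
qed

lemma Q_Cauchy_Schwarz:
  assumes "\<omega> \<in> Omega1" "\<eta> \<in> Omega1"
  shows "(Q \<omega> \<eta>)\<^sup>2 \<le> Q \<omega> \<omega> * Q \<eta> \<eta>"
proof -
  define a b c where "a = Q \<eta> \<eta>" "b = Q \<omega> \<eta>" "c = Q \<omega> \<omega>"
  have pos: "0 \<le> c - 2 * t * b + t\<^sup>2 * a" for t
  proof -
    have s: "(\<lambda>x y. t * \<eta> x y) \<in> Omega1" using assms(2) by (rule Omega1_scale)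
    have 1: "Q \<omega> (\<lambda>x y. t * \<eta> x y) = t * b"
      using Q_commute[OF assms(1) s] Q_scale_left[OF assms(2,1)] Q_commute[OF assms] by (simp add: a_b_c_def)
    have 2: "Q (\<lambda>x y. t * \<eta> x y) (\<lambda>x y. t * \<eta> x y) = t\<^sup>2 * a"
      using Q_scale_left[OF assms(2) s] Q_commute[OF assms(2) s] Q_scale_left[OF assms(2,2)]
      by (simp add: a_b_c_def power2_eq_square)
    have "0 \<le> Q (\<lambda>x y. \<omega> x y - t * \<eta> x y) (\<lambda>x y. \<omega> x y - t * \<eta> x y)"
      by (rule Q_nonneg[OF Omega1_diff[OF assms(1) s]])
    also have "\<dots> = c - 2 * (t * b) + t\<^sup>2 * a"
      unfolding Q_diff_self[OF assms(1) s] 1 2 by (simp add: a_b_c_def)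
    finally show ?thesis by (simp add: mult.assoc)
  qed
  show ?thesis
  proof (cases "a = 0")
    case True
    have "b = 0"
    proof (rule ccontr)
      assume "b \<noteq> 0"
      \<comment> \<open>With \<open>a = 0\<close> the quadratic is affine in \<open>t\<close>, and
        at this \<open>t\<close> it equals -1.\<close>
      then show False using pos[of "(c + 1) / (2 * b)"] True by simp
    qed
    then show ?thesis using True by (simp add: a_b_c_def)
  next
    case False
    then have "a > 0" using Q_nonneg[OF assms(2)] by (simp add: a_b_c_def)
    \<comment> \<open>The quadratic in \<open>t\<close> attains its minimum at
      \<open>b / a\<close>.\<close>
    then show ?thesis
      using pos[of "b / a"] by (simp add: a_b_c_def[symmetric] power2_eq_square field_simps)
  qed
qed

text \<open>By Cauchy-Schwarz a null form pairs to zero with every form. This permits replacing the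
  chosen minimizer \<open>dz \<sigma>\<close> by an explicit form inside pairings.\<close>

lemma Q_eq_if_Q_diff_zero:
  assumes "\<omega> \<in> Omega1" "\<omega>' \<in> Omega1" "\<eta> \<in> Omega1"
    and "Q (\<lambda>x y. \<omega> x y - \<omega>' x y) (\<lambda>x y. \<omega> x y - \<omega>' x y) \<le> 0"
  shows "Q \<omega> \<eta> = Q \<omega>' \<eta>"
proof -
  have d: "(\<lambda>x y. \<omega> x y - \<omega>' x y) \<in> Omega1" using assms by (intro Omega1_diff)
  have "Q (\<lambda>x y. \<omega> x y - \<omega>' x y) (\<lambda>x y. \<omega> x y - \<omega>' x y) = 0" using assms(4) Q_nonneg[OF d] by simp
  then have "Q (\<lambda>x y. \<omega> x y - \<omega>' x y) \<eta> = 0" using Q_Cauchy_Schwarz[OF d assms(3)] by simp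
  then show ?thesis using Q_diff_left[OF assms(1-3)] by simp
qed

section \<open>Subdivision of edges and path integrals\<close>

fun subdiv_sum :: "nat \<Rightarrow> (pt \<Rightarrow> pt \<Rightarrow> real) \<Rightarrow> pt \<Rightarrow> pt \<Rightarrow> real" where
  "subdiv_sum 0 F x y = F x y"
| "subdiv_sum (Suc k) F x y = subdiv_sum k F x (midpoint x y) + subdiv_sum k F (midpoint x y) y"

definition split_edge :: "(pt \<Rightarrow> pt \<Rightarrow> real) \<Rightarrow> pt \<Rightarrow> pt \<Rightarrow> real" where
  "split_edge F x y = F x (midpoint x y) + F (midpoint x y) y"

text \<open>The recursion performs the coarsest bisection first; here the finest one is split off
  instead, which is the version needed for measuring the effect of one more bisection.\<close>

lemma subdiv_sum_Suc': "subdiv_sum (Suc k) F x y = subdiv_sum k (split_edge F) x y"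
  by (induction k arbitrary: x y) (simp_all add: split_edge_def)

lemma subdiv_sum_diff: "subdiv_sum k (\<lambda>a b. F a b - G a b) x y = subdiv_sum k F x y - subdiv_sum k G x y"
  by (induction k arbitrary: x y) simp_all

lemma subdiv_sum_swap: "subdiv_sum k F y x = subdiv_sum k (\<lambda>a b. F b a) x y"
  by (induction k arbitrary: x y) (simp_all add: midpoint_sym)

lemma subdiv_sum_abs: "\<bar>subdiv_sum k F x y\<bar> \<le> subdiv_sum k (\<lambda>a b. \<bar>F a b\<bar>) x y"
proof (induction k arbitrary: x y)
  case (Suc k)
  show ?case using Suc[of x "midpoint x y"] Suc[of "midpoint x y" y] unfolding subdiv_sum.simps by linarith
qed simp

lemma subdiv_sum_nonneg: "(\<And>a b. 0 \<le> F a b) \<Longrightarrow> 0 \<le> subdiv_sum k F x y"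
  by (induction k arbitrary: x y) simp_all

lemma subdiv_sum_telescope: "subdiv_sum k (\<lambda>a b. f b - f a) x y = f y - f x" for f :: "pt \<Rightarrow> real"
  by (induction k arbitrary: x y) simp_all

section \<open>Dyadic points and the edges lying on an edge\<close>

definition dyadic_point :: "nat \<Rightarrow> pt \<Rightarrow> pt \<Rightarrow> nat \<Rightarrow> pt" where
  "dyadic_point k x y i = x + (real i / 2^k) *\<^sub>R (y - x)"

lemma dyadic_point_left: "dyadic_point (Suc k) x y i = dyadic_point k x (midpoint x y) i"
  by (rule coord_eqI) (simp_all add: dyadic_point_def midpoint_def field_simps)

lemma dyadic_point_right: "dyadic_point (Suc k) x y (2^k + i) = dyadic_point k (midpoint x y) y i"
  by (rule coord_eqI) (simp_all add: dyadic_point_def midpoint_def field_simps)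

lemma sum_lessThan_add: "(\<Sum>i<m + n. f i) = (\<Sum>i<m. f i) + (\<Sum>i<n. f (m + i))" for f :: "nat \<Rightarrow> real"
  by (induction n) (simp_all add: add.assoc)

lemma subdiv_sum_eq: "subdiv_sum k F x y = (\<Sum>i<2^k. F (dyadic_point k x y i) (dyadic_point k x y (Suc i)))"
proof (induction k arbitrary: x y)
  case 0
  then show ?case by (simp add: dyadic_point_def)
next
  case (Suc k)
  have "(\<Sum>i<2^Suc k. F (dyadic_point (Suc k) x y i) (dyadic_point (Suc k) x y (Suc i)))
    = (\<Sum>i<2^k + 2^k. F (dyadic_point (Suc k) x y i) (dyadic_point (Suc k) x y (Suc i)))"
    by (simp add: mult_2)
  also have "\<dots> = subdiv_sum (Suc k) F x y"
    unfolding sum_lessThan_add add_Suc_right[symmetric] dyadic_point_right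
    by (simp add: Suc dyadic_point_left)
  finally show ?case by simp
qed

lemma oedges_iff:
  "(x, y) \<in> oedges m \<longleftrightarrow> (\<exists>\<sigma>\<in>level_words m. \<exists>i<3. \<exists>j<3. i \<noteq> j \<and> x = wmap \<sigma> (p i) \<and> y = wmap \<sigma> (p j))"
proof -
  have "(x, y) \<in> oedges m \<longleftrightarrow> (\<exists>\<sigma>\<in>level_words m. (x, y) \<in> cell_edges \<sigma> \<or> (y, x) \<in> cell_edges \<sigma>)"
  proof -
    have "(x, y) \<in> prod.swap ` E \<longleftrightarrow> (y, x) \<in> E" for E by (force simp: image_iff)
    then show ?thesis unfolding oedges_def edges_eq by auto
  qed
  moreover have "(x, y) \<in> cell_edges \<sigma> \<or> (y, x) \<in> cell_edges \<sigma> \<longleftrightarrow>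
      (\<exists>i<3. \<exists>j<3. i \<noteq> j \<and> x = wmap \<sigma> (p i) \<and> y = wmap \<sigma> (p j))" (is "?L \<longleftrightarrow> ?R") for \<sigma>
  proof
    assume ?L
    then show ?R
    proof
      assume "(x, y) \<in> cell_edges \<sigma>"
      then show ?R by (rule cell_edgesE) auto
    next
      assume "(y, x) \<in> cell_edges \<sigma>"
      then show ?R by (rule cell_edgesE) auto
    qed
  next
    assume ?R
    then show ?L
      by (auto simp: cell_edges_def less_Suc_eq eval_nat_numeral)
  qed
  ultimately show ?thesis by simp
qed

lemma oedges_split:
  assumes "(x, y) \<in> oedges m"
  shows "(x, midpoint x y) \<in> oedges (Suc m)" "(midpoint x y, y) \<in> oedges (Suc m)"
proof -
  obtain \<sigma> i j where s: "\<sigma> \<in> level_words m" "i < 3" "j < 3" "i \<noteq> j" "x = wmap \<sigma> (p i)" "y = wmap \<sigma> (p j)"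
    using assms unfolding oedges_iff by blast
  have l: "\<sigma> @ [i] \<in> level_words (Suc m)" "\<sigma> @ [j] \<in> level_words (Suc m)"
    using s by (auto simp: level_words_def)
  have mid: "midpoint x y = wmap (\<sigma> @ [i]) (p j)" "midpoint x y = wmap (\<sigma> @ [j]) (p i)"
    using s w_p_swap[of i j] by (simp_all add: wmap_midpoint[symmetric] wmap_append w_p_midpoint midpoint_sym)
  have ends: "x = wmap (\<sigma> @ [i]) (p i)" "y = wmap (\<sigma> @ [j]) (p j)"
    using s by (simp_all add: wmap_append)
  show "(x, midpoint x y) \<in> oedges (Suc m)"
    unfolding oedges_iff using l(1) mid(1) ends(1) s(2-4) by blast
  show "(midpoint x y, y) \<in> oedges (Suc m)"
    unfolding oedges_iff using l(2) mid(2) ends(2) s(2-4) by blast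
qed

lemma dyadic_edge:
  assumes "(x, y) \<in> oedges m" "i < 2^k"
  shows "(dyadic_point k x y i, dyadic_point k x y (Suc i)) \<in> oedges (m + k)"
  using assms
proof (induction k arbitrary: m x y i)
  case 0
  then show ?case by (simp add: dyadic_point_def)
next
  case (Suc k)
  show ?case
  proof (cases "i < 2^k")
    case True
    then show ?thesis
      using Suc.IH[OF oedges_split(1)[OF Suc.prems(1)] True] by (simp add: dyadic_point_left)
  next
    case False
    then obtain j where j: "i = 2^k + j" "j < 2^k"
      using Suc.prems(2) by (metis add_less_cancel_left le_add_diff_inverse linorder_not_less mult_2 power_Suc)
    then have "Suc i = 2^k + Suc j" by simp
    then show ?thesis
      using Suc.IH[OF oedges_split(2)[OF Suc.prems(1)] j(2)] by (simp only: j(1) dyadic_point_right) simp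
  qed
qed

lemma dist_p:
  assumes "i < 3" "j < 3" "i \<noteq> j"
  shows "dist (p i) (p j) = 1"
proof -
  have d: "dist (p 0) (p 1) = 1" "dist (p 0) (p 2) = 1" "dist (p 1) (p 2) = 1"
    by (simp_all add: p_def dist_Pair_Pair dist_real_def power_divide)
  have "i \<in> {0, 1, 2}" "j \<in> {0, 1, 2}" using assms by auto
  then show ?thesis using d assms(3) by (auto simp: dist_commute)
qed

text \<open>In the oblique coordinates the vertices of a level lie on a scaled integer lattice. This
  confines the fine edges inside a coarse edge to dyadic positions.\<close>

lemma vertex_lattice: "cA (wmap \<sigma> (p i)) * 2 ^ length \<sigma> \<in> \<int>" "cB (wmap \<sigma> (p i)) * 2 ^ length \<sigma> \<in> \<int>"
proof (induction \<sigma>)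
  case (Cons j \<sigma>)
  have "cA (wmap (j # \<sigma>) (p i)) * 2 ^ length (j # \<sigma>) = cA (p j) * 2 ^ length \<sigma> + cA (wmap \<sigma> (p i)) * 2 ^ length \<sigma>"
    "cB (wmap (j # \<sigma>) (p i)) * 2 ^ length (j # \<sigma>) = cB (p j) * 2 ^ length \<sigma> + cB (wmap \<sigma> (p i)) * 2 ^ length \<sigma>"
    by (simp_all add: cA_w cB_w field_simps)
  moreover have "cA (p j) * 2 ^ length \<sigma> \<in> \<int>" "cB (p j) * 2 ^ length \<sigma> \<in> \<int>"
    by (auto simp: cA_p cB_p)
  ultimately show "cA (wmap (j # \<sigma>) (p i)) * 2 ^ length (j # \<sigma>) \<in> \<int>"
    "cB (wmap (j # \<sigma>) (p i)) * 2 ^ length (j # \<sigma>) \<in> \<int>"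
    using Cons by simp_all
qed (auto simp: cA_p cB_p)

text \<open>The definition of \<open>edges_along\<close> is geometric, by inclusion of segments and
  a positive inner product. That it selects nothing besides the dyadic pieces follows from the
  length of an edge, which fixes the step, and from the vertex lattice, which fixes the starting
  point.\<close>

lemma edges_along_eq:
  assumes e: "(x, y) \<in> oedges m"
  shows "edges_along (m + k) (x, y) = (\<lambda>i. (dyadic_point k x y i, dyadic_point k x y (Suc i))) ` {..<2^k}"
proof -
  obtain \<sigma> i j where s: "\<sigma> \<in> level_words m" "i < 3" "j < 3" "i \<noteq> j" "x = wmap \<sigma> (p i)" "y = wmap \<sigma> (p j)"
    using e unfolding oedges_iff by blast
  have len: "length \<sigma> = m" using s(1) by (rule level_wordsD)
  have d: "norm (y - x) = 1 / 2^m"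
    using s len dist_p[of i j] by (simp add: dist_norm[symmetric] dist_commute dist_wmap)
  have dpos: "(y - x) \<bullet> (y - x) > 0"
    using d by (metis inner_gt_zero_iff norm_zero zero_less_divide_1_iff less_irrefl zero_less_numeral zero_less_power)
  show ?thesis
  proof (intro equalityI subsetI)
    fix e' assume "e' \<in> (\<lambda>i. (dyadic_point k x y i, dyadic_point k x y (Suc i))) ` {..<2^k}"
    then obtain l where l: "l < 2^k" "e' = (dyadic_point k x y l, dyadic_point k x y (Suc l))" by auto
    have inseg: "dyadic_point k x y l \<in> closed_segment x y" if "l \<le> 2^k" for l
    proof -
      have "real l \<le> 2^k" using that by (metis of_nat_le_iff of_nat_numeral of_nat_power)
      then show ?thesis
        unfolding closed_segment_def dyadic_point_def
        by (intro CollectI exI[of _ "real l / 2^k"]) (auto simp: algebra_simps)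
    qed
    have "seg e' \<subseteq> seg (x, y)"
      using inseg[of l] inseg[of "Suc l"] l by (simp add: seg_def subset_closed_segment)
    moreover have "snd e' - fst e' = (1 / 2^k) *\<^sub>R (y - x)"
      by (rule coord_eqI) (simp_all add: l(2) dyadic_point_def field_simps)
    ultimately show "e' \<in> edges_along (m + k) (x, y)"
      using dyadic_edge[OF e l(1)] dpos l(2) by (simp add: edges_along_def)
  next
    fix e' assume e': "e' \<in> edges_along (m + k) (x, y)"
    obtain x' y' where xy': "e' = (x', y')" by (cases e') auto
    have E: "(x', y') \<in> oedges (m + k)" "x' \<in> closed_segment x y" "y' \<in> closed_segment x y" "(y' - x') \<bullet> (y - x) > 0"
      using e' unfolding edges_along_def xy' by (auto simp: seg_def)
    obtain a where a: "0 \<le> a" "a \<le> 1" "x' = x + a *\<^sub>R (y - x)"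
      using E(2) by (auto simp: closed_segment_def algebra_simps)
    obtain b where b: "0 \<le> b" "b \<le> 1" "y' = x + b *\<^sub>R (y - x)"
      using E(3) by (auto simp: closed_segment_def algebra_simps)
    have diff: "y' - x' = (b - a) *\<^sub>R (y - x)" by (simp add: a(3) b(3) algebra_simps)
    have ab: "b > a" using E(4) dpos unfolding diff by (simp add: zero_less_mult_iff)
    obtain \<tau> i' j' where t: "\<tau> \<in> level_words (m + k)" "i' < 3" "j' < 3" "i' \<noteq> j'" "x' = wmap \<tau> (p i')" "y' = wmap \<tau> (p j')"
      using E(1) unfolding oedges_iff by blast
    have len': "length \<tau> = m + k" using t(1) by (rule level_wordsD)
    \<comment> \<open>All edges of level \<open>m + k\<close> have the same length, so the
      parameters of the two endpoints differ by 1/2^k.\<close>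
    have "norm (y' - x') = 1 / 2^(m + k)"
      using t len' dist_p[of i' j'] by (simp add: dist_norm[symmetric] dist_commute dist_wmap)
    moreover have "norm (y' - x') = (b - a) * (1 / 2^m)"
      unfolding diff using ab d by simp
    ultimately have "(b - a) * (1 / 2^m) = 1 / 2^k * (1 / 2^m)" by (simp add: power_add)
    then have "b - a = 1 / 2^k" by (subst (asm) mult_cancel_right) auto
    then have ba: "b = a + 1 / 2^k" by simp
    have lat: "cA x' * 2^(m+k) \<in> \<int>" "cB x' * 2^(m+k) \<in> \<int>"
      using vertex_lattice[of \<tau> i'] t(5) len' by simp_all
    have lat0: "cA x * 2^m \<in> \<int>" "cB x * 2^m \<in> \<int>"
      using vertex_lattice[of \<sigma> i] s(5) len by simp_all
    have A: "a * 2^k * (cA (y - x) * 2^m) \<in> \<int>"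
    proof -
      have "a * 2^k * (cA (y - x) * 2^m) = cA x' * 2^(m+k) - cA x * 2^m * 2^k"
        by (simp add: a(3) power_add algebra_simps)
      then show ?thesis using lat lat0 by simp
    qed
    have B: "a * 2^k * (cB (y - x) * 2^m) \<in> \<int>"
    proof -
      have "a * 2^k * (cB (y - x) * 2^m) = cB x' * 2^(m+k) - cB x * 2^m * 2^k"
        by (simp add: a(3) power_add algebra_simps)
      then show ?thesis using lat lat0 by simp
    qed
    have "y - x = (1 / 2^m) *\<^sub>R (p j - p i)"
      using s(5,6) len by (simp add: wmap_diff)
    then have "cA (y - x) * 2^m = cA (p j) - cA (p i)" "cB (y - x) * 2^m = cB (p j) - cB (p i)"
      by simp_all
    \<comment> \<open>Two distinct corners of the triangle differ by 1 or -1 in at least one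
      coordinate; in that coordinate the lattice condition becomes integrality of
      \<open>a * 2^k\<close>.\<close>
    then have "cA (y - x) * 2^m \<in> {1, -1} \<or> cB (y - x) * 2^m \<in> {1, -1}"
      using s(2-4) by (auto simp: cA_p cB_p)
    then have "a * 2^k \<in> \<int>" using A B by (auto simp: Ints_minus)
    then obtain z :: int where z: "a * 2^k = of_int z" by (auto elim: Ints_cases)
    have "z \<ge> 0" using z a(1) by (metis mult_nonneg_nonneg of_int_0_le_iff zero_le_numeral zero_le_power)
    define l where "l = nat z"
    have l: "a * 2^k = real l" using z \<open>z \<ge> 0\<close> by (simp add: l_def)
    have "b * 2^k = real (Suc l)" using ba l by (simp add: field_simps)
    then have "real (Suc l) \<le> 2^k" using b(2) by (metis mult_left_le_one_le mult.commute mult_cancel_right1 mult_le_cancel_right1 mult_right_mono zero_le_numeral zero_le_power mult_1)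
    then have "l < 2^k" by (metis Suc_le_eq of_nat_le_iff of_nat_numeral of_nat_power)
    moreover have "a = real l / 2^k" "b = real (Suc l) / 2^k"
      using l \<open>b * 2^k = real (Suc l)\<close> by (simp_all add: field_simps)
    then have "e' = (dyadic_point k x y l, dyadic_point k x y (Suc l))"
      unfolding xy' a(3) b(3) dyadic_point_def by simp
    ultimately show "e' \<in> (\<lambda>i. (dyadic_point k x y i, dyadic_point k x y (Suc i))) ` {..<2^k}" by blast
  qed
qed

lemma sum_edges_along:
  assumes e: "(x, y) \<in> oedges m"
  shows "(\<Sum>e'\<in>edges_along (m + k) (x, y). F (fst e') (snd e')) = subdiv_sum k F x y"
proof -
  have "x \<noteq> y"
    using e p_eq_iff unfolding oedges_iff by auto
  then have "inj_on (\<lambda>i. (dyadic_point k x y i, dyadic_point k x y (Suc i))) {..<2^k}"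
    by (intro inj_onI) (auto simp: dyadic_point_def)
  then show ?thesis
    unfolding edges_along_eq[OF e] subdiv_sum_eq by (simp add: sum.reindex)
qed

lemma edges_along_telescope:
  fixes f :: "pt \<Rightarrow> real"
  assumes "(x, y) \<in> oedges m" "seg (x, y) \<subseteq> A" "m \<le> n"
    and pot: "\<And>a b. a \<in> A \<Longrightarrow> b \<in> A \<Longrightarrow> \<omega> b a = f b - f a"
  shows "(\<Sum>e'\<in>edges_along n (x, y). \<omega> (snd e') (fst e')) = f y - f x"
proof -
  obtain k where k: "n = m + k" using assms(3) le_Suc_ex by blast
  have "(\<Sum>e'\<in>edges_along n (x, y). \<omega> (snd e') (fst e')) = (\<Sum>e'\<in>edges_along n (x, y). f (snd e') - f (fst e'))"
  proof (rule sum.cong[OF refl])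
    fix e' assume "e' \<in> edges_along n (x, y)"
    then have "seg e' \<subseteq> A" using assms(2) by (auto simp: edges_along_def)
    then have "fst e' \<in> A" "snd e' \<in> A" by (auto simp: seg_def)
    then show "\<omega> (snd e') (fst e') = f (snd e') - f (fst e')" by (rule pot)
  qed
  also have "\<dots> = f y - f x"
    unfolding k sum_edges_along[OF assms(1), where F = "\<lambda>a b. f b - f a"] by (rule subdiv_sum_telescope)
  finally show ?thesis .
qed

section \<open>Edge integrals: convergence and rate\<close>

definition edge_integral :: "form \<Rightarrow> pt \<Rightarrow> pt \<Rightarrow> real" where
  "edge_integral \<omega> x y = path_integral [(x, y)] \<omega>"

text \<open>Levels coarser than the edge do not subdivide it; shifting the sequence by
  \<open>m\<close> discards these terms without affecting the limit.\<close>

lemma edges_along_sum_tendsto_iff: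
  assumes "(x, y) \<in> oedges m"
  shows "(\<lambda>n. \<Sum>e'\<in>edges_along n (x, y). \<omega> (snd e') (fst e')) \<longlonglongrightarrow> L
    \<longleftrightarrow> (\<lambda>k. subdiv_sum k (\<lambda>a b. \<omega> b a) x y) \<longlonglongrightarrow> L"
proof -
  have "(\<lambda>k. \<Sum>e'\<in>edges_along (k + m) (x, y). \<omega> (snd e') (fst e')) = (\<lambda>k. subdiv_sum k (\<lambda>a b. \<omega> b a) x y)"
    using sum_edges_along[OF assms, where F = "\<lambda>a b. \<omega> b a"] by (simp add: add.commute)
  then show ?thesis
    using LIMSEQ_ignore_initial_segment[of "\<lambda>n. \<Sum>e'\<in>edges_along n (x, y). \<omega> (snd e') (fst e')" L m]
      LIMSEQ_offset[of "\<lambda>n. \<Sum>e'\<in>edges_along n (x, y). \<omega> (snd e') (fst e')" m L] by auto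
qed

definition edge_defect :: "(pt \<Rightarrow> pt \<Rightarrow> real) \<Rightarrow> pt \<Rightarrow> pt \<Rightarrow> real" where
  "edge_defect F x y = split_edge F x y - F x y"

text \<open>The errors of one bisection, summed over a whole level, decay at the rate of the
  unnormalized energy. This is summable in the level and stable under addition of forms.\<close>

definition tame :: "(pt \<Rightarrow> pt \<Rightarrow> real) \<Rightarrow> bool" where
  "tame F \<longleftrightarrow> (\<exists>C\<ge>0. \<forall>m. level_sum (\<lambda>x y. \<bar>edge_defect F x y\<bar>) m \<le> C * (3/5)^m)"

lemma subdiv_sum_step: "subdiv_sum (Suc k) F x y - subdiv_sum k F x y = subdiv_sum k (edge_defect F) x y"
  unfolding subdiv_sum_Suc' edge_defect_def subdiv_sum_diff ..

lemma level_sum_mono_vertices: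
  assumes "\<And>\<sigma> i j. \<sigma> \<in> level_words m \<Longrightarrow> i < 3 \<Longrightarrow> j < 3 \<Longrightarrow>
    F (wmap \<sigma> (p i)) (wmap \<sigma> (p j)) \<le> G (wmap \<sigma> (p i)) (wmap \<sigma> (p j))"
  shows "level_sum F m \<le> level_sum G m"
  unfolding level_sum_def by (intro sum_mono cell_sum_mono assms)

lemma vertex_midpoint_in_K:
  assumes "\<sigma> \<in> Words" "i < 3" "j < 3"
  shows "midpoint (wmap \<sigma> (p i)) (wmap \<sigma> (p j)) \<in> K"
  using assms by (simp add: wmap_midpoint[symmetric] w_p_midpoint[symmetric] wmap_K w_K p_in_K)

lemma level_sum_mono_midpoint:
  assumes "\<And>x y. x \<in> K \<Longrightarrow> y \<in> K \<Longrightarrow> midpoint x y \<in> K \<Longrightarrow> F x y \<le> G x y"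
  shows "level_sum F m \<le> level_sum G m"
  by (intro level_sum_mono_vertices assms wmap_p_in_K vertex_midpoint_in_K) (auto simp: level_words_def)

text \<open>Only an inequality: the next level consists of the bisected edges and, in each cell, of
  the three sides of the midpoint triangle.\<close>

lemma level_sum_split_edge:
  assumes "\<And>x y. 0 \<le> F x y"
  shows "level_sum (split_edge F) m \<le> level_sum F (Suc m)"
  unfolding level_sum_def sum_level_words_Suc
proof (rule sum_mono)
  fix \<sigma>
  have "midpoint (p 2) (p 0) = w 0 (p 2)" by (simp add: w_p_midpoint midpoint_sym)
  then have mids: "midpoint (wmap \<sigma> (p 0)) (wmap \<sigma> (p 1)) = wmap \<sigma> (w 0 (p 1))"
    "midpoint (wmap \<sigma> (p 1)) (wmap \<sigma> (p 2)) = wmap \<sigma> (w 1 (p 2))"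
    "midpoint (wmap \<sigma> (p 2)) (wmap \<sigma> (p 0)) = wmap \<sigma> (w 0 (p 2))"
    by (simp_all only: wmap_midpoint[symmetric] w_p_midpoint)
  define a b c where "a = wmap \<sigma> (p 0)" "b = wmap \<sigma> (p 1)" "c = wmap \<sigma> (p 2)"
  define x y z where "x = wmap \<sigma> (w 0 (p 1))" "y = wmap \<sigma> (w 1 (p 2))" "z = wmap \<sigma> (w 0 (p 2))"
  show "cell_sum (split_edge F) \<sigma> \<le> cell_sum F (\<sigma> @ [0]) + cell_sum F (\<sigma> @ [1]) + cell_sum F (\<sigma> @ [2])"
    unfolding cell_sum_children unfolding cell_sum_def split_edge_def mids Let_def
    unfolding a_b_c_def[symmetric] x_y_z_def[symmetric]
    using assms[of x z] assms[of y x] assms[of z y] by linarith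
qed

lemma level_sum_subdiv_sum:
  "(\<And>x y. 0 \<le> F x y) \<Longrightarrow> level_sum (subdiv_sum k F) m \<le> level_sum F (m + k)"
proof (induction k arbitrary: F)
  case 0
  then show ?case by (simp add: subdiv_sum.simps[abs_def])
next
  case (Suc k)
  have "level_sum (subdiv_sum (Suc k) F) m = level_sum (subdiv_sum k (split_edge F)) m"
    by (rule level_sum_cong) (rule subdiv_sum_Suc')
  also have "\<dots> \<le> level_sum (split_edge F) (m + k)"
    by (rule Suc.IH) (simp add: split_edge_def Suc.prems)
  also have "\<dots> \<le> level_sum F (m + Suc k)"
    using level_sum_split_edge[OF Suc.prems] by simp
  finally show ?case .
qed

text \<open>The factor 5/2 is the sum of the geometric series with ratio 3/5; the induction carries
  its partial sums. The bound is uniform in \<open>k\<close> and hence survives the limit that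
  defines edge integrals.\<close>

lemma tame_subdiv_sum_bound:
  assumes "\<And>m. level_sum (\<lambda>x y. \<bar>edge_defect F x y\<bar>) m \<le> C * (3/5)^m" "C \<ge> 0"
  shows "level_sum (\<lambda>x y. \<bar>subdiv_sum k F x y - F x y\<bar>) m \<le> 5/2 * C * (3/5)^m"
proof -
  have "level_sum (\<lambda>x y. \<bar>subdiv_sum k F x y - F x y\<bar>) m \<le> 5/2 * C * (3/5)^m * (1 - (3/5)^k)"
  proof (induction k)
    case 0
    then show ?case by (simp add: level_sum_def cell_sum_def)
  next
    case (Suc k)
    have "\<bar>subdiv_sum (Suc k) F x y - F x y\<bar>
        \<le> \<bar>subdiv_sum k F x y - F x y\<bar> + subdiv_sum k (\<lambda>a b. \<bar>edge_defect F a b\<bar>) x y" for x y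
      using subdiv_sum_step[of k F x y] subdiv_sum_abs[of k "edge_defect F" x y] by linarith
    then have "level_sum (\<lambda>x y. \<bar>subdiv_sum (Suc k) F x y - F x y\<bar>) m
        \<le> level_sum (\<lambda>x y. \<bar>subdiv_sum k F x y - F x y\<bar> + subdiv_sum k (\<lambda>a b. \<bar>edge_defect F a b\<bar>) x y) m"
      by (intro level_sum_mono)
    also have "\<dots> = level_sum (\<lambda>x y. \<bar>subdiv_sum k F x y - F x y\<bar>) m + level_sum (subdiv_sum k (\<lambda>a b. \<bar>edge_defect F a b\<bar>)) m"
      by (rule level_sum_add_fun)
    also have "\<dots> \<le> 5/2 * C * (3/5)^m * (1 - (3/5)^k) + C * (3/5)^(m + k)"
      using Suc.IH level_sum_subdiv_sum[of "\<lambda>a b. \<bar>edge_defect F a b\<bar>" k m] assms(1)[of "m + k"] by simp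
    also have "\<dots> = 5/2 * C * (3/5)^m * (1 - (3/5)^Suc k)"
      by (simp add: power_add field_simps)
    finally show ?case .
  qed
  also have "\<dots> \<le> 5/2 * C * (3/5)^m * 1"
    using assms(2) by (intro mult_left_mono) auto
  finally show ?thesis by simp
qed

lemma le_level_sum:
  assumes "\<And>x y. 0 \<le> F x y" "(x, y) \<in> edges m"
  shows "F x y \<le> level_sum F m"
proof -
  have "F (fst (x, y)) (snd (x, y)) \<le> (\<Sum>e\<in>edges m. F (fst e) (snd e))"
    using assms by (intro member_le_sum) auto
  then show ?thesis by (simp add: sum_edges)
qed

text \<open>The effect of one more bisection on a single edge is dominated by the total defect of
  the whole level, hence by a geometric sequence.\<close>

lemma tame_convergent:
  assumes "tame F" "(x, y) \<in> edges m"
  shows "convergent (\<lambda>k. subdiv_sum k F x y)"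
proof -
  obtain C where C: "C \<ge> 0" "\<And>m. level_sum (\<lambda>x y. \<bar>edge_defect F x y\<bar>) m \<le> C * (3/5)^m"
    using assms(1) unfolding tame_def by blast
  have "summable (\<lambda>k. subdiv_sum (Suc k) F x y - subdiv_sum k F x y)"
  proof (rule summable_comparison_test')
    show "summable (\<lambda>k. C * (3/5)^m * (3/5)^k :: real)"
      by (intro summable_mult summable_geometric) simp
    fix k
    have "\<bar>subdiv_sum (Suc k) F x y - subdiv_sum k F x y\<bar> \<le> subdiv_sum k (\<lambda>a b. \<bar>edge_defect F a b\<bar>) x y"
      unfolding subdiv_sum_step by (rule subdiv_sum_abs)
    also have "\<dots> \<le> level_sum (subdiv_sum k (\<lambda>a b. \<bar>edge_defect F a b\<bar>)) m"
      by (rule le_level_sum[OF _ assms(2)]) (simp add: subdiv_sum_nonneg)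
    also have "\<dots> \<le> level_sum (\<lambda>a b. \<bar>edge_defect F a b\<bar>) (m + k)"
      by (rule level_sum_subdiv_sum) simp
    also have "\<dots> \<le> C * (3/5)^(m + k)" by (rule C)
    finally show "norm (subdiv_sum (Suc k) F x y - subdiv_sum k F x y) \<le> C * (3/5)^m * (3/5)^k"
      by (simp add: power_add mult.assoc)
  qed
  then have "convergent (\<lambda>n. \<Sum>k<n. subdiv_sum (Suc k) F x y - subdiv_sum k F x y)"
    by (simp add: summable_iff_convergent)
  then have "convergent (\<lambda>n. subdiv_sum n F x y - subdiv_sum 0 F x y)"
    using sum_lessThan_telescope[of "\<lambda>n. subdiv_sum n F x y"] by simp
  then show ?thesis by (simp add: convergent_diff_const_right_iff)
qed

text \<open>The error is of second order: an increment of \<open>f\<close> over one half of the edge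
  times an increment of \<open>g\<close> over the other half. Such products are controlled by the
  energies.\<close>

lemma edge_defect_fdg:
  assumes "x \<in> K" "y \<in> K" "midpoint x y \<in> K"
  shows "edge_defect (\<lambda>a b. fdg f g b a) x y = (f (midpoint x y) - f y) * (g (midpoint x y) - g x)"
    and "edge_defect (fdg f g) x y = (f (midpoint x y) - f x) * (g (midpoint x y) - g y)"
  using assms by (simp_all add: edge_defect_def split_edge_def fdg_def algebra_simps)

lemma abs_mult_le_squares: "\<bar>a * b\<bar> \<le> a\<^sup>2 + b\<^sup>2" for a b :: real
proof -
  have "0 \<le> (\<bar>a\<bar> - \<bar>b\<bar>)\<^sup>2" by simp
  then have "2 * \<bar>a * b\<bar> \<le> a\<^sup>2 + b\<^sup>2" by (simp add: power2_eq_square algebra_simps abs_mult)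
  then show ?thesis by simp
qed

lemma FF2_level_bound:
  assumes "f \<in> FF" "g \<in> FF"
  obtains C where "C \<ge> 0" "\<And>m. level_sum (\<lambda>x y. (f y - f x)\<^sup>2 + (g y - g x)\<^sup>2) m \<le> C * (3/5)^m"
proof -
  obtain C where C: "C \<ge> 0" "\<And>m. level_sum (\<lambda>x y. (f y - f x)\<^sup>2) m \<le> C * (3/5)^m"
    using FF_level_bound[OF assms(1)] by blast
  obtain D where D: "D \<ge> 0" "\<And>m. level_sum (\<lambda>x y. (g y - g x)\<^sup>2) m \<le> D * (3/5)^m"
    using FF_level_bound[OF assms(2)] by blast
  show ?thesis
  proof (rule that)
    show "0 \<le> C + D" using C D by simp
    show "level_sum (\<lambda>x y. (f y - f x)\<^sup>2 + (g y - g x)\<^sup>2) m \<le> (C + D) * (3/5)^m" for m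
      using C(2)[of m] D(2)[of m] by (simp add: level_sum_add_fun distrib_right)
  qed
qed

lemma tame_fdg:
  assumes "f \<in> FF" "g \<in> FF"
  shows "tame (\<lambda>a b. fdg f g b a)" "tame (fdg f g)"
proof -
  obtain C where C: "C \<ge> 0" "\<And>m. level_sum (\<lambda>x y. (f y - f x)\<^sup>2 + (g y - g x)\<^sup>2) m \<le> C * (3/5)^m"
    using FF2_level_bound[OF assms] by blast
  define H where "H = (\<lambda>x y. (f y - f x)\<^sup>2 + (g y - g x)\<^sup>2)"
  have main: "tame F"
    if "\<And>x y. x \<in> K \<Longrightarrow> y \<in> K \<Longrightarrow> midpoint x y \<in> K \<Longrightarrow> \<bar>edge_defect F x y\<bar> \<le> split_edge H x y" for F
    unfolding tame_def
  proof (intro exI[of _ "C * (3/5)"] conjI allI)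
    fix m
    have "level_sum (\<lambda>x y. \<bar>edge_defect F x y\<bar>) m \<le> level_sum (split_edge H) m"
      by (rule level_sum_mono_midpoint) (rule that)
    also have "\<dots> \<le> level_sum H (Suc m)" by (rule level_sum_split_edge) (simp add: H_def)
    also have "\<dots> \<le> C * (3/5)^Suc m" unfolding H_def by (rule C)
    finally show "level_sum (\<lambda>x y. \<bar>edge_defect F x y\<bar>) m \<le> C * (3/5) * (3/5)^m" by simp
  qed (use C in simp)
  show "tame (\<lambda>a b. fdg f g b a)"
  proof (rule main)
    fix x y assume K: "x \<in> K" "y \<in> K" "midpoint x y \<in> K"
    have "(f (midpoint x y) - f y)\<^sup>2 + (g (midpoint x y) - g x)\<^sup>2 \<le> split_edge H x y"
      by (simp add: split_edge_def H_def power2_commute)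
    then show "\<bar>edge_defect (\<lambda>a b. fdg f g b a) x y\<bar> \<le> split_edge H x y"
      unfolding edge_defect_fdg[OF K] using abs_mult_le_squares order_trans by blast
  qed
  show "tame (fdg f g)"
  proof (rule main)
    fix x y assume K: "x \<in> K" "y \<in> K" "midpoint x y \<in> K"
    have "(f (midpoint x y) - f x)\<^sup>2 + (g (midpoint x y) - g y)\<^sup>2 \<le> split_edge H x y"
      by (simp add: split_edge_def H_def power2_commute)
    then show "\<bar>edge_defect (fdg f g) x y\<bar> \<le> split_edge H x y"
      unfolding edge_defect_fdg[OF K] using abs_mult_le_squares order_trans by blast
  qed
qed

lemma tame_add:
  assumes "tame F" "tame G"
  shows "tame (\<lambda>a b. F a b + G a b)"
proof -
  obtain C where C: "C \<ge> 0" "\<And>m. level_sum (\<lambda>x y. \<bar>edge_defect F x y\<bar>) m \<le> C * (3/5)^m"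
    using assms(1) unfolding tame_def by blast
  obtain D where D: "D \<ge> 0" "\<And>m. level_sum (\<lambda>x y. \<bar>edge_defect G x y\<bar>) m \<le> D * (3/5)^m"
    using assms(2) unfolding tame_def by blast
  have "level_sum (\<lambda>x y. \<bar>edge_defect (\<lambda>a b. F a b + G a b) x y\<bar>) m \<le> (C + D) * (3/5)^m" for m
  proof -
    have "\<bar>edge_defect (\<lambda>a b. F a b + G a b) x y\<bar> \<le> \<bar>edge_defect F x y\<bar> + \<bar>edge_defect G x y\<bar>" for x y
      by (simp add: edge_defect_def split_edge_def)
    then have "level_sum (\<lambda>x y. \<bar>edge_defect (\<lambda>a b. F a b + G a b) x y\<bar>) m
      \<le> level_sum (\<lambda>x y. \<bar>edge_defect F x y\<bar> + \<bar>edge_defect G x y\<bar>) m" by (intro level_sum_mono)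
    then show ?thesis using C(2)[of m] D(2)[of m] by (simp add: level_sum_add_fun distrib_right)
  qed
  then show ?thesis unfolding tame_def using C(1) D(1) by (intro exI[of _ "C + D"]) simp
qed

lemma tame_zero: "tame (\<lambda>a b. 0)"
  unfolding tame_def by (intro exI[of _ 0]) (simp add: edge_defect_def split_edge_def level_sum_def cell_sum_def)

text \<open>Level sums run over clockwise edges only. An edge traversed the other way is treated
  through the form with exchanged arguments, so both versions are needed.\<close>

lemma Omega1_tame:
  assumes "\<omega> \<in> Omega1"
  shows "tame (\<lambda>a b. \<omega> b a)" "tame \<omega>"
proof -
  obtain ps where ps: "set ps \<subseteq> FF \<times> FF" "form_of ps = \<omega>"
    using assms unfolding Omega1_def by blast
  have "tame (\<lambda>a b. form_of ps b a) \<and> tame (form_of ps)"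
    using ps(1)
  proof (induction ps)
    case Nil
    then show ?case by (simp add: form_of_Nil tame_zero)
  next
    case (Cons a ps)
    then show ?case by (cases a) (auto simp: form_of_Cons intro!: tame_add tame_fdg)
  qed
  then show "tame (\<lambda>a b. \<omega> b a)" "tame \<omega>" using ps(2) by auto
qed

lemma edge_integral_tendsto:
  assumes "\<omega> \<in> Omega1" "(x, y) \<in> oedges m"
  shows "(\<lambda>n. \<Sum>e'\<in>edges_along n (x, y). \<omega> (snd e') (fst e')) \<longlonglongrightarrow> edge_integral \<omega> x y"
    and "(\<lambda>k. subdiv_sum k (\<lambda>a b. \<omega> b a) x y) \<longlonglongrightarrow> edge_integral \<omega> x y"
proof -
  have "convergent (\<lambda>k. subdiv_sum k (\<lambda>a b. \<omega> b a) x y)"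
  proof (cases "(x, y) \<in> edges m")
    case True
    then show ?thesis using tame_convergent Omega1_tame(1)[OF assms(1)] by blast
  next
    case False
    then have "(y, x) \<in> edges m" using assms(2) by (auto simp: oedges_def)
    then have "convergent (\<lambda>k. subdiv_sum k \<omega> y x)"
      using tame_convergent Omega1_tame(2)[OF assms(1)] by blast
    then show ?thesis by (subst subdiv_sum_swap) simp
  qed
  then obtain L where L: "(\<lambda>k. subdiv_sum k (\<lambda>a b. \<omega> b a) x y) \<longlonglongrightarrow> L"
    by (auto simp: convergent_def)
  then have L': "(\<lambda>n. \<Sum>e'\<in>edges_along n (x, y). \<omega> (snd e') (fst e')) \<longlonglongrightarrow> L"
    using edges_along_sum_tendsto_iff[OF assms(2)] by blast
  then have "edge_integral \<omega> x y = L"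
    by (simp add: edge_integral_def path_integral_def limI)
  then show "(\<lambda>n. \<Sum>e'\<in>edges_along n (x, y). \<omega> (snd e') (fst e')) \<longlonglongrightarrow> edge_integral \<omega> x y"
    "(\<lambda>k. subdiv_sum k (\<lambda>a b. \<omega> b a) x y) \<longlonglongrightarrow> edge_integral \<omega> x y"
    using L L' by simp_all
qed

lemma level_sum_tendsto:
  assumes "\<And>x y. (x, y) \<in> edges m \<Longrightarrow> (\<lambda>k. F k x y) \<longlonglongrightarrow> G x y"
  shows "(\<lambda>k. level_sum (F k) m) \<longlonglongrightarrow> level_sum G m"
  unfolding sum_edges[symmetric] by (intro tendsto_sum) (simp add: assms)

text \<open>The passage to the limit in \<open>tame_subdiv_sum_bound\<close>. It permits replacing
  the edge values of a form by its edge integrals.\<close>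

lemma edge_integral_bound:
  assumes "\<omega> \<in> Omega1"
  obtains C where "C \<ge> 0" "\<And>m. level_sum (\<lambda>x y. \<bar>edge_integral \<omega> x y - \<omega> y x\<bar>) m \<le> C * (3/5)^m"
proof -
  obtain C where C: "C \<ge> 0" "\<And>m. level_sum (\<lambda>x y. \<bar>edge_defect (\<lambda>a b. \<omega> b a) x y\<bar>) m \<le> C * (3/5)^m"
    using Omega1_tame(1)[OF assms] unfolding tame_def by blast
  have "level_sum (\<lambda>x y. \<bar>edge_integral \<omega> x y - \<omega> y x\<bar>) m \<le> 5/2 * C * (3/5)^m" for m
  proof (rule LIMSEQ_le_const2)
    show "(\<lambda>k. level_sum (\<lambda>x y. \<bar>subdiv_sum k (\<lambda>a b. \<omega> b a) x y - \<omega> y x\<bar>) m)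
        \<longlonglongrightarrow> level_sum (\<lambda>x y. \<bar>edge_integral \<omega> x y - \<omega> y x\<bar>) m"
      using edge_integral_tendsto(2)[OF assms, of _ _ m]
      by (intro level_sum_tendsto tendsto_intros) (auto simp: oedges_def)
    show "\<exists>N. \<forall>k\<ge>N. level_sum (\<lambda>x y. \<bar>subdiv_sum k (\<lambda>a b. \<omega> b a) x y - \<omega> y x\<bar>) m \<le> 5/2 * C * (3/5)^m"
      using tame_subdiv_sum_bound[OF C(2,1)] by blast
  qed
  then show ?thesis using that[of "5/2 * C"] C(1) by simp
qed

text \<open>For \<open>f dg\<close> the symmetric part is \<Delta>f \<Delta>g, again of second
  order. Up to this error a smooth form is an antisymmetric function of oriented edges.\<close>

lemma symmetric_part_bound:
  assumes "\<omega> \<in> Omega1"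
  obtains C where "C \<ge> 0" "\<And>m. level_sum (\<lambda>x y. \<bar>\<omega> y x + \<omega> x y\<bar>) m \<le> C * (3/5)^m"
proof -
  obtain ps where ps: "set ps \<subseteq> FF \<times> FF" "form_of ps = \<omega>"
    using assms unfolding Omega1_def by blast
  have "\<exists>C\<ge>0. \<forall>m. level_sum (\<lambda>x y. \<bar>form_of ps y x + form_of ps x y\<bar>) m \<le> C * (3/5)^m"
    using ps(1)
  proof (induction ps)
    case Nil
    then show ?case by (intro exI[of _ 0]) (simp add: form_of_Nil level_sum_def cell_sum_def)
  next
    case (Cons a ps)
    obtain f g where a: "a = (f, g)" "f \<in> FF" "g \<in> FF" using Cons.prems by (cases a) auto
    obtain C where C: "C \<ge> 0" "\<And>m. level_sum (\<lambda>x y. (f y - f x)\<^sup>2 + (g y - g x)\<^sup>2) m \<le> C * (3/5)^m"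
      using FF2_level_bound[OF a(2,3)] by blast
    obtain D where D: "D \<ge> 0" "\<And>m. level_sum (\<lambda>x y. \<bar>form_of ps y x + form_of ps x y\<bar>) m \<le> D * (3/5)^m"
      using Cons by auto
    have "level_sum (\<lambda>x y. \<bar>form_of (a # ps) y x + form_of (a # ps) x y\<bar>) m \<le> (C + D) * (3/5)^m" for m
    proof -
      have "level_sum (\<lambda>x y. \<bar>form_of (a # ps) y x + form_of (a # ps) x y\<bar>) m
        \<le> level_sum (\<lambda>x y. ((f y - f x)\<^sup>2 + (g y - g x)\<^sup>2) + \<bar>form_of ps y x + form_of ps x y\<bar>) m"
      proof (rule level_sum_mono)
        fix x y assume K: "x \<in> K" "y \<in> K"
        have "fdg f g y x + fdg f g x y = (f y - f x) * (g y - g x)"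
          using K by (simp add: fdg_def algebra_simps)
        then show "\<bar>form_of (a # ps) y x + form_of (a # ps) x y\<bar>
          \<le> ((f y - f x)\<^sup>2 + (g y - g x)\<^sup>2) + \<bar>form_of ps y x + form_of ps x y\<bar>"
          using abs_mult_le_squares[of "f y - f x" "g y - g x"] unfolding a(1) form_of_Cons by linarith
      qed
      then show ?thesis using C(2)[of m] D(2)[of m] by (simp add: level_sum_add_fun distrib_right)
    qed
    then show ?case using C(1) D(1) by (intro exI[of _ "C + D"]) simp
  qed
  then show ?thesis using that ps(2) by auto
qed

section \<open>The forms dz and the Hodge coefficients\<close>

text \<open>Corner values of the local potential of \<open>dz \<sigma>\<close> on the cell of \<open>\<sigma> @ [i]\<close>; the side of the lacuna
  in this cell runs from corner \<open>(i + 2) mod 3\<close> to corner \<open>(i + 1) mod 3\<close>.\<close>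

definition lacuna_value :: "nat \<Rightarrow> nat \<Rightarrow> real" where
  "lacuna_value i j = (if j = (i + 1) mod 3 then 1/6 else if j = (i + 2) mod 3 then - 1/6 else 0)"

lemma lacuna_value_simps [simp]:
  "lacuna_value 0 0 = 0" "lacuna_value 0 (Suc 0) = 1/6" "lacuna_value 0 2 = - 1/6"
  "lacuna_value (Suc 0) 0 = - 1/6" "lacuna_value (Suc 0) (Suc 0) = 0" "lacuna_value (Suc 0) 2 = 1/6"
  "lacuna_value 2 0 = 1/6" "lacuna_value 2 (Suc 0) = - 1/6" "lacuna_value 2 2 = 0"
  by (simp_all add: lacuna_value_def)

section \<open>The explicit forms \<open>dz_form\<close>\<close>

definition lacuna_source :: "nat list \<Rightarrow> nat \<Rightarrow> pt" where
  "lacuna_source \<sigma> i = wmap (\<sigma> @ [i]) (p ((i + 2) mod 3))"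

definition lacuna_target :: "nat list \<Rightarrow> nat \<Rightarrow> pt" where
  "lacuna_target \<sigma> i = wmap (\<sigma> @ [i]) (p ((i + 1) mod 3))"

definition dz_form :: "nat list \<Rightarrow> form" where
  "dz_form \<sigma> = (\<lambda>x y. \<Sum>i<3. cell_form (\<sigma> @ [i]) (lacuna_value i) x y)"

text \<open>Comparing \<open>butlast \<tau>\<close> with \<sigma> tests whether \<tau> is a child of
  \<sigma>. With zero values for the other cells, all cells of the level below \<sigma> can be
  treated alike.\<close>

definition dz_values :: "nat list \<Rightarrow> nat list \<Rightarrow> nat \<Rightarrow> real" where
  "dz_values \<sigma> \<tau> = (if butlast \<tau> = \<sigma> then lacuna_value (last \<tau>) else (\<lambda>_. 0))"

lemma sum_lessThan_3: "(\<Sum>i<3. F i) = F 0 + F 1 + F 2" for F :: "nat \<Rightarrow> real"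
  by (simp add: eval_nat_numeral)

lemma lacuna_eq:
  "lacuna \<sigma> = [(lacuna_source \<sigma> 1, lacuna_target \<sigma> 1), (lacuna_source \<sigma> 2, lacuna_target \<sigma> 2),
     (lacuna_source \<sigma> 0, lacuna_target \<sigma> 0)]"
  by (simp add: lacuna_def lacuna_source_def lacuna_target_def wmap_append, simp add: numeral_2_eq_2)

lemma lacuna_closed:
  "lacuna_target \<sigma> 0 = lacuna_source \<sigma> 1" "lacuna_target \<sigma> 1 = lacuna_source \<sigma> 2"
  "lacuna_target \<sigma> 2 = lacuna_source \<sigma> 0"
  by (simp_all add: lacuna_source_def lacuna_target_def wmap_append, simp_all add: numeral_2_eq_2)

lemma dz_form_in_Omega1: "dz_form \<sigma> \<in> Omega1"
  unfolding dz_form_def by (intro Omega1_sum cell_form_in_Omega1) simp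

lemma dz_form_cell:
  assumes "\<sigma> \<in> Words" "\<tau> \<in> level_words (Suc (length \<sigma>))" "x \<in> K" "y \<in> K"
  shows "dz_form \<sigma> (wmap \<tau> x) (wmap \<tau> y) = hext (dz_values \<sigma> \<tau>) x - hext (dz_values \<sigma> \<tau>) y"
proof -
  have summand: "cell_form (\<sigma> @ [i]) (lacuna_value i) (wmap \<tau> x) (wmap \<tau> y)
      = (if \<tau> = \<sigma> @ [i] then hext (dz_values \<sigma> \<tau>) x - hext (dz_values \<sigma> \<tau>) y else 0)" if "i < 3" for i
  proof (cases "\<tau> = \<sigma> @ [i]")
    case True
    then show ?thesis using cell_form_on_cell[of "\<sigma> @ [i]" x y] assms that by (simp add: dz_values_def)
  next
    case False
    then show ?thesis using cell_form_off_cell[of "\<sigma> @ [i]" \<tau> x y] assms that by simp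
  qed
  have "dz_form \<sigma> (wmap \<tau> x) (wmap \<tau> y)
      = (\<Sum>i<3. if \<tau> = \<sigma> @ [i] then hext (dz_values \<sigma> \<tau>) x - hext (dz_values \<sigma> \<tau>) y else 0)"
    unfolding dz_form_def by (intro sum.cong refl summand) simp
  also have "\<dots> = hext (dz_values \<sigma> \<tau>) x - hext (dz_values \<sigma> \<tau>) y"
  proof (cases "butlast \<tau> = \<sigma>")
    case True
    have "\<tau> \<noteq> []" "set \<tau> \<subseteq> {0,1,2}" using assms(2) by (auto simp: level_words_def Words_def)
    then have "last \<tau> < 3" using last_in_set[of \<tau>] by fastforce
    moreover have "\<tau> = \<sigma> @ [i] \<longleftrightarrow> i = last \<tau>" for i
      using True \<open>\<tau> \<noteq> []\<close> by (metis append_butlast_last_id last_snoc)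
    ultimately show ?thesis by simp
  next
    case False
    then have "\<tau> \<noteq> \<sigma> @ [i]" for i by auto
    then show ?thesis using False by (simp add: dz_values_def)
  qed
  finally show ?thesis .
qed

text \<open>Inside a cell of the level below \<sigma> the form is the increment of a harmonic
  function. This gives antisymmetry, and the oscillation shrinks by 3/5 with each further
  level.\<close>

lemma dz_form_antisym_bound:
  assumes "\<sigma> \<in> Words" "\<upsilon> \<in> level_words (Suc (length \<sigma>) + k)" "i < 3" "j < 3"
  shows "dz_form \<sigma> (wmap \<upsilon> (p i)) (wmap \<upsilon> (p j)) = - dz_form \<sigma> (wmap \<upsilon> (p j)) (wmap \<upsilon> (p i))"
    and "\<bar>dz_form \<sigma> (wmap \<upsilon> (p i)) (wmap \<upsilon> (p j))\<bar> \<le> (3/5)^k"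
proof -
  define \<tau> \<rho> where "\<tau> = take (Suc (length \<sigma>)) \<upsilon>" and "\<rho> = drop (Suc (length \<sigma>)) \<upsilon>"
  have tr: "\<upsilon> = \<tau> @ \<rho>" "\<tau> \<in> level_words (Suc (length \<sigma>))" "\<rho> \<in> level_words k"
    using assms(2) by (auto simp: \<tau>_def \<rho>_def level_words_def Words_def dest: in_set_takeD in_set_dropD)
  have rW: "\<rho> \<in> Words" using tr(3) by (rule level_wordsD)
  define h where "h = hext (dz_values \<sigma> \<tau>)"
  have eq: "dz_form \<sigma> (wmap \<upsilon> (p a)) (wmap \<upsilon> (p b)) = h (wmap \<rho> (p a)) - h (wmap \<rho> (p b))" if "a < 3" "b < 3" for a b
    unfolding tr(1) wmap_append h_def by (intro dz_form_cell assms(1) tr(2) wmap_K rW p_in_K that)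
  show "dz_form \<sigma> (wmap \<upsilon> (p i)) (wmap \<upsilon> (p j)) = - dz_form \<sigma> (wmap \<upsilon> (p j)) (wmap \<upsilon> (p i))"
    using eq assms by simp
  have "\<bar>h (wmap \<rho> (p i)) - h (wmap \<rho> (p j))\<bar> \<le> cell_sum (\<lambda>x y. \<bar>h y - h x\<bar>) \<rho>"
  proof -
    have "i \<in> {0,1,2}" "j \<in> {0,1,2}" using assms by auto
    then show ?thesis by (auto simp: cell_sum_def)
  qed
  also have "\<dots> \<le> (3/5) ^ k * cell_sum (\<lambda>x y. \<bar>h y - h x\<bar>) []"
    using harmonic_osc[of h "[]" \<rho>] harmonic_in_hext[of "dz_values \<sigma> \<tau>"] rW level_wordsD(2)[OF tr(3)]
    by (simp add: h_def)
  \<comment> \<open>On a child of \<sigma> the absolute increments are 1/6, 1/6 and 1/3, with sum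
    2/3; on the other cells they are zero.\<close>
  also have "cell_sum (\<lambda>x y. \<bar>h y - h x\<bar>) [] \<le> 1"
  proof -
    have "cell_sum (\<lambda>x y. \<bar>h y - h x\<bar>) [] = osc (dz_values \<sigma> \<tau>)"
      by (simp add: cell_sum_def h_def hext_p osc_def)
    also have "\<dots> \<le> 1"
    proof (cases "butlast \<tau> = \<sigma>")
      case True
      have "\<tau> \<noteq> []" "set \<tau> \<subseteq> {0,1,2}" using tr(2) by (auto simp: level_words_def Words_def)
      then have "last \<tau> \<in> {0,1,2}" using last_in_set[of \<tau>] by blast
      then show ?thesis using True by (auto simp: dz_values_def osc_def)
    qed (simp add: dz_values_def osc_def)
    finally show ?thesis .
  qed
  finally show "\<bar>dz_form \<sigma> (wmap \<upsilon> (p i)) (wmap \<upsilon> (p j))\<bar> \<le> (3/5)^k"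
    using eq assms by simp
qed

section \<open>Pairing smooth forms with \<open>dz_form\<close>\<close>

lemma level_sum_cong_vertices:
  assumes "\<And>\<sigma> i j. \<sigma> \<in> level_words m \<Longrightarrow> i < 3 \<Longrightarrow> j < 3 \<Longrightarrow>
    F (wmap \<sigma> (p i)) (wmap \<sigma> (p j)) = G (wmap \<sigma> (p i)) (wmap \<sigma> (p j))"
  shows "level_sum F m = level_sum G m"
  by (intro antisym level_sum_mono_vertices) (simp_all add: assms)

lemma level_sum_dz_form:
  assumes s: "\<sigma> \<in> Words"
  defines "h \<equiv> \<lambda>i. cell_harmonic (\<sigma> @ [i]) (lacuna_value i)"
  shows "level_sum (\<lambda>x y. G x y * dz_form \<sigma> y x) (Suc (length \<sigma>) + k)
    = (\<Sum>i<3. \<Sum>\<rho>\<in>level_words k. cell_sum (\<lambda>x y. G x y * (h i y - h i x)) ((\<sigma> @ [i]) @ \<rho>))"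
proof -
  define S where "S = (\<lambda>\<tau>. \<Sum>\<rho>\<in>level_words k. cell_sum (\<lambda>x y. G x y * dz_form \<sigma> y x) (\<tau> @ \<rho>))"
  have eq: "dz_form \<sigma> (wmap (\<tau> @ \<rho>) (p b)) (wmap (\<tau> @ \<rho>) (p a))
      = hext (dz_values \<sigma> \<tau>) (wmap \<rho> (p b)) - hext (dz_values \<sigma> \<tau>) (wmap \<rho> (p a))"
    if "\<tau> \<in> level_words (Suc (length \<sigma>))" "\<rho> \<in> level_words k" "a < 3" "b < 3" for \<tau> \<rho> a b
    unfolding wmap_append using that by (intro dz_form_cell s wmap_K p_in_K level_wordsD(1)) auto
  have "level_sum (\<lambda>x y. G x y * dz_form \<sigma> y x) (Suc (length \<sigma>) + k) = (\<Sum>\<tau>\<in>level_words (Suc (length \<sigma>)). S \<tau>)"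
    unfolding level_sum_add S_def ..
  also have "\<dots> = (\<Sum>\<tau>\<in>(\<lambda>i. \<sigma> @ [i]) ` {..<3}. S \<tau>)"
  proof (rule sum.mono_neutral_right)
    show "(\<lambda>i. \<sigma> @ [i]) ` {..<3} \<subseteq> level_words (Suc (length \<sigma>))"
      using s by (auto simp: level_words_def)
    show "\<forall>\<tau>\<in>level_words (Suc (length \<sigma>)) - (\<lambda>i. \<sigma> @ [i]) ` {..<3}. S \<tau> = 0"
    proof
      fix \<tau> assume t: "\<tau> \<in> level_words (Suc (length \<sigma>)) - (\<lambda>i. \<sigma> @ [i]) ` {..<3}"
      have "butlast \<tau> \<noteq> \<sigma>"
      proof
        assume b: "butlast \<tau> = \<sigma>"
        have "\<tau> \<noteq> []" "set \<tau> \<subseteq> {0,1,2}" using t by (auto simp: level_words_def Words_def)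
        then have "last \<tau> < 3" "\<tau> = \<sigma> @ [last \<tau>]"
          using last_in_set[of \<tau>] b append_butlast_last_id[of \<tau>] by fastforce+
        then show False using t by blast
      qed
      then have "cell_sum (\<lambda>x y. G x y * dz_form \<sigma> y x) (\<tau> @ \<rho>) = cell_sum (\<lambda>x y. 0) (\<tau> @ \<rho>)"
        if "\<rho> \<in> level_words k" for \<rho>
        using t by (intro cell_sum_cong) (simp add: eq that dz_values_def)
      then show "S \<tau> = 0" unfolding S_def by (intro sum.neutral) (simp add: cell_sum_def)
    qed
  qed simp
  also have "\<dots> = (\<Sum>i<3. S (\<sigma> @ [i]))"
    by (simp add: sum.reindex inj_on_def)
  also have "\<dots> = (\<Sum>i<3. \<Sum>\<rho>\<in>level_words k. cell_sum (\<lambda>x y. G x y * (h i y - h i x)) ((\<sigma> @ [i]) @ \<rho>))"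
    unfolding S_def
  proof (intro sum.cong refl cell_sum_cong)
    fix i \<rho> a b assume i: "i \<in> {..<3::nat}" and r: "\<rho> \<in> level_words k" and ab: "a < (3::nat)" "b < (3::nat)"
    have "\<sigma> @ [i] \<in> level_words (Suc (length \<sigma>))" using s i by (auto simp: level_words_def)
    note eq[OF this r ab]
    moreover have "h i (wmap ((\<sigma> @ [i]) @ \<rho>) (p c)) = hext (lacuna_value i) (wmap \<rho> (p c))" for c
      unfolding h_def wmap_append[of "\<sigma> @ [i]"] cell_harmonic_wmap ..
    ultimately show "G (wmap ((\<sigma> @ [i]) @ \<rho>) (p a)) (wmap ((\<sigma> @ [i]) @ \<rho>) (p b))
        * dz_form \<sigma> (wmap ((\<sigma> @ [i]) @ \<rho>) (p b)) (wmap ((\<sigma> @ [i]) @ \<rho>) (p a))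
      = G (wmap ((\<sigma> @ [i]) @ \<rho>) (p a)) (wmap ((\<sigma> @ [i]) @ \<rho>) (p b))
        * (h i (wmap ((\<sigma> @ [i]) @ \<rho>) (p b)) - h i (wmap ((\<sigma> @ [i]) @ \<rho>) (p a)))"
      by (simp add: dz_values_def)
  qed
  finally show ?thesis .
qed

text \<open>The symmetrized edge values of \<open>\<omega>\<close> in \<open>Q_at\<close> may be
  replaced by its edge integrals. The level sum of the differences is O((3/5)^m), which cancels the
  factor (5/3)^m, and the edgewise bound (3/5)^k on \<open>dz_form \<sigma>\<close> then forces the
  error to zero.\<close>

lemma Q_dz_form_tendsto:
  assumes w: "\<omega> \<in> Omega1" and s: "\<sigma> \<in> Words"
  shows "(\<lambda>m. (5/3)^m * level_sum (\<lambda>x y. edge_integral \<omega> x y * dz_form \<sigma> y x) m) \<longlonglongrightarrow> Q \<omega> (dz_form \<sigma>)"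
proof -
  let ?n = "Suc (length \<sigma>)"
  let ?I = "\<lambda>m. (5/3)^m * level_sum (\<lambda>x y. edge_integral \<omega> x y * dz_form \<sigma> y x) m"
  obtain C where C: "C \<ge> 0" "\<And>m. level_sum (\<lambda>x y. \<bar>edge_integral \<omega> x y - \<omega> y x\<bar>) m \<le> C * (3/5)^m"
    using edge_integral_bound[OF w] by blast
  obtain D where D: "D \<ge> 0" "\<And>m. level_sum (\<lambda>x y. \<bar>\<omega> y x + \<omega> x y\<bar>) m \<le> D * (3/5)^m"
    using symmetric_part_bound[OF w] by blast
  have bound: "\<bar>?I (k + ?n) - Q_at (k + ?n) \<omega> (dz_form \<sigma>)\<bar> \<le> (C + D) * (3/5)^k" for k
  proof -
    define m where "m = ?n + k"
    have "\<bar>level_sum (\<lambda>x y. edge_integral \<omega> x y * dz_form \<sigma> y x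
          - 1/2 * (\<omega> y x * dz_form \<sigma> y x + \<omega> x y * dz_form \<sigma> x y)) m\<bar>
      \<le> level_sum (\<lambda>x y. \<bar>edge_integral \<omega> x y * dz_form \<sigma> y x
          - 1/2 * (\<omega> y x * dz_form \<sigma> y x + \<omega> x y * dz_form \<sigma> x y)\<bar>) m"
      by (rule level_sum_abs)
    also have "\<dots> \<le> level_sum (\<lambda>x y. (3/5)^k * (\<bar>edge_integral \<omega> x y - \<omega> y x\<bar> + \<bar>\<omega> y x + \<omega> x y\<bar>)) m"
    proof (rule level_sum_mono_vertices)
      fix \<upsilon> i j assume u: "\<upsilon> \<in> level_words m" and ij: "i < (3::nat)" "j < (3::nat)"
      define x y where "x = wmap \<upsilon> (p i)" and "y = wmap \<upsilon> (p j)"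
      have half: "\<bar>u + 1/2 * v\<bar> \<le> \<bar>u\<bar> + \<bar>v\<bar>" for u v :: real
        using abs_triangle_ineq[of u "1/2 * v"] by simp
      have anti: "dz_form \<sigma> x y = - dz_form \<sigma> y x" and le: "\<bar>dz_form \<sigma> y x\<bar> \<le> (3/5)^k"
        unfolding x_def y_def using dz_form_antisym_bound[OF s u[unfolded m_def]] ij by blast+
      \<comment> \<open>Antisymmetry of \<open>dz_form \<sigma>\<close> pulls out a common factor;
        what remains is the deviation from the edge integral plus half the symmetric part, the two
        quantities bounded by \<open>C\<close> and \<open>D\<close>.\<close>
      have "\<bar>edge_integral \<omega> x y * dz_form \<sigma> y x - 1/2 * (\<omega> y x * dz_form \<sigma> y x + \<omega> x y * dz_form \<sigma> x y)\<bar>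
        = \<bar>dz_form \<sigma> y x\<bar> * \<bar>(edge_integral \<omega> x y - \<omega> y x) + 1/2 * (\<omega> y x + \<omega> x y)\<bar>"
        unfolding anti abs_mult[symmetric] by (simp add: algebra_simps)
      also have "\<dots> \<le> (3/5)^k * (\<bar>edge_integral \<omega> x y - \<omega> y x\<bar> + \<bar>\<omega> y x + \<omega> x y\<bar>)"
      proof (rule mult_mono[OF le])
        show "\<bar>(edge_integral \<omega> x y - \<omega> y x) + 1/2 * (\<omega> y x + \<omega> x y)\<bar>
          \<le> \<bar>edge_integral \<omega> x y - \<omega> y x\<bar> + \<bar>\<omega> y x + \<omega> x y\<bar>"
          by (rule half)
      qed auto
      finally show "\<bar>edge_integral \<omega> x y * dz_form \<sigma> y x - 1/2 * (\<omega> y x * dz_form \<sigma> y x + \<omega> x y * dz_form \<sigma> x y)\<bar>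
        \<le> (3/5)^k * (\<bar>edge_integral \<omega> x y - \<omega> y x\<bar> + \<bar>\<omega> y x + \<omega> x y\<bar>)" .
    qed
    also have "\<dots> = (3/5)^k * (level_sum (\<lambda>x y. \<bar>edge_integral \<omega> x y - \<omega> y x\<bar>) m + level_sum (\<lambda>x y. \<bar>\<omega> y x + \<omega> x y\<bar>) m)"
      by (simp only: level_sum_scale level_sum_add_fun)
    also have "\<dots> \<le> (3/5)^k * (C * (3/5)^m + D * (3/5)^m)"
      by (intro mult_left_mono add_mono C D) simp
    finally have "(5/3)^m * \<bar>level_sum (\<lambda>x y. edge_integral \<omega> x y * dz_form \<sigma> y x
          - 1/2 * (\<omega> y x * dz_form \<sigma> y x + \<omega> x y * dz_form \<sigma> x y)) m\<bar>
      \<le> (5/3)^m * ((3/5)^k * (C * (3/5)^m + D * (3/5)^m))"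
      by (intro mult_left_mono) auto
    also have "\<dots> = ((5/3)^m * (3/5)^m) * ((C + D) * (3/5)^k)" by (simp add: algebra_simps)
    also have "(5/3)^m * (3/5)^m = (1::real)" by (simp add: power_mult_distrib[symmetric])
    finally have "\<bar>?I m - Q_at m \<omega> (dz_form \<sigma>)\<bar> \<le> (C + D) * (3/5)^k"
      unfolding Q_at_def right_diff_distrib[symmetric] level_sum_diff_fun[symmetric] abs_mult by simp
    then show ?thesis by (simp add: m_def add.commute)
  qed
  have "(\<lambda>k. ?I (k + ?n) - Q_at (k + ?n) \<omega> (dz_form \<sigma>)) \<longlonglongrightarrow> 0"
  proof (rule Lim_null_comparison[OF always_eventually])
    show "\<forall>k. norm (?I (k + ?n) - Q_at (k + ?n) \<omega> (dz_form \<sigma>)) \<le> (C + D) * (3/5)^k"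
      using bound by simp
    have "(\<lambda>k. (C + D) * (3/5)^k) \<longlonglongrightarrow> (C + D) * 0"
      by (intro tendsto_intros) simp
    then show "(\<lambda>k. (C + D) * (3/5)^k) \<longlonglongrightarrow> 0" by simp
  qed
  then have "(\<lambda>m. ?I m - Q_at m \<omega> (dz_form \<sigma>)) \<longlonglongrightarrow> 0" by (rule LIMSEQ_offset)
  from tendsto_add[OF this Q_tendsto[OF w dz_form_in_Omega1[of \<sigma>]]] show ?thesis by simp
qed

text \<open>Summation by parts: a corner value of \<open>F\<close> is multiplied by the sum of the
  differences of \<open>h\<close> to the other two corners. At the corner with value 0, the mean of
  1/6 and -1/6, this multiplier vanishes.\<close>

lemma dz_pairing:
  fixes F :: "pt \<Rightarrow> real" and \<sigma> :: "nat list" and i :: nat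
  assumes "i < 3"
  defines "h \<equiv> cell_harmonic (\<sigma> @ [i]) (lacuna_value i)"
  shows "cell_sum (\<lambda>x y. (F y - F x) * (h y - h x)) (\<sigma> @ [i]) = 1/2 * (F (lacuna_target \<sigma> i) - F (lacuna_source \<sigma> i))"
proof -
  have h: "h (wmap (\<sigma> @ [i]) (p j)) = lacuna_value i j" if "j < 3" for j
    using that by (simp add: h_def hext_p)
  have "i \<in> {0,1,2}" using assms(1) by auto
  then show ?thesis
    unfolding cell_sum_def lacuna_target_def lacuna_source_def
    by (auto simp: h numeral_2_eq_2[symmetric] field_simps)
qed

lemma power_cancel: "(5/3)^(n + k) * ((3/5)^k * x) = (5/3)^n * x" for x :: real
  by (simp add: power_add power_mult_distrib[symmetric] mult.assoc[symmetric])

text \<open>Since the potential of \<open>dz_form \<sigma>\<close> is harmonic on each child cell, with normal derivatives \<open>1/2\<close> and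
  \<open>-1/2\<close> at the ends of the side of the lacuna and \<open>0\<close> at the third corner, \<open>Q\<close> reads off the period.\<close>

lemma Q_dz_form_locally_exact:
  fixes F :: "nat \<Rightarrow> pt \<Rightarrow> real"
  assumes w: "\<omega> \<in> Omega1" and s: "\<sigma> \<in> Words"
    and F: "\<And>i m x y. i < 3 \<Longrightarrow> (x, y) \<in> oedges m \<Longrightarrow> seg (x, y) \<subseteq> cell (\<sigma> @ [i]) \<Longrightarrow>
      edge_integral \<omega> x y = F i y - F i x"
  shows "Q \<omega> (dz_form \<sigma>) = (5/3)^Suc (length \<sigma>) / 2 * (\<Sum>i<3. F i (lacuna_target \<sigma> i) - F i (lacuna_source \<sigma> i))"
proof -
  let ?n = "Suc (length \<sigma>)"
  let ?S = "\<Sum>i<3. F i (lacuna_target \<sigma> i) - F i (lacuna_source \<sigma> i)"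
  define h where "h = (\<lambda>i. cell_harmonic (\<sigma> @ [i]) (lacuna_value i))"
  \<comment> \<open>The level sums are constant from the level of the children on, so the limit
    needs no estimate here.\<close>
  have const: "(5/3)^(k + ?n) * level_sum (\<lambda>x y. edge_integral \<omega> x y * dz_form \<sigma> y x) (k + ?n) = (5/3)^?n / 2 * ?S" for k
  proof -
    have "level_sum (\<lambda>x y. edge_integral \<omega> x y * dz_form \<sigma> y x) (?n + k)
        = (\<Sum>i<3. \<Sum>\<rho>\<in>level_words k. cell_sum (\<lambda>x y. edge_integral \<omega> x y * (h i y - h i x)) ((\<sigma> @ [i]) @ \<rho>))"
      unfolding h_def by (rule level_sum_dz_form[OF s])
    also have "\<dots> = (\<Sum>i<3. \<Sum>\<rho>\<in>level_words k. cell_sum (\<lambda>x y. (F i y - F i x) * (h i y - h i x)) ((\<sigma> @ [i]) @ \<rho>))"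
    proof (intro sum.cong refl cell_sum_cong)
      fix i \<rho> a b assume i: "i \<in> {..<3::nat}" and r: "\<rho> \<in> level_words k" and ab: "a < (3::nat)" "b < (3::nat)"
      let ?x = "wmap ((\<sigma> @ [i]) @ \<rho>) (p a)" and ?y = "wmap ((\<sigma> @ [i]) @ \<rho>) (p b)"
      show "edge_integral \<omega> ?x ?y * (h i ?y - h i ?x) = (F i ?y - F i ?x) * (h i ?y - h i ?x)"
      proof (cases "a = b")
        case False
        have "(\<sigma> @ [i]) @ \<rho> \<in> level_words (?n + k)" using s i r by (auto simp: level_words_def)
        then have "(?x, ?y) \<in> oedges (?n + k)" unfolding oedges_iff using ab False by blast
        moreover have "seg (?x, ?y) \<subseteq> cell (\<sigma> @ [i])"
          using side_subset_cell[OF level_wordsD(1)[OF r] ab, of "\<sigma> @ [i]"] by (simp add: seg_def)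
        ultimately show ?thesis using F[of i ?x ?y] i by simp
      qed simp
    qed
    also have "\<dots> = (\<Sum>i<3. (3/5)^k * cell_sum (\<lambda>x y. (F i y - F i x) * (h i y - h i x)) (\<sigma> @ [i]))"
      using s by (intro sum.cong refl harmonic_pairing) (auto simp: h_def harmonic_in_cell_harmonic)
    also have "\<dots> = (3/5)^k * (1/2 * ?S)"
      unfolding h_def sum_distrib_left by (intro sum.cong refl arg_cong2[where f = "(*)"] dz_pairing) simp
    finally show ?thesis unfolding add.commute[of k ?n] by (simp only: power_cancel)
  qed
  have "(\<lambda>k. (5/3)^(k + ?n) * level_sum (\<lambda>x y. edge_integral \<omega> x y * dz_form \<sigma> y x) (k + ?n)) \<longlonglongrightarrow> (5/3)^?n / 2 * ?S"
    unfolding const by (rule tendsto_const)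
  then have "(\<lambda>m. (5/3)^m * level_sum (\<lambda>x y. edge_integral \<omega> x y * dz_form \<sigma> y x) m) \<longlonglongrightarrow> (5/3)^?n / 2 * ?S"
    by (rule LIMSEQ_offset)
  then show ?thesis using Q_dz_form_tendsto[OF w s] LIMSEQ_unique by blast
qed

text \<open>With one potential on the whole cell the increments along the three sides telescope,
  because the lacuna is closed. This single criterion serves for \<open>dU\<close>, for the forms of
  coarser cells and for the contradiction with exactness.\<close>

lemma Q_dz_form_exact_around:
  fixes F :: "pt \<Rightarrow> real"
  assumes "\<omega> \<in> Omega1" "\<sigma> \<in> Words"
    and "\<And>m x y. (x, y) \<in> oedges m \<Longrightarrow> seg (x, y) \<subseteq> cell \<sigma> \<Longrightarrow> edge_integral \<omega> x y = F y - F x"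
  shows "Q \<omega> (dz_form \<sigma>) = 0"
proof -
  have sub: "cell (\<sigma> @ [i]) \<subseteq> cell \<sigma>" if "i < 3" for i
    using that w_K by (auto simp: cell_def wmap_append)
  have "Q \<omega> (dz_form \<sigma>) = (5/3)^Suc (length \<sigma>) / 2 * (\<Sum>i<3. F (lacuna_target \<sigma> i) - F (lacuna_source \<sigma> i))"
  proof (rule Q_dz_form_locally_exact[OF assms(1,2)])
    show "edge_integral \<omega> x y = F y - F x"
      if "i < 3" "(x, y) \<in> oedges m" "seg (x, y) \<subseteq> cell (\<sigma> @ [i])" for i m x y
      using assms(3)[OF that(2)] that(3) sub[OF that(1)] by blast
  qed
  then show ?thesis by (simp add: sum_lessThan_3 lacuna_closed[simplified])
qed

lemma n_exact_edge_integral: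
  assumes "n_exact n \<omega>" "\<tau> \<in> level_words n"
  obtains F :: "pt \<Rightarrow> real" where
    "\<And>m x y. (x, y) \<in> oedges m \<Longrightarrow> seg (x, y) \<subseteq> cell \<tau> \<Longrightarrow> edge_integral \<omega> x y = F y - F x"
proof -
  obtain F where F: "\<And>\<gamma>. elementary_path \<gamma> \<and> epath_image \<gamma> \<subseteq> cell \<tau> \<Longrightarrow>
      path_integral \<gamma> \<omega> = F (snd (last \<gamma>)) - F (fst (hd \<gamma>))"
    using assms unfolding n_exact_def level_words_def by blast
  have "edge_integral \<omega> x y = F y - F x" if "(x, y) \<in> oedges m" "seg (x, y) \<subseteq> cell \<tau>" for m x y
    using F[of "[(x, y)]"] that by (auto simp: elementary_path_def epath_image_def edge_integral_def)
  then show ?thesis using that by blast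
qed

lemma lacuna_side:
  assumes "\<sigma> \<in> Words" "i < 3"
  shows "(lacuna_source \<sigma> i, lacuna_target \<sigma> i) \<in> oedges (Suc (length \<sigma>))"
    and "seg (lacuna_source \<sigma> i, lacuna_target \<sigma> i) \<subseteq> cell (\<sigma> @ [i])"
proof -
  have "\<sigma> @ [i] \<in> level_words (Suc (length \<sigma>))" using assms by (auto simp: level_words_def)
  moreover have "(i + 1) mod 3 < 3" "(i + 2) mod 3 < 3" "(i + 2) mod 3 \<noteq> (i + 1) mod 3"
    by (simp_all, presburger)
  ultimately show "(lacuna_source \<sigma> i, lacuna_target \<sigma> i) \<in> oedges (Suc (length \<sigma>))"
    unfolding oedges_iff lacuna_source_def lacuna_target_def by blast
  show "seg (lacuna_source \<sigma> i, lacuna_target \<sigma> i) \<subseteq> cell (\<sigma> @ [i])"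
    using side_subset_cell[of "[]" "(i + 2) mod 3" "(i + 1) mod 3" "\<sigma> @ [i]"]
    by (simp add: seg_def lacuna_source_def lacuna_target_def)
qed

lemma path_integral_lacuna:
  assumes "\<omega> \<in> Omega1" "\<sigma> \<in> Words"
  shows "path_integral (lacuna \<sigma>) \<omega> = (\<Sum>i<3. edge_integral \<omega> (lacuna_source \<sigma> i) (lacuna_target \<sigma> i))"
proof -
  let ?E = "\<lambda>i n. \<Sum>e'\<in>edges_along n (lacuna_source \<sigma> i, lacuna_target \<sigma> i). \<omega> (snd e') (fst e')"
  have "?E i \<longlonglongrightarrow> edge_integral \<omega> (lacuna_source \<sigma> i) (lacuna_target \<sigma> i)" if "i < 3" for i
    by (rule edge_integral_tendsto(1)[OF assms(1) lacuna_side(1)[OF assms(2) that]])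
  then have "(\<lambda>n. \<Sum>i<3. ?E i n) \<longlonglongrightarrow> (\<Sum>i<3. edge_integral \<omega> (lacuna_source \<sigma> i) (lacuna_target \<sigma> i))"
    by (intro tendsto_sum) simp
  moreover have "(\<Sum>e\<leftarrow>lacuna \<sigma>. \<Sum>e'\<in>edges_along n e. \<omega> (snd e') (fst e')) = (\<Sum>i<3. ?E i n)" for n
    unfolding lacuna_eq sum_lessThan_3 by simp
  ultimately show ?thesis unfolding path_integral_def by (simp add: limI)
qed

text \<open>The period constraint in the definition of \<open>dz \<sigma>\<close> thereby becomes a
  prescribed pairing with \<open>dz_form \<sigma>\<close>, the setting in which minimizing the norm
  is an orthogonal projection.\<close>

lemma Q_dz_form_period:
  assumes "n_exact (Suc (length \<sigma>)) \<omega>" "\<sigma> \<in> Words"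
  shows "Q \<omega> (dz_form \<sigma>) = (5/3)^Suc (length \<sigma>) / 2 * path_integral (lacuna \<sigma>) \<omega>"
proof -
  have w: "\<omega> \<in> Omega1" using assms(1) by (simp add: n_exact_def)
  have "\<exists>F :: pt \<Rightarrow> real. \<forall>m x y. (x, y) \<in> oedges m \<longrightarrow> seg (x, y) \<subseteq> cell (\<sigma> @ [i]) \<longrightarrow> edge_integral \<omega> x y = F y - F x"
    if "i < 3" for i
  proof -
    have "\<sigma> @ [i] \<in> level_words (Suc (length \<sigma>))" using that assms(2) by (auto simp: level_words_def)
    from n_exact_edge_integral[OF assms(1) this] show ?thesis by metis
  qed
  then obtain F :: "nat \<Rightarrow> pt \<Rightarrow> real" where F: "\<And>i m x y. i < 3 \<Longrightarrow> (x, y) \<in> oedges m \<Longrightarrow>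
      seg (x, y) \<subseteq> cell (\<sigma> @ [i]) \<Longrightarrow> edge_integral \<omega> x y = F i y - F i x"
    by metis
  have "path_integral (lacuna \<sigma>) \<omega> = (\<Sum>i<3. F i (lacuna_target \<sigma> i) - F i (lacuna_source \<sigma> i))"
    unfolding path_integral_lacuna[OF w assms(2)]
    by (intro sum.cong refl F[OF _ lacuna_side[OF assms(2)]]) auto
  then show ?thesis using Q_dz_form_locally_exact[OF w assms(2) F] by simp
qed

lemma Q_dU_dz_form:
  assumes "U \<in> FF" "\<sigma> \<in> Words"
  shows "Q (fdg (\<lambda>_. 1) U) (dz_form \<sigma>) = 0"
proof (rule Q_dz_form_exact_around[OF _ assms(2)])
  show w: "fdg (\<lambda>_. 1) U \<in> Omega1" using assms(1) by (intro fdg_in_Omega1 FF_const)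
  fix m x y assume e: "(x, y) \<in> oedges m" and "seg (x, y) \<subseteq> cell \<sigma>"
  then have "seg (x, y) \<subseteq> K" using wmap_K[OF assms(2)] by (auto simp: cell_def)
  then have ev: "eventually (\<lambda>n. (\<Sum>e'\<in>edges_along n (x, y). fdg (\<lambda>_. 1) U (snd e') (fst e')) = U y - U x) sequentially"
    unfolding eventually_sequentially
    by (intro exI[of _ m] allI impI edges_along_telescope[OF e, where A = K]) (auto simp: fdg_def)
  show "edge_integral (fdg (\<lambda>_. 1) U) x y = U y - U x"
    by (rule LIMSEQ_unique[OF edge_integral_tendsto(1)[OF w e] tendsto_eventually[OF ev]])
qed

section \<open>Exactness, periods, orthogonality and Hodge coefficients\<close>

definition dz_potential :: "nat list \<Rightarrow> nat list \<Rightarrow> pt \<Rightarrow> real" where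
  "dz_potential \<sigma> \<tau> = cell_harmonic \<tau> (dz_values \<sigma> \<tau>)"

lemma dz_form_potential:
  assumes "\<sigma> \<in> Words" "\<tau> \<in> level_words (Suc (length \<sigma>))" "a \<in> cell \<tau>" "b \<in> cell \<tau>"
  shows "dz_form \<sigma> b a = dz_potential \<sigma> \<tau> b - dz_potential \<sigma> \<tau> a"
proof -
  obtain x y where "x \<in> K" "y \<in> K" "a = wmap \<tau> x" "b = wmap \<tau> y"
    using assms(3,4) by (auto simp: cell_def)
  then show ?thesis using dz_form_cell[OF assms(1,2)] by (simp add: dz_potential_def)
qed

lemma dz_form_edges_along:
  assumes "\<sigma> \<in> Words" "\<tau> \<in> level_words (Suc (length \<sigma>))" "(x, y) \<in> oedges m" "seg (x, y) \<subseteq> cell \<tau>"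
  shows "eventually (\<lambda>n. (\<Sum>e'\<in>edges_along n (x, y). dz_form \<sigma> (snd e') (fst e'))
    = dz_potential \<sigma> \<tau> y - dz_potential \<sigma> \<tau> x) sequentially"
  unfolding eventually_sequentially
  by (intro exI[of _ m] allI impI edges_along_telescope[OF assms(3,4)] dz_form_potential[OF assms(1,2)])

lemma dz_form_edge_integral:
  assumes "\<sigma> \<in> Words" "\<tau> \<in> level_words (Suc (length \<sigma>))" "(x, y) \<in> oedges m" "seg (x, y) \<subseteq> cell \<tau>"
  shows "edge_integral (dz_form \<sigma>) x y = dz_potential \<sigma> \<tau> y - dz_potential \<sigma> \<tau> x"
  by (rule LIMSEQ_unique[OF edge_integral_tendsto(1)[OF dz_form_in_Omega1 assms(3)]
      tendsto_eventually[OF dz_form_edges_along[OF assms]]])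

lemma sum_list_path_telescope:
  fixes f :: "pt \<Rightarrow> real"
  assumes "\<gamma> \<noteq> []" "\<forall>j. Suc j < length \<gamma> \<longrightarrow> snd (\<gamma> ! j) = fst (\<gamma> ! Suc j)"
  shows "(\<Sum>e\<leftarrow>\<gamma>. f (snd e) - f (fst e)) = f (snd (last \<gamma>)) - f (fst (hd \<gamma>))"
  using assms
proof (induction \<gamma>)
  case (Cons e \<gamma>)
  show ?case
  proof (cases "\<gamma> = []")
    case False
    have "snd (\<gamma> ! j) = fst (\<gamma> ! Suc j)" if "Suc j < length \<gamma>" for j
      using Cons.prems(2) that by (metis Suc_less_eq length_Cons nth_Cons_Suc)
    moreover have "snd e = fst (hd \<gamma>)"
      using Cons.prems(2) False by (metis Suc_less_eq hd_conv_nth length_Cons length_greater_0_conv nth_Cons_0 nth_Cons_Suc)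
    ultimately show ?thesis using Cons.IH False by simp
  qed simp
qed simp

lemma energy_on_cell_harmonic:
  assumes "\<tau> \<in> level_words n"
  shows "energy_on (cell \<tau>) (cell_harmonic \<tau> v) < \<infinity>"
proof -
  let ?h = "cell_harmonic \<tau> v"
  let ?F = "\<lambda>x y. (?h y - ?h x) * (?h y - ?h x)"
  have "(5/3)^(k + n) * (\<Sum>e\<in>{e\<in>edges (k + n). seg e \<subseteq> cell \<tau>}. \<bar>?h (snd e) - ?h (fst e)\<bar>\<^sup>2)
      = (5/3)^n * cell_sum ?F \<tau>" for k
  proof -
    have "(\<Sum>e\<in>{e\<in>edges (n + k). seg e \<subseteq> cell \<tau>}. \<bar>?h (snd e) - ?h (fst e)\<bar>\<^sup>2)
        = (\<Sum>\<rho>\<in>level_words k. cell_sum ?F (\<tau> @ \<rho>))"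
      using sum_edges_in_cell[OF assms, of ?F k] by (simp add: power2_eq_square)
    also have "\<dots> = (3/5)^k * cell_sum ?F \<tau>"
      by (rule harmonic_pairing[OF harmonic_in_cell_harmonic level_wordsD(1)[OF assms]])
    finally show ?thesis by (simp only: power_cancel add.commute[of k n])
  qed
  then have "(\<lambda>k. ereal ((5/3)^(k + n) * (\<Sum>e\<in>{e\<in>edges (k + n). seg e \<subseteq> cell \<tau>}. \<bar>?h (snd e) - ?h (fst e)\<bar>\<^sup>2)))
      \<longlonglongrightarrow> ereal ((5/3)^n * cell_sum ?F \<tau>)"
    by simp
  then have "(\<lambda>m. ereal ((5/3)^m * (\<Sum>e\<in>{e\<in>edges m. seg e \<subseteq> cell \<tau>}. \<bar>?h (snd e) - ?h (fst e)\<bar>\<^sup>2)))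
      \<longlonglongrightarrow> ereal ((5/3)^n * cell_sum ?F \<tau>)"
    by (rule LIMSEQ_offset)
  then have "energy_on (cell \<tau>) ?h = ereal ((5/3)^n * cell_sum ?F \<tau>)"
    unfolding energy_on_def by (rule limI)
  then show ?thesis by simp
qed

lemma dz_form_n_exact:
  assumes s: "\<sigma> \<in> Words"
  shows "n_exact (Suc (length \<sigma>)) (dz_form \<sigma>)"
  unfolding n_exact_def
proof (intro conjI ballI impI)
  show "dz_form \<sigma> \<in> Omega1" by (rule dz_form_in_Omega1)
  fix \<tau> assume "\<tau> \<in> Words" "length \<tau> = Suc (length \<sigma>)"
  then have t: "\<tau> \<in> level_words (Suc (length \<sigma>))" by (rule level_wordsI)
  let ?f = "dz_potential \<sigma> \<tau>"
  have "path_integral \<gamma> (dz_form \<sigma>) = ?f (snd (last \<gamma>)) - ?f (fst (hd \<gamma>))"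
    if \<gamma>: "elementary_path \<gamma>" "epath_image \<gamma> \<subseteq> cell \<tau>" for \<gamma>
  proof -
    have "eventually (\<lambda>n. \<forall>e\<in>set \<gamma>. (\<Sum>e'\<in>edges_along n e. dz_form \<sigma> (snd e') (fst e')) = ?f (snd e) - ?f (fst e)) sequentially"
    proof (rule eventually_ball_finite)
      show "\<forall>e\<in>set \<gamma>. eventually (\<lambda>n. (\<Sum>e'\<in>edges_along n e. dz_form \<sigma> (snd e') (fst e')) = ?f (snd e) - ?f (fst e)) sequentially"
      proof
        fix e assume e: "e \<in> set \<gamma>"
        then obtain m where "e \<in> oedges m" using \<gamma>(1) by (auto simp: elementary_path_def)
        moreover have "seg e \<subseteq> cell \<tau>" using \<gamma>(2) e by (auto simp: epath_image_def)
        ultimately show "eventually (\<lambda>n. (\<Sum>e'\<in>edges_along n e. dz_form \<sigma> (snd e') (fst e')) = ?f (snd e) - ?f (fst e)) sequentially"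
          using dz_form_edges_along[OF s t, of "fst e" "snd e" m] by simp
      qed
    qed simp
    then have "eventually (\<lambda>n. (\<Sum>e\<leftarrow>\<gamma>. \<Sum>e'\<in>edges_along n e. dz_form \<sigma> (snd e') (fst e')) = ?f (snd (last \<gamma>)) - ?f (fst (hd \<gamma>))) sequentially"
    proof (rule eventually_mono)
      fix n assume *: "\<forall>e\<in>set \<gamma>. (\<Sum>e'\<in>edges_along n e. dz_form \<sigma> (snd e') (fst e')) = ?f (snd e) - ?f (fst e)"
      have "(\<Sum>e\<leftarrow>\<gamma>. \<Sum>e'\<in>edges_along n e. dz_form \<sigma> (snd e') (fst e')) = (\<Sum>e\<leftarrow>\<gamma>. ?f (snd e) - ?f (fst e))"
        using * by (intro arg_cong[where f = sum_list] map_cong refl) blast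
      also have "\<dots> = ?f (snd (last \<gamma>)) - ?f (fst (hd \<gamma>))"
        using \<gamma>(1) unfolding elementary_path_def by (intro sum_list_path_telescope) auto
      finally show "(\<Sum>e\<leftarrow>\<gamma>. \<Sum>e'\<in>edges_along n e. dz_form \<sigma> (snd e') (fst e')) = ?f (snd (last \<gamma>)) - ?f (fst (hd \<gamma>))" .
    qed
    then show ?thesis unfolding path_integral_def by (intro limI tendsto_eventually)
  qed
  moreover have "continuous_on (cell \<tau>) ?f" "energy_on (cell \<tau>) ?f < \<infinity>"
    unfolding dz_potential_def using continuous_cell_harmonic energy_on_cell_harmonic[OF t] by blast+
  ultimately show "\<exists>f. continuous_on (cell \<tau>) f \<and> energy_on (cell \<tau>) f < \<infinity> \<and>
      (\<forall>\<gamma>. elementary_path \<gamma> \<and> epath_image \<gamma> \<subseteq> cell \<tau> \<longrightarrow>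
        path_integral \<gamma> (dz_form \<sigma>) = f (snd (last \<gamma>)) - f (fst (hd \<gamma>)))"
    by blast
qed

lemma dz_form_period:
  assumes s: "\<sigma> \<in> Words"
  shows "path_integral (lacuna \<sigma>) (dz_form \<sigma>) = 1"
proof -
  have "edge_integral (dz_form \<sigma>) (lacuna_source \<sigma> i) (lacuna_target \<sigma> i) = 1/3" if i: "i < 3" for i
  proof -
    have t: "\<sigma> @ [i] \<in> level_words (Suc (length \<sigma>))" using s i by (auto simp: level_words_def)
    have "edge_integral (dz_form \<sigma>) (lacuna_source \<sigma> i) (lacuna_target \<sigma> i)
        = dz_potential \<sigma> (\<sigma> @ [i]) (lacuna_target \<sigma> i) - dz_potential \<sigma> (\<sigma> @ [i]) (lacuna_source \<sigma> i)"
      by (rule dz_form_edge_integral[OF s t lacuna_side[OF s i]])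
    also have "\<dots> = lacuna_value i ((i + 1) mod 3) - lacuna_value i ((i + 2) mod 3)"
      by (simp add: dz_potential_def dz_values_def lacuna_target_def lacuna_source_def hext_p)
    also have "\<dots> = 1/3"
    proof -
      have "i \<in> {0,1,2}" using i by auto
      then show ?thesis by (auto simp: lacuna_value_def)
    qed
    finally show ?thesis .
  qed
  then show ?thesis unfolding path_integral_lacuna[OF dz_form_in_Omega1 s] by (subst sum.cong[OF refl, of _ _ "\<lambda>_. 1/3"]) auto
qed

text \<open>The form is itself admissible in the period formula with period 1, so its norm is
  obtained without adding up the energies of its potentials.\<close>

lemma Q_dz_form_self: "\<sigma> \<in> Words \<Longrightarrow> Q (dz_form \<sigma>) (dz_form \<sigma>) = (5/3)^Suc (length \<sigma>) / 2"
  using Q_dz_form_period[OF dz_form_n_exact] dz_form_period by simp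

text \<open>For equal lengths the form of \<tau> has zero potential on the children of \<sigma>. For
  a shorter \<tau> the cell of \<sigma> lies in one cell of the level below \<tau>, so there is one
  potential around the lacuna of \<sigma>. The finer word has to be the second argument, where the
  period is taken.\<close>

lemma Q_dz_form_orthogonal_le:
  assumes "\<sigma> \<in> Words" "\<tau> \<in> Words" "\<tau> \<noteq> \<sigma>" "length \<tau> \<le> length \<sigma>"
  shows "Q (dz_form \<tau>) (dz_form \<sigma>) = 0"
proof (cases "length \<tau> = length \<sigma>")
  case True
  have "Q (dz_form \<tau>) (dz_form \<sigma>) = (5/3)^Suc (length \<sigma>) / 2 * (\<Sum>i<3::nat. (\<lambda>_. 0) (lacuna_target \<sigma> i) - (\<lambda>_. 0) (lacuna_source \<sigma> i))"
  proof (rule Q_dz_form_locally_exact[OF dz_form_in_Omega1 assms(1)])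
    fix i m x y assume *: "i < (3::nat)" "(x, y) \<in> oedges m" "seg (x, y) \<subseteq> cell (\<sigma> @ [i])"
    have t: "\<sigma> @ [i] \<in> level_words (Suc (length \<tau>))" using assms(1) * True by (auto simp: level_words_def)
    show "edge_integral (dz_form \<tau>) x y = (\<lambda>_. 0) y - (\<lambda>_. 0) x"
      unfolding dz_form_edge_integral[OF assms(2) t *(2,3)]
      using assms(3) by (simp add: dz_potential_def dz_values_def cell_harmonic_def)
  qed
  then show ?thesis by simp
next
  case False
  then have "Suc (length \<tau>) \<le> length \<sigma>" using assms(4) by simp
  define \<alpha> \<beta> where "\<alpha> = take (Suc (length \<tau>)) \<sigma>" and "\<beta> = drop (Suc (length \<tau>)) \<sigma>"
  have ab: "\<sigma> = \<alpha> @ \<beta>" "\<alpha> \<in> level_words (Suc (length \<tau>))" "\<beta> \<in> Words"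
    using assms(1) \<open>Suc (length \<tau>) \<le> length \<sigma>\<close>
    by (auto simp: \<alpha>_def \<beta>_def level_words_def Words_def dest: in_set_takeD in_set_dropD)
  have "cell \<sigma> \<subseteq> cell \<alpha>" using wmap_K[OF ab(3)] by (auto simp: ab(1) cell_def wmap_append)
  then show ?thesis
    by (intro Q_dz_form_exact_around[OF dz_form_in_Omega1 assms(1), of _ "dz_potential \<tau> \<alpha>"]
        dz_form_edge_integral[OF assms(2) ab(2)]) auto
qed

lemma Q_dz_form_orthogonal:
  assumes "\<sigma> \<in> Words" "\<tau> \<in> Words" "\<tau> \<noteq> \<sigma>"
  shows "Q (dz_form \<tau>) (dz_form \<sigma>) = 0"
  using Q_dz_form_orthogonal_le[of \<sigma> \<tau>] Q_dz_form_orthogonal_le[of \<tau> \<sigma>] assms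
    Q_commute[OF dz_form_in_Omega1 dz_form_in_Omega1] by (cases "length \<tau> \<le> length \<sigma>") auto

text \<open>All admissible forms have the same pairing with \<open>dz_form \<sigma>\<close>, namely
  \<open>Q (dz_form \<sigma>) (dz_form \<sigma>)\<close>. Hence Q(\<omega> - dz_form) = Q(\<omega>)
  - Q(dz_form) for the quadratic form: \<open>dz_form \<sigma>\<close> is a minimizer, and the one
  selected by \<open>arg_min\<close> differs from it by a null form.\<close>

lemma dz_minimizer:
  assumes s: "\<sigma> \<in> Words"
  shows "dz \<sigma> \<in> Omega1" "\<And>\<eta>. \<eta> \<in> Omega1 \<Longrightarrow> Q (dz \<sigma>) \<eta> = Q (dz_form \<sigma>) \<eta>"
proof -
  define P where "P = (\<lambda>\<omega>. n_exact (Suc (length \<sigma>)) \<omega> \<and> path_integral (lacuna \<sigma>) \<omega> = 1)"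
  have P_form: "P (dz_form \<sigma>)" using dz_form_n_exact[OF s] dz_form_period[OF s] by (simp add: P_def)
  have pair: "Q \<omega> (dz_form \<sigma>) = Q (dz_form \<sigma>) (dz_form \<sigma>)" if "P \<omega>" for \<omega>
    using Q_dz_form_period[of \<sigma> \<omega>] that s Q_dz_form_self[OF s] by (simp add: P_def)
  have P_Omega1: "\<omega> \<in> Omega1" if "P \<omega>" for \<omega> using that by (simp add: P_def n_exact_def)
  have "Q (dz_form \<sigma>) (dz_form \<sigma>) \<le> Q \<omega> \<omega>" if "P \<omega>" for \<omega>
    using Q_nonneg[OF Omega1_diff[OF P_Omega1[OF that] dz_form_in_Omega1[of \<sigma>]]]
      Q_diff_self[OF P_Omega1[OF that] dz_form_in_Omega1[of \<sigma>]] pair[OF that] by simp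
  then have "is_arg_min Qnorm P (dz_form \<sigma>)"
    using P_form unfolding is_arg_min_def Qnorm_def by (simp add: not_less)
  then have "is_arg_min Qnorm P (dz \<sigma>)"
    unfolding dz_def arg_min_def P_def[symmetric] by (rule someI[of "is_arg_min Qnorm P"])
  then have dz: "P (dz \<sigma>)" "\<not> Qnorm (dz_form \<sigma>) < Qnorm (dz \<sigma>)"
    using P_form by (auto simp: is_arg_min_def)
  show O: "dz \<sigma> \<in> Omega1" by (rule P_Omega1[OF dz(1)])
  have "Q (dz \<sigma>) (dz \<sigma>) \<le> Q (dz_form \<sigma>) (dz_form \<sigma>)"
    using dz(2) by (simp add: Qnorm_def not_less)
  then have "Q (\<lambda>x y. dz \<sigma> x y - dz_form \<sigma> x y) (\<lambda>x y. dz \<sigma> x y - dz_form \<sigma> x y) \<le> 0"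
    using Q_diff_self[OF O dz_form_in_Omega1[of \<sigma>]] pair[OF dz(1)] by simp
  then show "Q (dz \<sigma>) \<eta> = Q (dz_form \<sigma>) \<eta>" if "\<eta> \<in> Omega1" for \<eta>
    using Q_eq_if_Q_diff_zero O dz_form_in_Omega1 that by blast
qed

text \<open>Pairing with \<open>dz_form \<sigma>\<close> is continuous for \<open>Qnorm\<close> by
  Cauchy-Schwarz, so it can be applied term by term to the decomposition; orthogonality leaves the
  term of \<sigma> alone.\<close>

lemma hodge_coefficient:
  assumes "\<omega> \<in> Omega1" "hodge_decomposition \<omega> U k" and s: "\<sigma> \<in> Words"
  shows "Q \<omega> (dz_form \<sigma>) = k \<sigma> * ((5/3)^Suc (length \<sigma>) / 2)"
proof -
  let ?\<eta> = "dz_form \<sigma>"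
  define R where "R = (\<lambda>A x y. \<omega> x y - fdg (\<lambda>_. 1) U x y - (\<Sum>\<tau>\<in>A. k \<tau> * dz \<tau> x y))"
  have U: "U \<in> FF" and lim: "((\<lambda>A. Qnorm (R A)) \<longlongrightarrow> 0) (finite_subsets_at_top Words)"
    using assms(2) by (auto simp: hodge_decomposition_def R_def)
  have dU: "fdg (\<lambda>_. 1) U \<in> Omega1" using U by (intro fdg_in_Omega1 FF_const)
  let ?d = "Q \<omega> ?\<eta> - k \<sigma> * ((5/3)^Suc (length \<sigma>) / 2)"
  \<comment> \<open>As soon as \<open>A\<close> contains \<sigma>, the remainder has the same
    pairing \<open>?d\<close> with \<open>dz_form \<sigma>\<close>, while its norm tends to zero; so
    \<open>?d\<close> is zero.\<close>
  have "eventually (\<lambda>A. \<bar>?d\<bar> \<le> Qnorm (R A) * Qnorm ?\<eta>) (finite_subsets_at_top Words)"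
    unfolding eventually_finite_subsets_at_top
  proof (intro exI[of _ "{\<sigma>}"] conjI allI impI)
    fix A assume A: "finite A \<and> {\<sigma>} \<subseteq> A \<and> A \<subseteq> Words"
    have sumO: "(\<lambda>x y. \<Sum>\<tau>\<in>A. k \<tau> * dz \<tau> x y) \<in> Omega1"
      using A dz_minimizer(1) by (intro Omega1_sum Omega1_scale) auto
    have diffO: "(\<lambda>x y. \<omega> x y - fdg (\<lambda>_. 1) U x y) \<in> Omega1" using assms(1) dU by (rule Omega1_diff)
    have RO: "R A \<in> Omega1" unfolding R_def by (rule Omega1_diff[OF diffO sumO])
    have "Q (\<lambda>x y. \<Sum>\<tau>\<in>A. k \<tau> * dz \<tau> x y) ?\<eta> = (\<Sum>\<tau>\<in>A. k \<tau> * Q (dz \<tau>) ?\<eta>)"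
      using A dz_minimizer(1) dz_form_in_Omega1 by (intro Q_sum_left) auto
    also have "\<dots> = (\<Sum>\<tau>\<in>A. if \<tau> = \<sigma> then k \<sigma> * Q ?\<eta> ?\<eta> else 0)"
      using A dz_minimizer(2)[OF _ dz_form_in_Omega1] Q_dz_form_orthogonal[OF s]
      by (intro sum.cong refl) auto
    also have "\<dots> = k \<sigma> * ((5/3)^Suc (length \<sigma>) / 2)"
      using A Q_dz_form_self[OF s] by simp
    finally have "Q (R A) ?\<eta> = ?d"
      unfolding R_def Q_diff_left[OF diffO sumO dz_form_in_Omega1] Q_diff_left[OF assms(1) dU dz_form_in_Omega1]
        Q_dU_dz_form[OF U s] by simp
    then have "?d\<^sup>2 \<le> (Qnorm (R A) * Qnorm ?\<eta>)\<^sup>2"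
      using Q_Cauchy_Schwarz[OF RO dz_form_in_Omega1[of \<sigma>]]
      by (simp add: power_mult_distrib Qnorm_power2 RO dz_form_in_Omega1)
    moreover have "0 \<le> Qnorm (R A) * Qnorm ?\<eta>"
      using Q_nonneg[OF RO] Q_nonneg[OF dz_form_in_Omega1[of \<sigma>]] by (simp add: Qnorm_def)
    ultimately show "\<bar>?d\<bar> \<le> Qnorm (R A) * Qnorm ?\<eta>"
      by (simp add: power2_le_iff_abs_le)
  qed (use s in auto)
  moreover have "((\<lambda>A. Qnorm (R A) * Qnorm ?\<eta>) \<longlongrightarrow> 0) (finite_subsets_at_top Words)"
    using tendsto_mult_right[OF lim, of "Qnorm ?\<eta>"] by simp
  ultimately have "\<bar>?d\<bar> \<le> 0"
    by (intro tendsto_lowerbound[of _ 0]) auto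
  then show ?thesis by simp
qed

text \<open>The pairing of \<open>f dg\<close> with \<open>dz_form \<sigma>\<close> is alternating in the harmonic functions \<open>f\<close> and \<open>g\<close> and
  blind to constants, hence a multiple of the determinant of their increments on the cell.\<close>

definition increment_det :: "(pt \<Rightarrow> real) \<Rightarrow> (pt \<Rightarrow> real) \<Rightarrow> nat list \<Rightarrow> real" where
  "increment_det f g \<sigma> =
     (f (wmap \<sigma> (p 1)) - f (wmap \<sigma> (p 0))) * (g (wmap \<sigma> (p 2)) - g (wmap \<sigma> (p 0)))
     - (f (wmap \<sigma> (p 2)) - f (wmap \<sigma> (p 0))) * (g (wmap \<sigma> (p 1)) - g (wmap \<sigma> (p 0)))"

text \<open>The numbers 1/6, 1/6 and -1/3 are the increments of the potential along the clockwise
  sides of a child. The negative one belongs to the side of the lacuna, which the child traverses in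
  the opposite direction.\<close>

lemma dz_triple_identity:
  fixes a b c a' b' c' :: real
  assumes "x = (2*a + 2*b + c)/5" "y = (a + 2*b + 2*c)/5" "z = (2*a + b + 2*c)/5"
    "x' = (2*a' + 2*b' + c')/5" "y' = (a' + 2*b' + 2*c')/5" "z' = (2*a' + b' + 2*c')/5"
  shows "((a+x)/2*(x'-a')*(1/6) + (x+z)/2*(z'-x')*(-1/3) + (z+a)/2*(a'-z')*(1/6))
    + ((x+b)/2*(b'-x')*(1/6) + (b+y)/2*(y'-b')*(1/6) + (y+x)/2*(x'-y')*(-1/3))
    + ((z+y)/2*(y'-z')*(-1/3) + (y+c)/2*(c'-y')*(1/6) + (c+z)/2*(z'-c')*(1/6))
    = 1/25 * ((b-a)*(c'-a') - (c-a)*(b'-a'))"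
  unfolding assms by (simp add: algebra_simps add_divide_distrib diff_divide_distrib)

lemma dz_triple:
  fixes \<sigma> :: "nat list"
  assumes "harmonic_at f \<sigma>" "harmonic_at g \<sigma>"
  defines "h \<equiv> \<lambda>i. cell_harmonic (\<sigma> @ [i]) (lacuna_value i)"
  shows "(\<Sum>i<3. cell_sum (\<lambda>x y. (f x + f y) / 2 * (g y - g x) * (h i y - h i x)) (\<sigma> @ [i]))
    = 1/25 * increment_det f g \<sigma>"
proof -
  define a b c where "a = f (wmap \<sigma> (p 0))" "b = f (wmap \<sigma> (p 1))" "c = f (wmap \<sigma> (p 2))"
  define a' b' c' where "a' = g (wmap \<sigma> (p 0))" "b' = g (wmap \<sigma> (p 1))" "c' = g (wmap \<sigma> (p 2))"
  define x y z where "x = f (wmap \<sigma> (w 0 (p 1)))" "y = f (wmap \<sigma> (w 1 (p 2)))" "z = f (wmap \<sigma> (w 0 (p 2)))"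
  define x' y' z' where "x' = g (wmap \<sigma> (w 0 (p 1)))" "y' = g (wmap \<sigma> (w 1 (p 2)))" "z' = g (wmap \<sigma> (w 0 (p 2)))"
  note defs = a_b_c_def a'_b'_c'_def x_y_z_def x'_y'_z'_def
  have h: "h i (wmap (\<sigma> @ [i]) (p j)) = lacuna_value i j" if "j < 3" for i j
    using that by (simp add: h_def hext_p)
  have "cell_sum (\<lambda>x y. (f x + f y) / 2 * (g y - g x) * (h 0 y - h 0 x)) (\<sigma> @ [0])
      = (a+x)/2*(x'-a')*(1/6) + (x+z)/2*(z'-x')*(-1/3) + (z+a)/2*(a'-z')*(1/6)"
    unfolding cell_sum_def by (simp add: h) (simp add: wmap_append defs)
  moreover have "cell_sum (\<lambda>x y. (f x + f y) / 2 * (g y - g x) * (h 1 y - h 1 x)) (\<sigma> @ [1])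
      = (x+b)/2*(b'-x')*(1/6) + (b+y)/2*(y'-b')*(1/6) + (y+x)/2*(x'-y')*(-1/3)"
    unfolding cell_sum_def by (simp add: h) (simp add: wmap_append defs)
  moreover have "cell_sum (\<lambda>x y. (f x + f y) / 2 * (g y - g x) * (h 2 y - h 2 x)) (\<sigma> @ [2])
      = (z+y)/2*(y'-z')*(-1/3) + (y+c)/2*(c'-y')*(1/6) + (c+z)/2*(z'-c')*(1/6)"
    unfolding cell_sum_def by (simp add: h) (simp add: wmap_append defs)
  moreover have "((a+x)/2*(x'-a')*(1/6) + (x+z)/2*(z'-x')*(-1/3) + (z+a)/2*(a'-z')*(1/6))
    + ((x+b)/2*(b'-x')*(1/6) + (b+y)/2*(y'-b')*(1/6) + (y+x)/2*(x'-y')*(-1/3))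
    + ((z+y)/2*(y'-z')*(-1/3) + (y+c)/2*(c'-y')*(1/6) + (c+z)/2*(z'-c')*(1/6))
    = 1/25 * ((b-a)*(c'-a') - (c-a)*(b'-a'))"
    by (rule dz_triple_identity) (use assms(1,2) in \<open>simp_all only: harmonic_at_def defs\<close>)
  ultimately show ?thesis
    unfolding sum_lessThan_3 increment_det_def defs by (simp only:)
qed

text \<open>Relative to the fixed corner, the map on increments is the symmetric 2 by 2 matrix with
  entries 2/5 and 1/5, whose eigenvalues are 3/5 and 1/5. The determinant does not depend on the
  base corner as long as the cyclic order is kept, so all children give the same factor.\<close>

lemma increment_det_child:
  assumes "harmonic_at f \<sigma>" "harmonic_at g \<sigma>" "i < 3"
  shows "increment_det f g (\<sigma> @ [i]) = 3/25 * increment_det f g \<sigma>"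
proof -
  define a b c where "a = f (wmap \<sigma> (p 0))" "b = f (wmap \<sigma> (p 1))" "c = f (wmap \<sigma> (p 2))"
  define a' b' c' where "a' = g (wmap \<sigma> (p 0))" "b' = g (wmap \<sigma> (p 1))" "c' = g (wmap \<sigma> (p 2))"
  define x y z where "x = f (wmap \<sigma> (w 0 (p 1)))" "y = f (wmap \<sigma> (w 1 (p 2)))" "z = f (wmap \<sigma> (w 0 (p 2)))"
  define x' y' z' where "x' = g (wmap \<sigma> (w 0 (p 1)))" "y' = g (wmap \<sigma> (w 1 (p 2)))" "z' = g (wmap \<sigma> (w 0 (p 2)))"
  note defs = a_b_c_def a'_b'_c'_def x_y_z_def x'_y'_z'_def
  have mid: "x = (2*a + 2*b + c)/5" "y = (a + 2*b + 2*c)/5" "z = (2*a + b + 2*c)/5"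
    "x' = (2*a' + 2*b' + c')/5" "y' = (a' + 2*b' + 2*c')/5" "z' = (2*a' + b' + 2*c')/5"
    using assms(1,2) unfolding harmonic_at_def defs by simp_all
  have D: "increment_det f g \<sigma> = (b-a)*(c'-a') - (c-a)*(b'-a')"
    by (simp add: increment_det_def defs)
  consider "i = 0" | "i = 1" | "i = 2" using assms(3) by linarith
  then show ?thesis
  proof cases
    case 1
    then have "increment_det f g (\<sigma> @ [i]) = (x-a)*(z'-a') - (z-a)*(x'-a')"
      by (simp add: increment_det_def wmap_append defs)
    then show ?thesis
      unfolding D mid by (simp add: algebra_simps add_divide_distrib diff_divide_distrib)
  next
    case 2
    then have "increment_det f g (\<sigma> @ [i]) = (b-x)*(y'-x') - (y-x)*(b'-x')"
      by (simp add: increment_det_def wmap_append defs)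
    then show ?thesis
      unfolding D mid by (simp add: algebra_simps add_divide_distrib diff_divide_distrib)
  next
    case 3
    then have "increment_det f g (\<sigma> @ [i]) = (y-z)*(c'-z') - (c-z)*(y'-z')"
      by (simp add: increment_det_def wmap_append defs)
    then show ?thesis
      unfolding D mid by (simp add: algebra_simps add_divide_distrib diff_divide_distrib)
  qed
qed

lemma increment_det_harmonic:
  assumes "harmonic_in f []" "harmonic_in g []" "\<sigma> \<in> Words"
  shows "increment_det f g \<sigma> = (3/25)^length \<sigma> * increment_det f g []"
  using assms(3)
proof (induction \<sigma> rule: rev_induct)
  case (snoc i \<sigma>)
  then have "harmonic_at f \<sigma>" "harmonic_at g \<sigma>" "i < 3"
    using assms(1,2) by (auto simp: harmonic_in_def)
  then show ?case using snoc increment_det_child by simp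
qed simp

text \<open>Antisymmetry of \<open>dz_form \<sigma>\<close> collapses \<open>Q_at\<close> to the
  averaged triple product, which is exactly self-similar for three harmonic functions. The value on
  the level of the children is already the limit.\<close>

lemma Q_fdg_dz_form:
  assumes "f \<in> FF" "g \<in> FF" "harmonic_in f []" "harmonic_in g []" and s: "\<sigma> \<in> Words"
  shows "Q (fdg f g) (dz_form \<sigma>) = (5/3)^Suc (length \<sigma>) * (1/25 * increment_det f g \<sigma>)"
proof -
  let ?n = "Suc (length \<sigma>)"
  define h where "h = (\<lambda>i. cell_harmonic (\<sigma> @ [i]) (lacuna_value i))"
  define G where "G = (\<lambda>x y. (f x + f y) / 2 * (g y - g x))"
  have harm: "harmonic_in f \<tau>" "harmonic_in g \<tau>" if "\<tau> \<in> Words" for \<tau>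
    using harmonic_in_append[OF assms(3) that] harmonic_in_append[OF assms(4) that] by simp_all
  have const: "Q_at (k + ?n) (fdg f g) (dz_form \<sigma>) = (5/3)^?n * (1/25 * increment_det f g \<sigma>)" for k
  proof -
    have "level_sum (\<lambda>x y. 1/2 * (fdg f g y x * dz_form \<sigma> y x + fdg f g x y * dz_form \<sigma> x y)) (?n + k)
        = level_sum (\<lambda>x y. G x y * dz_form \<sigma> y x) (?n + k)"
    proof (rule level_sum_cong_vertices)
      fix \<upsilon> i j assume u: "\<upsilon> \<in> level_words (?n + k)" and ij: "i < (3::nat)" "j < (3::nat)"
      define x y where "x = wmap \<upsilon> (p i)" and "y = wmap \<upsilon> (p j)"
      have K: "x \<in> K" "y \<in> K"
        unfolding x_def y_def using wmap_p_in_K[OF level_wordsD(1)[OF u]] ij by blast+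
      have anti: "dz_form \<sigma> x y = - dz_form \<sigma> y x"
        unfolding x_def y_def using dz_form_antisym_bound(1)[OF s u] ij by blast
      show "1/2 * (fdg f g y x * dz_form \<sigma> y x + fdg f g x y * dz_form \<sigma> x y) = G x y * dz_form \<sigma> y x"
        unfolding anti using K by (simp add: fdg_def G_def field_simps)
    qed
    also have "\<dots> = (\<Sum>i<3. \<Sum>\<rho>\<in>level_words k. cell_sum (\<lambda>x y. G x y * (h i y - h i x)) ((\<sigma> @ [i]) @ \<rho>))"
      unfolding h_def by (rule level_sum_dz_form[OF s])
    also have "\<dots> = (\<Sum>i<3. (3/5)^k * cell_sum (\<lambda>x y. G x y * (h i y - h i x)) (\<sigma> @ [i]))"
      unfolding G_def h_def using s harm
      by (intro sum.cong refl harmonic_triple) (auto simp: harmonic_in_cell_harmonic)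
    also have "\<dots> = (3/5)^k * (1/25 * increment_det f g \<sigma>)"
      unfolding sum_distrib_left[symmetric] G_def h_def
      using dz_triple[OF harmonic_in_at[OF harm(1)[OF s]] harmonic_in_at[OF harm(2)[OF s]]] by simp
    finally show ?thesis unfolding Q_at_def add.commute[of k ?n] by (simp only: power_cancel)
  qed
  have "(\<lambda>k. Q_at (k + ?n) (fdg f g) (dz_form \<sigma>)) \<longlonglongrightarrow> (5/3)^?n * (1/25 * increment_det f g \<sigma>)"
    unfolding const by (rule tendsto_const)
  then have "(\<lambda>m. Q_at m (fdg f g) (dz_form \<sigma>)) \<longlonglongrightarrow> (5/3)^?n * (1/25 * increment_det f g \<sigma>)"
    by (rule LIMSEQ_offset)
  then show ?thesis
    using Q_tendsto[OF fdg_in_Omega1[OF assms(1,2)] dz_form_in_Omega1] LIMSEQ_unique by blast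
qed

lemma harmonic0_harmonic_in:
  assumes "harmonic0 u"
  shows "harmonic_in u []"
  by (rule harmonic0_imp_harmonic_in[OF assms hext_in_FF harmonic_in_hext]) (rule hext_p)

theorem proposition2p34:
  fixes f0 f1 :: "real \<times> real \<Rightarrow> real"
  assumes "harmonic0 f0" and "f0 (p 0) = 1" and "f0 (p 1) = 0" and "f0 (p 2) = 0"
    and "harmonic0 f1" and "f1 (p 1) = 1" and "f1 (p 0) = 0" and "f1 (p 2) = 0"
  shows "\<not> locally_exact (fdg f0 f1) \<and>
    (\<forall>U k. hodge_decomposition (fdg f0 f1) U k \<longrightarrow> (\<forall>\<sigma>\<in>Words. k \<sigma> \<noteq> 0))"
proof -
  have FF: "f0 \<in> FF" "f1 \<in> FF" using assms by (auto simp: harmonic0_def)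
  have harm: "harmonic_in f0 []" "harmonic_in f1 []"
    using harmonic0_harmonic_in assms by blast+
  have O: "fdg f0 f1 \<in> Omega1" using FF by (rule fdg_in_Omega1)
  have det: "increment_det f0 f1 [] = 1"
    using assms by (simp add: increment_det_def)
  have nz: "Q (fdg f0 f1) (dz_form \<sigma>) \<noteq> 0" if "\<sigma> \<in> Words" for \<sigma>
    unfolding Q_fdg_dz_form[OF FF harm that] increment_det_harmonic[OF harm that] det by simp
  have "\<not> n_exact n (fdg f0 f1)" for n
  proof
    assume ex: "n_exact n (fdg f0 f1)"
    \<comment> \<open>Any word of length \<open>n\<close> would serve: exactness provides a
      potential on its whole cell, including a neighbourhood of its lacuna within that cell.\<close>
    have W: "replicate n 0 \<in> Words" by (auto simp: Words_def)
    then have "replicate n 0 \<in> level_words n" by (simp add: level_words_def)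
    from n_exact_edge_integral[OF ex this] obtain F :: "pt \<Rightarrow> real" where
      "\<And>m x y. (x, y) \<in> oedges m \<Longrightarrow> seg (x, y) \<subseteq> cell (replicate n 0) \<Longrightarrow> edge_integral (fdg f0 f1) x y = F y - F x"
      by metis
    from Q_dz_form_exact_around[OF O W this] nz[OF W] show False by simp
  qed
  moreover have "k \<sigma> \<noteq> 0" if "hodge_decomposition (fdg f0 f1) U k" "\<sigma> \<in> Words" for U k \<sigma>
    using hodge_coefficient[OF O that] nz[OF that(2)] by auto
  ultimately show ?thesis unfolding locally_exact_def by blast
qed

end
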